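(* Suppose that the displacements $(X_i : i\ge 1)$ are i.i.d. real random variables satisfying, for some $\alpha>0$, some slowly varying function $L$ and some $q\in[0,1]$, $$\mathbb P(|X_1|>x)=x^{-\alpha}L(x),\qquad \lim_{x\to\infty}\frac{\mathbb P(X_1>x)}{\mathbb P(|X_1|>x)}=q .$$ Let the progeny variable $Z$ satisfy $\mathbb P(Z\ge 1)=1$, $\mu:=\mathbb E(Z)\in(1,\infty)$ and $\mathbb E(Z\log_+Z)<\infty$. Let $(\gamma_n)_{n\ge1}$ be a positive sequence with $b_n=o(\gamma_n)$, where $b_n=\inf\{x:\mathbb P(|X_1|>x)\le\mu^{-n}\}$, let $r_n=(\mu^n\mathbb P(|X_1|>\gamma_n))^{-1}$, and let $\mathbf N_n=\sum_{|\mathsf v|=n}\delta_{\gamma_n^{-1}S(\mathsf v)}$. Then there exists a non-null measure $m^*_{iid}$ on $\mathscr M_0$ such that $$\lim_{n\to\infty}r_n\,\mathbb P(\mathbf N_n\in\mathsf A)=m^*_{iid}(\mathsf A)$$ for every $\mathsf A\in\mathcal B(\mathscr M_0)$ satisfying $m^*_{iid}(\partial\mathsf A)=0$ and $\varnothing\notin\mathrm{cl}(\mathsf A)$. Furthermore, $$m^*_{iid}(\mathsf A)=\sum_{l=0}^\infty\mu^{-l}\,\mathbb E\Big(\nu_\alpha\{x\in\mathbb R: Z_l\,\delta_x\in\mathsf A\}\Big).$$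
   Context: Branching random walk (BRW): it starts with one particle (the root) at position $0$ (generation $0$). After unit time each particle dies and produces, independently of all others, an independent copy of the point process $\mathscr L=\sum_{i=1}^Z\delta_{X_i}$, where $Z$ is a $\{0,1,2,\dots\}$-valued random variable independent of the sequence $(X_i:i\ge1)$. The atoms are the displacements of the children, and the position $S(\mathsf v)$ of a particle $\mathsf v$ is its displacement plus the position of its parent. $|\mathsf v|$ is the generation of $\mathsf v$ and $Z_l$ is the size of the $l$-th generation ($Z_0=1$). $\log_+x=\log(\max(x,1))$; $L$ is slowly varying if $\lim_{t\to\infty}L(tx)/L(t)=1$ for every $x>0$. The measure $\nu_\alpha$ is $$\nu_\alpha(dx)=\alpha q x^{-\alpha-1}\mathbf 1(x>0)\,dx+\alpha(1-q)|x|^{-\alpha-1}\mathbf 1(x<0)\,dx .$$ $\mathbb R_0=\mathbb R\setminus\{0\}$. $\mathscr M(\mathbb R_0)$ is the space of point measures on $\mathbb R_0$ that are finite on every set bounded away from $0$. It carries the vague topology, i.e. the coarsest topology making $\xi\mapsto\int g\,d\xi$ continuous for every $g\in C_c^+(\bar{\mathbb R}_0)$, the nonnegative continuous functions on $\bar{\mathbb R}_0=[-\infty,\infty]\setminus\{0\}$ with compact support (so $g$ vanishes near $0$). $\varnothing$ is the null measure and $\mathscr M_0=\mathscr M(\mathbb R_0)\setminus\{\varnothing\}$. Atoms at $0$ are ignored when a point process is regarded as an element of $\mathscr M(\mathbb R_0)$. $\mathrm{cl}(\mathsf A)$, $\mathrm{int}(\mathsf A)$ are closure and interior in $\mathscr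 M(\mathbb R_0)$, and $\partial\mathsf A=\mathrm{cl}(\mathsf A)\setminus\mathrm{int}(\mathsf A)$. *)

theory Defs
  imports "HOL-Probability.Probability" "HOL-Library.Landau_Symbols"
begin

subsection \<open>Point measures and the vague topology\<close>

definition R0 :: "real measure" where
  "R0 = restrict_space borel (- {0})"

text \<open>The image of counting measure is the sum over \<open>i \<in> I\<close> of the Dirac masses at \<open>x i\<close>.
  The atoms at \<open>0\<close> are dropped.\<close>

definition dirac_sum :: "'i set \<Rightarrow> ('i \<Rightarrow> real) \<Rightarrow> real measure" where
  "dirac_sum I x = distr (count_space {i \<in> I. x i \<noteq> 0}) R0 x"

text \<open>A countable index set suffices: a point measure that is finite on sets bounded away from
  \<open>0\<close> has countably many atoms.\<close>

definition point_measures :: "real measure set" where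
  "point_measures = {\<xi>. (\<exists>(I :: nat set) x. \<xi> = dirac_sum I x) \<and>
     (\<forall>A \<in> sets R0. 0 \<notin> closure A \<longrightarrow> emeasure \<xi> A < \<infinity>)}"

abbreviation ereal0_topology :: "ereal topology" where
  "ereal0_topology \<equiv> top_of_set (- {0})"

text \<open>The values \<open>g 0\<close> of these functions are irrelevant.\<close>

definition test_functions :: "(ereal \<Rightarrow> real) set" where
  "test_functions = {g. continuous_on (- {0}) g \<and> (\<forall>x \<in> - {0}. 0 \<le> g x) \<and>
     compactin ereal0_topology (ereal0_topology closure_of {x \<in> - {0}. g x \<noteq> 0})}"

definition vague_topology :: "real measure topology" where
  "vague_topology = topology_generated_by
     {{\<xi> \<in> point_measures. (\<integral>x. g (ereal x) \<partial>\<xi>) \<in> U} | g U. g \<in> test_functions \<and> open U}"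

abbreviation null_point_measure :: "real measure" where
  "null_point_measure \<equiv> null_measure R0"

definition nonnull_point_measures :: "real measure set" where
  "nonnull_point_measures = point_measures - {null_point_measure}"

definition borel_of :: "'a topology \<Rightarrow> 'a measure" where
  "borel_of T = sigma (topspace T) {U. openin T U}"

abbreviation borel_M0 :: "real measure measure" where
  "borel_M0 \<equiv> borel_of (subtopology vague_topology nonnull_point_measures)"


subsection \<open>Regular variation\<close>

definition slowly_varying :: "(real \<Rightarrow> real) \<Rightarrow> bool" where
  "slowly_varying L \<longleftrightarrow> (\<forall>x>0. ((\<lambda>t. L (t * x) / L t) \<longlongrightarrow> 1) at_top)"

definition log_plus :: "real \<Rightarrow> real" where
  "log_plus x = ln (max x 1)"

definition nu :: "real \<Rightarrow> real \<Rightarrow> real measure" where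
  "nu \<alpha> q = density lborel (\<lambda>x. ennreal
     (\<alpha> * q * x powr (- \<alpha> - 1) * indicator {0<..} x
      + \<alpha> * (1 - q) * \<bar>x\<bar> powr (- \<alpha> - 1) * indicator {..<0} x))"


subsection \<open>Branching random walks\<close>

text \<open>Same as \<^const>\<open>prob_space.indep_var\<close>, which requires both random variables to have the
  same type.\<close>

definition indep_rv ::
    "'a measure \<Rightarrow> 'b measure \<Rightarrow> ('a \<Rightarrow> 'b) \<Rightarrow> 'c measure \<Rightarrow> ('a \<Rightarrow> 'c) \<Rightarrow> bool" where
  "indep_rv M S X T Y \<longleftrightarrow> X \<in> measurable M S \<and> Y \<in> measurable M T \<and>
     prob_space.indep_set M {X -` A \<inter> space M | A. A \<in> sets S} {Y -` B \<inter> space M | B. B \<in> sets T}"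

text \<open>A reproduction \<open>(z, x)\<close> consists of the number \<open>z\<close> of children and the sequence \<open>x\<close> of
  displacements. Only the entries \<open>x i\<close> with \<open>i < z\<close> are used: sequences are indexed from
  \<open>0\<close>, so \<open>x i\<close> is the displacement of the \<open>(i + 1)\<close>-st child.\<close>

type_synonym reproduction = "nat \<times> (nat \<Rightarrow> real)"

abbreviation reproduction_space :: "reproduction measure" where
  "reproduction_space \<equiv> count_space UNIV \<Otimes>\<^sub>M PiM UNIV (\<lambda>_. borel)"

definition reproduction_law ::
    "'a measure \<Rightarrow> ('a \<Rightarrow> nat) \<Rightarrow> (nat \<Rightarrow> 'a \<Rightarrow> real) \<Rightarrow> reproduction measure" where
  "reproduction_law P Z X = distr P reproduction_space (\<lambda>\<omega>. (Z \<omega>, \<lambda>i. X i \<omega>))"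

text \<open>Particles carry Ulam-Harris labels, read from the youngest generation back to the oldest:
  \<open>[]\<close> is the root and \<open>i # v\<close> is a child of \<open>v\<close>. The generation of \<open>v\<close> is its length.
  The function \<open>e\<close> assigns a reproduction to every potential particle.\<close>

inductive_set particles :: "(nat list \<Rightarrow> reproduction) \<Rightarrow> nat list set"
  for e :: "nat list \<Rightarrow> reproduction" where
  root: "[] \<in> particles e"
| child: "v \<in> particles e \<Longrightarrow> i < fst (e v) \<Longrightarrow> i # v \<in> particles e"

definition generation :: "(nat list \<Rightarrow> reproduction) \<Rightarrow> nat \<Rightarrow> nat list set" where
  "generation e n = {v \<in> particles e. length v = n}"

primrec position :: "(nat list \<Rightarrow> reproduction) \<Rightarrow> nat list \<Rightarrow> real" where
  "position e [] = 0"
| "position e (i # v) = position e v + snd (e v) i"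

definition branching_random_walk ::
    "reproduction measure \<Rightarrow> 'b measure \<Rightarrow> (nat list \<Rightarrow> 'b \<Rightarrow> reproduction) \<Rightarrow> bool" where
  "branching_random_walk Q M E \<longleftrightarrow>
     prob_space.indep_vars M (\<lambda>_. reproduction_space) E UNIV \<and>
     (\<forall>v. distr M reproduction_space (E v) = Q)"

definition scaled_generation ::
    "(nat list \<Rightarrow> 'b \<Rightarrow> reproduction) \<Rightarrow> real \<Rightarrow> nat \<Rightarrow> 'b \<Rightarrow> real measure" where
  "scaled_generation E c n \<omega> =
     (let e = (\<lambda>v. E v \<omega>) in dirac_sum (generation e n) (\<lambda>v. position e v / c))"

definition generation_size :: "(nat list \<Rightarrow> 'b \<Rightarrow> reproduction) \<Rightarrow> nat \<Rightarrow> 'b \<Rightarrow> nat" where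
  "generation_size E n \<omega> = card (generation (\<lambda>v. E v \<omega>) n)"


subsection \<open>Basic facts\<close>

lemma (in prob_space) indep_rv_eq_indep_var: "indep_rv M S X T Y \<longleftrightarrow> indep_var S X T Y"
proof -
  have "(case_bool {X -` A \<inter> space M | A. A \<in> sets S} {Y -` B \<inter> space M | B. B \<in> sets T}) =
      (\<lambda>i. {case_bool X Y i -` A \<inter> space M | A. A \<in> sets (case_bool S T i)})"
    by (rule ext) (simp split: bool.split)
  then show ?thesis
    by (simp add: indep_rv_def indep_var_def indep_vars_def2 indep_set_def UNIV_bool)
      (auto split: bool.split)
qed

lemma sets_dirac_sum [simp]: "sets (dirac_sum I x) = sets R0"
  and space_dirac_sum [simp]: "space (dirac_sum I x) = - {0}"
  by (simp_all add: dirac_sum_def R0_def space_restrict_space)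

lemma emeasure_dirac_sum:
  assumes "A \<in> sets R0"
  shows "emeasure (dirac_sum I x) A = emeasure (count_space UNIV) {i \<in> I. x i \<in> A}"
proof -
  have "A \<subseteq> - {0}"
    using sets.sets_into_space[OF assms] by (simp add: R0_def space_restrict_space)
  then have "x -` A \<inter> {i \<in> I. x i \<noteq> 0} = {i \<in> I. x i \<in> A}"
    by auto
  moreover have "x \<in> measurable (count_space {i \<in> I. x i \<noteq> 0}) R0"
    by (auto simp: R0_def space_restrict_space)
  ultimately have "emeasure (dirac_sum I x) A =
      emeasure (count_space {i \<in> I. x i \<noteq> 0}) {i \<in> I. x i \<in> A}"
    using assms by (simp add: dirac_sum_def emeasure_distr)
  also have "\<dots> = emeasure (count_space UNIV) {i \<in> I. x i \<in> A}"
    using \<open>A \<subseteq> - {0}\<close> by (subst (1 2) emeasure_count_space) auto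
  finally show ?thesis .
qed

lemma dirac_sum_finite_in_point_measures:
  assumes "finite I"
  shows "dirac_sum I x \<in> point_measures"
proof -
  obtain f :: "nat \<Rightarrow> 'a" where f: "bij_betw f {..<card I} I"
    using assms bij_betw_from_nat_into_finite by blast
  have "dirac_sum I x = dirac_sum {..<card I} (x \<circ> f)"
  proof (rule measure_eqI)
    fix A assume "A \<in> sets (dirac_sum I x)"
    then have A: "A \<in> sets R0" by simp
    have "bij_betw f {i \<in> {..<card I}. x (f i) \<in> A} {i \<in> I. x i \<in> A}"
      using f by (auto simp: bij_betw_def inj_on_def)
    then have "card {i \<in> {..<card I}. x (f i) \<in> A} = card {i \<in> I. x i \<in> A}"
      by (rule bij_betw_same_card)
    then show "emeasure (dirac_sum I x) A = emeasure (dirac_sum {..<card I} (x \<circ> f)) A"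
      using A assms by (simp add: emeasure_dirac_sum)
  qed simp
  moreover have "emeasure (dirac_sum I x) A < \<infinity>" if "A \<in> sets R0" for A
    using that assms by (simp add: emeasure_dirac_sum of_nat_less_top)
  ultimately show ?thesis
    unfolding point_measures_def by blast
qed

lemma null_point_measure_eq: "null_point_measure = dirac_sum {} x"
  by (rule measure_eqI) (auto simp: emeasure_dirac_sum)

lemma null_point_measure_in [simp]: "null_point_measure \<in> point_measures"
  unfolding null_point_measure_eq[where 'a = nat and x = "\<lambda>_. 0"]
  by (rule dirac_sum_finite_in_point_measures) simp

lemma topspace_vague [simp]: "topspace vague_topology = point_measures"
proof -
  have "(\<lambda>_. 0) \<in> test_functions"
    by (simp add: test_functions_def)
  then have "point_measures \<in>
      {{\<xi> \<in> point_measures. (\<integral>x. g (ereal x) \<partial>\<xi>) \<in> U} | g U. g \<in> test_functions \<and> open U}"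
    by (intro CollectI exI[of _ "\<lambda>_. 0"] exI[of _ UNIV]) auto
  then show ?thesis
    unfolding vague_topology_def topology_generated_by_topspace by blast
qed

lemma space_borel_M0: "space borel_M0 = nonnull_point_measures"
  by (auto simp: borel_of_def space_measure_of_conv nonnull_point_measures_def)

lemma finite_generation: "finite (generation e n)"
proof (induction n)
  case (Suc n)
  have "generation e (Suc n) \<subseteq> (\<Union>v \<in> generation e n. (\<lambda>i. i # v) ` {..<fst (e v)})"
    by (force simp: generation_def elim: particles.cases)
  then show ?case
    by (rule finite_subset) (use Suc in auto)
qed (auto simp: generation_def)

lemma scaled_generation_in_point_measures: "scaled_generation E c n \<omega> \<in> point_measures"
  by (simp add: scaled_generation_def Let_def dirac_sum_finite_in_point_measures finite_generation)

lemma scale_return_eq_dirac_sum: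
  "scale_measure (of_nat k) (return R0 x) = dirac_sum {..<k} (\<lambda>_. x)"
  by (rule measure_eqI) (auto simp: emeasure_dirac_sum indicator_def)

end

theory Submission
  imports Defs
begin

text \<open>The theorem is an instance of the principle of one big jump. Write \<open>T x\<close> for the tail
\<open>P(|X| > x)\<close>. Generation \<open>n\<close> has about \<open>\<mu>\<^sup>n\<close> particles, so the number of edges of the tree whose
displacement exceeds a multiple of \<open>\<gamma> n\<close> has expectation of order \<open>\<mu>\<^sup>n T(\<gamma> n)\<close>, which is the reciprocal of the
rate \<open>r n\<close> and tends to \<open>0\<close> because \<open>b n = o(\<gamma> n)\<close>. Up to events of smaller order there is at most one such edge,
and everything else is invisible on the scale \<open>\<gamma> n\<close>. If the edge leads to generation \<open>n - l\<close>, then the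
configuration of generation \<open>n\<close> is close to \<open>k \<delta>\<^sub>x\<close>, where \<open>x\<close> is the scaled displacement and \<open>k\<close> is the
number of descendants \<open>l\<close> generations later, which has the law of \<open>Z\<^sub>l\<close>. There are \<open>\<mu>\<^sup>n\<^sup>-\<^sup>l\<close> such edges on average and
\<open>T(\<gamma> n)\<^sup>-\<^sup>1 P(X / \<gamma> n \<in> \<sqdot>)\<close> converges vaguely to \<open>\<nu>\<^sub>\<alpha>\<close>; summation over \<open>l\<close> gives the limit measure.

Two error terms have to be of smaller order than \<open>\<mu>\<^sup>n T(\<gamma> n)\<close>. The first is that one line of descent contains two
displacements above a threshold \<open>a n\<close> with \<open>n a n = o(\<gamma> n)\<close>; its expected number of occurrences is at most
\<open>\<mu>\<^sup>n (n T(a n))\<^sup>2\<close> (\<open>nn_integral_jumps_le\<close>), and since \<open>\<gamma> n\<close> grows exponentially, \<open>a n\<close> can be chosen so that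
\<open>(n T(a n))\<^sup>2 = o(T(\<gamma> n))\<close> (\<open>threshold_exists\<close>). Outside this event a particle without a big displacement in its
ancestry stays near \<open>0\<close>, and the other particles stay near that displacement (\<open>one_big_jump\<close>).
The second is that two different edges carry big displacements. Here the first moment must be compared
with the probability that a big displacement exists. That probability solves a recursion through the generating
function of \<open>Z\<close>, and its defect relative to the first moment is controlled by \<open>E(Z ln(1 + \<epsilon> Z))\<close> with \<open>\<epsilon>\<close> of
order \<open>\<mu>\<^sup>n T(\<gamma> n)\<close> (\<open>big_mean_minus_prob_le\<close>); it tends to \<open>0\<close> by dominated convergence, and this is the place
where \<open>E(Z log\<^sub>+ Z) < \<infinity>\<close> enters.

All expectations are computed by decomposing the tree at the root: the subtrees of the children are independent
copies of the whole tree. The convergence is then obtained as in the portmanteau theorem. For open sets the lower bound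
follows from Fatou's lemma (\<open>limit_mass_le_liminf\<close>). For closed sets the upper bound
follows by complementation inside the set of configurations that charge \<open>{|x| > \<delta>}\<close>, for which a union bound is
sharp (\<open>limsup_far_le\<close>). The topology of the space of point measures enters only through finite configurations: an
open set that contains \<open>k \<delta>\<^sub>x\<close> contains all finite configurations with \<open>k\<close> atoms close to \<open>x\<close> and the others
close to \<open>0\<close> (\<open>stable_under_perturbation\<close>).\<close>

section \<open>Finite configurations in the vague topology\<close>

text \<open>The value of a test function at \<open>0\<close> is arbitrary. Setting it to \<open>0\<close> gives a continuous function on the
line, so that integrals against finite configurations become sums over all atoms, those at \<open>0\<close> included.\<close>

definition zero_ext :: "(ereal \<Rightarrow> real) \<Rightarrow> real \<Rightarrow> real" where
  "zero_ext g x = (if x = 0 then 0 else g (ereal x))"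

text \<open>The support is compact and hence closed in the extended line, and it misses \<open>0\<close>.\<close>

lemma test_function_vanishes_near_0:
  assumes "g \<in> test_functions"
  obtains \<delta> where "\<delta> > 0" "\<And>x. \<bar>x\<bar> \<le> \<delta> \<Longrightarrow> zero_ext g x = 0"
proof -
  let ?K = "ereal0_topology closure_of {x \<in> - {0}. g x \<noteq> 0}"
  have K: "compactin ereal0_topology ?K"
    using assms by (simp add: test_functions_def)
  then have cpt: "compact ?K" and K0: "?K \<subseteq> - {0}"
    by (auto simp: compactin_subtopology)
  have "open (- ?K)"
    by (rule open_Compl[OF compact_imp_closed[OF cpt]])
  then have "open (ereal -` (- ?K))"
    by (intro open_vimage) (auto intro: continuous_on_ereal)
  moreover have "0 \<in> ereal -` (- ?K)"
    using K0 by (auto simp: zero_ereal_def)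
  ultimately obtain d where d: "d > 0" "\<And>x. dist x 0 < d \<Longrightarrow> ereal x \<notin> ?K"
    unfolding open_dist by blast
  have "zero_ext g x = 0" if "\<bar>x\<bar> \<le> d / 2" for x
  proof (rule ccontr)
    assume "zero_ext g x \<noteq> 0"
    then have "x \<noteq> 0" "g (ereal x) \<noteq> 0"
      by (auto simp: zero_ext_def split: if_splits)
    then have "ereal x \<in> {x \<in> - {0}. g x \<noteq> 0}"
      by (auto simp: zero_ereal_def)
    then have "ereal x \<in> ?K"
      by (intro subsetD[OF closure_of_subset]) auto
    then show False
      using d that by (auto simp: dist_real_def)
  qed
  then show thesis
    using that[of "d / 2"] d(1) by auto
qed

lemma continuous_on_zero_ext:
  assumes "g \<in> test_functions"
  shows "continuous_on UNIV (zero_ext g)"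
proof -
  obtain \<delta> where \<delta>: "\<delta> > 0" "\<And>x. \<bar>x\<bar> \<le> \<delta> \<Longrightarrow> zero_ext g x = 0"
    using test_function_vanishes_near_0[OF assms] by blast
  have *: "continuous_on (- {0}) (\<lambda>x. g (ereal x))"
    by (rule continuous_on_compose2[of "- {0}" g])
      (use assms in \<open>auto simp: test_functions_def zero_ereal_def intro: continuous_on_ereal\<close>)
  have 1: "continuous_on (- {0}) (zero_ext g)"
    by (rule continuous_on_eq[OF *]) (auto simp: zero_ext_def)
  have 2: "continuous_on {-\<delta><..<\<delta>} (zero_ext g)"
    by (rule continuous_on_eq[of _ "\<lambda>_. 0"]) (use \<delta>(2) in auto)
  have "continuous_on (- {0} \<union> {-\<delta><..<\<delta>}) (zero_ext g)"
    by (rule continuous_on_open_Un[OF _ _ 1 2]) auto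
  moreover have "- {0} \<union> {-\<delta><..<\<delta>} = UNIV"
    using \<delta>(1) by auto
  ultimately show ?thesis by simp
qed

lemma integral_dirac_sum:
  assumes "g \<in> test_functions" and "finite I"
  shows "(\<integral>x. g (ereal x) \<partial>dirac_sum I y) = (\<Sum>i\<in>I. zero_ext g (y i))"
proof -
  let ?J = "{i \<in> I. y i \<noteq> 0}"
  have "zero_ext g \<in> borel_measurable R0"
    using borel_measurable_continuous_onI[OF continuous_on_zero_ext[OF assms(1)]]
    by (simp add: R0_def measurable_restrict_space1)
  then have meas: "(\<lambda>x. g (ereal x)) \<in> borel_measurable R0"
    by (rule measurable_cong[THEN iffD1, rotated])
      (auto simp: R0_def space_restrict_space zero_ext_def)
  have "(\<integral>x. g (ereal x) \<partial>dirac_sum I y) = (\<integral>i. g (ereal (y i)) \<partial>count_space ?J)"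
    unfolding dirac_sum_def
    by (rule integral_distr[OF _ meas]) (auto simp: R0_def space_restrict_space)
  also have "\<dots> = (\<Sum>i\<in>?J. zero_ext g (y i))"
    using assms(2) by (subst lebesgue_integral_count_space_finite) (auto simp: zero_ext_def)
  also have "\<dots> = (\<Sum>i\<in>I. zero_ext g (y i))"
    by (rule sum.mono_neutral_left) (use assms(2) in \<open>auto simp: zero_ext_def\<close>)
  finally show ?thesis .
qed

lemma dirac_sum_eq_null_iff:
  assumes "finite I"
  shows "dirac_sum I y = null_point_measure \<longleftrightarrow> (\<forall>i\<in>I. y i = 0)"
proof
  assume *: "dirac_sum I y = null_point_measure"
  have S: "- {0} \<in> sets R0"
    by (auto simp: R0_def sets_restrict_space intro!: image_eqI[of _ _ UNIV])
  have "card {i \<in> I. y i \<noteq> 0} = 0"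
    using emeasure_dirac_sum[OF S, of I y] assms by (simp add: *)
  then show "\<forall>i\<in>I. y i = 0"
    using assms by simp
next
  assume "\<forall>i\<in>I. y i = 0"
  then have "{i \<in> I. y i \<noteq> 0} = {}" by auto
  have "emeasure (dirac_sum I y) A = 0" if A: "A \<in> sets R0" for A
  proof -
    have "0 \<notin> A" using sets.sets_into_space[OF A] by (auto simp: R0_def space_restrict_space)
    then have "{i \<in> I. y i \<in> A} = {}"
      using \<open>\<forall>i\<in>I. y i = 0\<close> by auto
    then show ?thesis
      by (simp only: emeasure_dirac_sum[OF A] emeasure_empty)
  qed
  then show "dirac_sum I y = null_point_measure"
    by (intro measure_eqI) auto
qed

text \<open>Induction over the generation of the topology from its subbasis; it turns a property that survives finite
intersections and arbitrary unions into a property of all open sets.\<close>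

lemma openin_vague_induct [consumes 1, case_names Empty Int Union Basis]:
  assumes "openin vague_topology W"
    and "Q {}"
    and "\<And>U V. Q U \<Longrightarrow> Q V \<Longrightarrow> Q (U \<inter> V)"
    and "\<And>\<K>. (\<And>U. U \<in> \<K> \<Longrightarrow> Q U) \<Longrightarrow> Q (\<Union>\<K>)"
    and "\<And>g V. g \<in> test_functions \<Longrightarrow> open V \<Longrightarrow> Q {\<xi> \<in> point_measures. (\<integral>x. g (ereal x) \<partial>\<xi>) \<in> V}"
  shows "Q W"
  using openin_topology_generated_by[OF assms(1)[unfolded vague_topology_def]]
proof (induction rule: generate_topology_on.induct)
  case (Basis U)
  then show ?case using assms(5) by blast
next
  case (Int U V)
  from assms(3)[OF Int(3,4)] show ?case .
next
  case (UN \<K>)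
  from assms(4)[OF UN(2)] show ?case .
qed (fact assms(2))

text \<open>For finitely many atoms the configuration depends continuously on their positions. This is what makes events
about configurations measurable although the subbasis of the topology is uncountable: preimages of open sets are
open sets of positions.\<close>

lemma open_dirac_sum_vimage:
  fixes f :: "'b::topological_space \<Rightarrow> 'i \<Rightarrow> real"
  assumes "openin vague_topology W" and "finite I" and "\<And>i. continuous_on UNIV (\<lambda>a. f a i)"
  shows "open {a. dirac_sum I (f a) \<in> W}"
  using assms(1)
proof (induction rule: openin_vague_induct)
  case (Int U V)
  then show ?case using open_Int[OF Int] by (simp add: Int_def)
next
  case (Union \<K>)
  have "{a. dirac_sum I (f a) \<in> \<Union>\<K>} = (\<Union>U\<in>\<K>. {a. dirac_sum I (f a) \<in> U})" by auto
  then show ?case using Union by auto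
next
  case (Basis g V)
  have "continuous_on UNIV (\<lambda>a. \<Sum>i\<in>I. zero_ext g (f a i))"
    by (intro continuous_on_sum continuous_on_compose2[OF continuous_on_zero_ext[OF Basis(1)]] assms) auto
  from open_vimage[OF Basis(2) this] show ?case
    using assms(2) by (simp add: dirac_sum_finite_in_point_measures integral_dirac_sum[OF Basis(1)] vimage_def)
qed simp

lemma sets_borel_M0:
  "sets borel_M0 = sigma_sets nonnull_point_measures
     {U. openin (subtopology vague_topology nonnull_point_measures) U}"
proof -
  have "topspace (subtopology vague_topology nonnull_point_measures) = nonnull_point_measures"
    by (auto simp: nonnull_point_measures_def)
  moreover have "{U. openin T U} \<subseteq> Pow (topspace T)" for T :: "real measure topology"
    using openin_subset by blast
  ultimately show ?thesis
    unfolding borel_of_def by (metis (no_types) sets_measure_of)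
qed

lemma open_in_sets_borel_M0:
  assumes "openin vague_topology W" and "null_point_measure \<notin> W"
  shows "W \<in> sets borel_M0"
proof -
  have "W \<inter> nonnull_point_measures = W"
    using assms openin_subset[OF assms(1)] by (auto simp: nonnull_point_measures_def)
  then have "openin (subtopology vague_topology nonnull_point_measures) W"
    using openin_subtopology_Int[OF assms(1), of nonnull_point_measures] by simp
  then show ?thesis by (simp add: sets_borel_M0 sigma_sets.Basic)
qed

lemma closed_in_sets_borel_M0:
  assumes "closedin vague_topology F" and "null_point_measure \<notin> F"
  shows "F \<in> sets borel_M0"
proof -
  have "openin (subtopology vague_topology nonnull_point_measures)
      ((point_measures - F) \<inter> nonnull_point_measures)"
    using assms(1) by (intro openin_subtopology_Int) (simp add: closedin_def)
  then have *: "(point_measures - F) \<inter> nonnull_point_measures \<in> sets borel_M0"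
    by (simp add: sets_borel_M0 sigma_sets.Basic)
  have eq: "nonnull_point_measures - (point_measures - F) \<inter> nonnull_point_measures = F"
    using closedin_subset[OF assms(1)] assms(2)
    unfolding topspace_vague nonnull_point_measures_def by blast
  show ?thesis
    using sets.compl_sets[OF *] unfolding space_borel_M0 eq .
qed

lemma borel_dirac_sum_vimage:
  fixes f :: "'b::topological_space \<Rightarrow> 'i \<Rightarrow> real"
  assumes "A \<in> sets borel_M0" and I: "finite I" and f: "\<And>i. continuous_on UNIV (\<lambda>a. f a i)"
  shows "{a. dirac_sum I (f a) \<in> A} \<in> sets borel"
proof -
  have "closed (\<Inter>i\<in>I. {a. f a i = 0})"
    by (intro closed_INT ballI closed_Collect_eq f) auto
  moreover have "(\<Inter>i\<in>I. {a. f a i = 0}) = {a. dirac_sum I (f a) = null_point_measure}"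
    by (auto simp: dirac_sum_eq_null_iff[OF I])
  ultimately have "closed {a. dirac_sum I (f a) = null_point_measure}" by simp
  then have null: "{a. dirac_sum I (f a) \<noteq> null_point_measure} \<in> sets borel"
    by (auto simp: Collect_neg_eq)
  have M0: "dirac_sum I (f a) \<in> nonnull_point_measures \<longleftrightarrow> dirac_sum I (f a) \<noteq> null_point_measure" for a
    using I by (simp add: nonnull_point_measures_def dirac_sum_finite_in_point_measures)
  show ?thesis
    using assms(1) unfolding sets_borel_M0
  proof (induction rule: sigma_sets.induct)
    case (Basic U)
    then obtain W where W: "openin vague_topology W" "U = W \<inter> nonnull_point_measures"
      by (auto simp: openin_subtopology)
    have "{a. dirac_sum I (f a) \<in> W} \<in> sets borel"
      by (intro borel_open open_dirac_sum_vimage W I f)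
    from sets.Int[OF this null] show ?case
      by (simp add: W(2) M0 Int_def)
  next
    case (Compl U)
    have "{a. dirac_sum I (f a) \<in> nonnull_point_measures - U} =
        {a. dirac_sum I (f a) \<noteq> null_point_measure} - {a. dirac_sum I (f a) \<in> U}"
      by (auto simp: M0)
    then show ?case using Compl null by auto
  next
    case (Union U)
    have "{a. dirac_sum I (f a) \<in> (\<Union>i. U i)} = (\<Union>i. {a. dirac_sum I (f a) \<in> U i})"
      by auto
    then show ?case using Union by auto
  next
    case Empty
    show ?case by simp
  qed
qed

text \<open>A test function does not see atoms that are close to \<open>0\<close>, and by continuity its values at \<open>k\<close> atoms near \<open>x\<close>
add up to almost \<open>k\<close> times its value at \<open>x\<close>. So the claim holds for subbasic sets, and it is inherited by
finite intersections and unions. The bound \<open>\<eta>\<close> is uniform in the total number of atoms, which is unbounded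
in the application.\<close>

lemma stable_under_perturbation:
  assumes "openin vague_topology W" and "dirac_sum {..<k} (\<lambda>_. x) \<in> W"
  obtains \<eta> where "\<eta> > 0"
    "\<And>(I :: 'i set) D y. finite I \<Longrightarrow> D \<subseteq> I \<Longrightarrow> card D = k \<Longrightarrow> \<forall>i\<in>D. \<bar>y i - x\<bar> \<le> \<eta> \<Longrightarrow>
       \<forall>i\<in>I - D. \<bar>y i\<bar> \<le> \<eta> \<Longrightarrow> dirac_sum I y \<in> W"
proof -
  define near where "near \<eta> I D y \<longleftrightarrow> finite I \<and> D \<subseteq> I \<and> card D = k \<and>
    (\<forall>i\<in>D. \<bar>y i - x\<bar> \<le> \<eta>) \<and> (\<forall>i\<in>I - D. \<bar>y i\<bar> \<le> \<eta>)" for \<eta> :: real and I D :: "'i set" and y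
  have near_mono: "near \<eta>' I D y" if "near \<eta> I D y" "\<eta> \<le> \<eta>'" for \<eta> \<eta>' I D y
  proof -
    have "\<bar>y i - x\<bar> \<le> \<eta>'" if "i \<in> D" for i
      using \<open>near \<eta> I D y\<close> that \<open>\<eta> \<le> \<eta>'\<close> unfolding near_def by (meson dual_order.trans)
    moreover have "\<bar>y i\<bar> \<le> \<eta>'" if "i \<in> I - D" for i
      using \<open>near \<eta> I D y\<close> that \<open>\<eta> \<le> \<eta>'\<close> unfolding near_def by (meson dual_order.trans)
    ultimately show ?thesis
      using \<open>near \<eta> I D y\<close> by (simp add: near_def)
  qed
  have "dirac_sum {..<k} (\<lambda>_. x) \<in> W \<longrightarrow> (\<exists>\<eta>>0. \<forall>I D y. near \<eta> I D y \<longrightarrow> dirac_sum I y \<in> W)"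
    using assms(1)
  proof (induction rule: openin_vague_induct)
    case (Int U V)
    show ?case
    proof
      assume "dirac_sum {..<k} (\<lambda>_. x) \<in> U \<inter> V"
      then obtain \<eta>1 \<eta>2 where *: "\<eta>1 > 0" "\<eta>2 > 0" "\<And>I D y. near \<eta>1 I D y \<Longrightarrow> dirac_sum I y \<in> U"
          "\<And>I D y. near \<eta>2 I D y \<Longrightarrow> dirac_sum I y \<in> V"
        using Int by auto
      show "\<exists>\<eta>>0. \<forall>I D y. near \<eta> I D y \<longrightarrow> dirac_sum I y \<in> U \<inter> V"
      proof (intro exI[of _ "min \<eta>1 \<eta>2"] conjI allI impI IntI)
        show "0 < min \<eta>1 \<eta>2" using * by simp
        fix I D y assume "near (min \<eta>1 \<eta>2) I D y"
        then show "dirac_sum I y \<in> U" "dirac_sum I y \<in> V"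
          by (auto intro!: *(3,4) elim!: near_mono)
      qed
    qed
  next
    case (Union \<K>)
    show ?case
    proof
      assume "dirac_sum {..<k} (\<lambda>_. x) \<in> \<Union>\<K>"
      then obtain U where "U \<in> \<K>" "dirac_sum {..<k} (\<lambda>_. x) \<in> U" by blast
      with Union[of U] obtain \<eta> where "\<eta> > 0" "\<forall>I D y. near \<eta> I D y \<longrightarrow> dirac_sum I y \<in> U" by auto
      with \<open>U \<in> \<K>\<close> show "\<exists>\<eta>>0. \<forall>I D y. near \<eta> I D y \<longrightarrow> dirac_sum I y \<in> \<Union>\<K>"
        by (intro exI[of _ \<eta>]) auto
    qed
  next
    case (Basis g V)
    obtain \<delta> where \<delta>: "\<delta> > 0" "\<And>x. \<bar>x\<bar> \<le> \<delta> \<Longrightarrow> zero_ext g x = 0"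
      using test_function_vanishes_near_0[OF Basis(1)] by blast
    show ?case
    proof
      assume "dirac_sum {..<k} (\<lambda>_. x) \<in> {\<xi> \<in> point_measures. (\<integral>x. g (ereal x) \<partial>\<xi>) \<in> V}"
      then have "real k * zero_ext g x \<in> V"
        by (simp add: integral_dirac_sum[OF Basis(1)])
      then obtain e where e: "e > 0" "\<And>z. \<bar>z - real k * zero_ext g x\<bar> < e \<Longrightarrow> z \<in> V"
        using Basis(2) unfolding open_dist dist_real_def by metis
      define e' where "e' = e / (real k + 1)"
      have "e' > 0" using e by (simp add: e'_def)
      have "isCont (zero_ext g) x"
        using continuous_on_zero_ext[OF Basis(1)] by (simp add: continuous_on_eq_continuous_at)
      then obtain d where d: "d > 0" "\<And>z. \<bar>z - x\<bar> < d \<Longrightarrow> \<bar>zero_ext g z - zero_ext g x\<bar> < e'"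
        using \<open>e' > 0\<close> unfolding continuous_at_eps_delta dist_real_def by metis
      show "\<exists>\<eta>>0. \<forall>I D y. near \<eta> I D y \<longrightarrow>
          dirac_sum I y \<in> {\<xi> \<in> point_measures. (\<integral>x. g (ereal x) \<partial>\<xi>) \<in> V}"
      proof (intro exI[of _ "min \<delta> (d / 2)"] conjI allI impI)
        show "0 < min \<delta> (d / 2)" using \<delta> d by simp
        fix I D :: "'i set" and y assume "near (min \<delta> (d / 2)) I D y"
        then have I: "finite I" "D \<subseteq> I" "card D = k"
          and D: "\<And>i. i \<in> D \<Longrightarrow> \<bar>y i - x\<bar> \<le> min \<delta> (d / 2)"
          and D': "\<And>i. i \<in> I - D \<Longrightarrow> \<bar>y i\<bar> \<le> min \<delta> (d / 2)"
          by (auto simp: near_def)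
        have "(\<Sum>i\<in>I. zero_ext g (y i)) = (\<Sum>i\<in>D. zero_ext g (y i))"
          by (rule sum.mono_neutral_right) (use I D' \<delta> in auto)
        then have "\<bar>(\<Sum>i\<in>I. zero_ext g (y i)) - real k * zero_ext g x\<bar> =
            \<bar>\<Sum>i\<in>D. zero_ext g (y i) - zero_ext g x\<bar>"
          using I by (simp add: sum_subtractf)
        also have "\<dots> \<le> (\<Sum>i\<in>D. \<bar>zero_ext g (y i) - zero_ext g x\<bar>)" by (rule sum_abs)
        also have "\<dots> \<le> (\<Sum>i\<in>D. e')"
        proof (rule sum_mono)
          fix i assume "i \<in> D"
          then have "\<bar>y i - x\<bar> < d" using D[of i] d(1) by linarith
          then show "\<bar>zero_ext g (y i) - zero_ext g x\<bar> \<le> e'" using d(2) less_imp_le by blast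
        qed
        also have "\<dots> < e"
          using e I by (simp add: e'_def field_simps)
        finally have "(\<Sum>i\<in>I. zero_ext g (y i)) \<in> V" by (rule e(2))
        then show "dirac_sum I y \<in> {\<xi> \<in> point_measures. (\<integral>x. g (ereal x) \<partial>\<xi>) \<in> V}"
          using I by (simp add: dirac_sum_finite_in_point_measures integral_dirac_sum[OF Basis(1)])
      qed
    qed
  qed simp
  with assms(2) obtain \<eta> where "\<eta> > 0" "\<And>I D y. near \<eta> I D y \<Longrightarrow> dirac_sum I y \<in> W" by auto
  then show thesis
    by (intro that[of \<eta>]) (auto simp: near_def)
qed

text \<open>The function \<open>min 1 (max 0 (|x| - \<delta>))\<close>, written such that its continuity on the extended line is evident. Its
integral is positive for exactly the configurations that charge \<open>{|x| > \<delta>}\<close>, which makes the set of these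
configurations open.\<close>

definition far_test :: "real \<Rightarrow> ereal \<Rightarrow> real" where
  "far_test \<delta> x = max 0 (real_of_ereal (min (ereal (\<delta> + 1)) (max x (- x))) - \<delta>)"

definition far :: "real \<Rightarrow> real measure set" where
  "far \<delta> = {\<xi> \<in> point_measures. (\<integral>x. far_test \<delta> (ereal x) \<partial>\<xi>) \<in> {0<..}}"

lemma zero_ext_far_test: "\<delta> > 0 \<Longrightarrow> zero_ext (far_test \<delta>) x = max 0 (min (\<delta> + 1) \<bar>x\<bar> - \<delta>)"
  by (auto simp: zero_ext_def far_test_def abs_real_def max_def min_def)

lemma far_test_in_test_functions:
  assumes "\<delta> > 0"
  shows "far_test \<delta> \<in> test_functions"
proof -
  let ?m = "\<lambda>x :: ereal. min (ereal (\<delta> + 1)) (max x (- x))"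
  have fin: "?m x \<in> UNIV - {\<infinity>, - \<infinity>}" for x
    using assms by (cases x) (auto simp: min_def max_def)
  have "continuous_on UNIV ?m"
    by (intro continuous_on_min continuous_on_max continuous_intros)
  then have "continuous_on UNIV (\<lambda>x. real_of_ereal (?m x))"
    by (rule continuous_on_compose2[OF continuous_on_real]) (rule image_subsetI, rule fin)
  then have cont: "continuous_on UNIV (far_test \<delta>)"
    unfolding far_test_def by (intro continuous_intros)
  let ?K = "{x. x \<le> - ereal \<delta>} \<union> {x. ereal \<delta> \<le> x}"
  have "closed ?K"
    by (intro closed_Un closed_Collect_le continuous_intros)
  then have "compact ?K"
    by (rule compact_Int_closed[OF compact_UNIV, simplified])
  moreover have K0: "?K \<subseteq> - {0}"
    using assms by auto
  ultimately have K: "compactin ereal0_topology ?K"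
    by (simp add: compactin_subtopology)
  have "closedin ereal0_topology ?K"
    using \<open>closed ?K\<close> K0 by (simp add: closed_subset)
  moreover have "{x \<in> - {0}. far_test \<delta> x \<noteq> 0} \<subseteq> ?K"
  proof
    fix x assume "x \<in> {x \<in> - {0}. far_test \<delta> x \<noteq> 0}"
    then show "x \<in> ?K"
      using assms by (cases x) (auto simp: far_test_def max_def min_def split: if_splits)
  qed
  ultimately have "ereal0_topology closure_of {x \<in> - {0}. far_test \<delta> x \<noteq> 0} \<subseteq> ?K"
    by (intro closure_of_minimal)
  then have "compactin ereal0_topology (ereal0_topology closure_of {x \<in> - {0}. far_test \<delta> x \<noteq> 0})"
    by (intro closed_compactin[OF K]) auto
  then show ?thesis
    using continuous_on_subset[OF cont] by (auto simp: test_functions_def far_test_def)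
qed

lemma openin_far: "\<delta> > 0 \<Longrightarrow> openin vague_topology (far \<delta>)"
  unfolding vague_topology_def far_def
  by (rule topology_generated_by_Basis)
    (use far_test_in_test_functions[of \<delta>] open_greaterThan in blast)

lemma dirac_sum_in_far_iff:
  assumes "\<delta> > 0" and "finite I"
  shows "dirac_sum I y \<in> far \<delta> \<longleftrightarrow> (\<exists>i\<in>I. \<bar>y i\<bar> > \<delta>)"
proof -
  have "(\<Sum>i\<in>I. zero_ext (far_test \<delta>) (y i)) > 0 \<longleftrightarrow> (\<exists>i\<in>I. zero_ext (far_test \<delta>) (y i) \<noteq> 0)"
    using assms by (subst less_le) (auto simp: sum_nonneg_eq_0_iff zero_ext_far_test intro!: sum_nonneg)
  moreover have "zero_ext (far_test \<delta>) z \<noteq> 0 \<longleftrightarrow> \<bar>z\<bar> > \<delta>" for z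
    using assms(1) by (auto simp: zero_ext_far_test max_def min_def)
  ultimately show ?thesis
    using assms by (simp add: far_def dirac_sum_finite_in_point_measures
      integral_dirac_sum[OF far_test_in_test_functions])
qed

lemma null_notin_far: "\<delta> > 0 \<Longrightarrow> null_point_measure \<notin> far \<delta>"
  using dirac_sum_in_far_iff[of \<delta> "{} :: nat set" "\<lambda>_. 0"] null_point_measure_eq[of "\<lambda>_ :: nat. 0"] by simp

section \<open>Decomposition of the tree at the root\<close>

type_synonym environment = "nat list \<Rightarrow> reproduction"

abbreviation environment_space :: "environment measure" where
  "environment_space \<equiv> PiM UNIV (\<lambda>_. reproduction_space)"

text \<open>Labels are read from the youngest generation back to the oldest, so the subtree of the child \<open>j\<close> of the root
consists of the labels that end in \<open>j\<close>.\<close>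

definition shift :: "nat \<Rightarrow> environment \<Rightarrow> environment" where
  "shift j e = (\<lambda>w. e (w @ [j]))"

lemma measurable_shift [measurable]: "shift j \<in> measurable environment_space environment_space"
  unfolding shift_def by (rule measurable_PiM_single') (auto simp: space_PiM)

text \<open>The two factors of the reproduction law: \<open>\<zeta>\<close> is the law of the number of children and \<open>F\<close> the law of a
displacement.\<close>

locale branching =
  fixes \<zeta> :: "nat measure" and F :: "real measure"
  assumes prob_space_\<zeta>: "prob_space \<zeta>" and sets_\<zeta> [measurable_cong]: "sets \<zeta> = sets (count_space UNIV)"
    and prob_space_F: "prob_space F" and sets_F [measurable_cong]: "sets F = sets borel"
begin

definition rep_law :: "reproduction measure" where
  "rep_law = \<zeta> \<Otimes>\<^sub>M PiM UNIV (\<lambda>_. F)"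

definition env_law :: "environment measure" where
  "env_law = PiM UNIV (\<lambda>_. rep_law)"

lemma sets_displacements [measurable_cong]:
  "sets (PiM UNIV (\<lambda>_ :: nat. F)) = sets (PiM UNIV (\<lambda>_. borel))"
  by (rule sets_PiM_cong) (auto simp: sets_F)

lemma sets_rep_law [measurable_cong]: "sets rep_law = sets reproduction_space"
  unfolding rep_law_def by (rule sets_pair_measure_cong[OF sets_\<zeta> sets_displacements])

lemma sets_env_law [measurable_cong]: "sets env_law = sets environment_space"
  unfolding env_law_def by (rule sets_PiM_cong) (auto simp: sets_rep_law)

lemma space_env_law [simp]: "space env_law = UNIV" and space_F [simp]: "space F = UNIV"
  and space_\<zeta> [simp]: "space \<zeta> = UNIV"
  using sets_eq_imp_space_eq[OF sets_env_law] sets_eq_imp_space_eq[OF sets_F] sets_eq_imp_space_eq[OF sets_\<zeta>]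
  by (auto simp: space_PiM space_pair_measure)

sublocale \<zeta>: prob_space \<zeta> by (rule prob_space_\<zeta>)
sublocale F: prob_space F by (rule prob_space_F)

lemma prob_space_displacements: "prob_space (PiM UNIV (\<lambda>_ :: nat. F))"
  by (rule prob_space_PiM) (rule prob_space_F)

sublocale rep: prob_space rep_law
  unfolding rep_law_def
  by (intro prob_space_pair prob_space_\<zeta> prob_space_displacements)

sublocale env: prob_space env_law
  unfolding env_law_def by (rule prob_space_PiM) (rule rep.prob_space_axioms)

lemma distr_shift: "distr env_law env_law (shift j) = env_law"
proof -
  have "distr (PiM UNIV (\<lambda>_. rep_law)) (\<Pi>\<^sub>M w\<in>UNIV. (\<lambda>_. rep_law) (w @ [j])) (\<lambda>e. \<lambda>w\<in>UNIV. e (w @ [j])) =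
      (\<Pi>\<^sub>M w\<in>UNIV. (\<lambda>_. rep_law) (w @ [j]))"
    by (rule distr_PiM_reindex) (auto simp: inj_on_def rep.prob_space_axioms)
  then show ?thesis
    by (simp add: env_law_def shift_def [abs_def] restrict_UNIV)
qed

lemma distr_reproduction: "distr env_law rep_law (\<lambda>e. e v) = rep_law"
  unfolding env_law_def by (rule distr_PiM_component) (auto simp: rep.prob_space_axioms)

lemma distr_displacement: "distr (PiM UNIV (\<lambda>_ :: nat. F)) F (\<lambda>x. x j) = F"
  by (rule distr_PiM_component) (auto simp: F.prob_space_axioms)

text \<open>The root and the subtrees of its children occupy disjoint sets of labels; hence their reproductions are
independent, and each subtree has the law of the whole tree.\<close>

lemma nn_integral_root_prod:
  assumes f [measurable]: "f \<in> borel_measurable reproduction_space"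
    and g [measurable]: "\<And>j. g j \<in> borel_measurable environment_space" and J: "finite J"
  shows "(\<integral>\<^sup>+ e. f (e []) * (\<Prod>j\<in>J. g j (shift j e)) \<partial>env_law) =
    (\<integral>\<^sup>+ r. f r \<partial>rep_law) * (\<Prod>j\<in>J. \<integral>\<^sup>+ e. (g j e :: ennreal) \<partial>env_law)"
proof -
  \<comment> \<open>\<open>None\<close> stands for the root and \<open>Some j\<close> for the subtree of its child \<open>j\<close>\<close>
  define K :: "nat option \<Rightarrow> nat list set" where
    "K i = (case i of None \<Rightarrow> {[]} | Some j \<Rightarrow> range (\<lambda>w. w @ [j]))" for i
  define Y :: "nat option \<Rightarrow> environment \<Rightarrow> ennreal" where
    "Y i = (case i of None \<Rightarrow> (\<lambda>h. f (h [])) | Some j \<Rightarrow> (\<lambda>h. g j (\<lambda>w. h (w @ [j]))))" for i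
  define I where "I = insert None (Some ` J)"
  have "env.indep_vars (\<lambda>_. rep_law) (\<lambda>i e. e i) UNIV"
    by (subst env.indep_vars_iff_distr_eq_PiM)
      (simp_all add: distr_reproduction restrict_UNIV env_law_def[symmetric] del: split_paired_All)
  then have "env.indep_vars (\<lambda>i. PiM (K i) (\<lambda>_. rep_law)) (\<lambda>i e. restrict (\<lambda>w. e w) (K i)) I"
    by (rule env.indep_vars_restrict)
      (auto simp: disjoint_family_on_def K_def I_def split: option.splits)
  moreover have "Y i \<in> borel_measurable (PiM (K i) (\<lambda>_. rep_law))" for i
  proof (cases i)
    case None
    have "(\<lambda>h. h []) \<in> measurable (PiM {[]} (\<lambda>_. rep_law)) rep_law"
      by (rule measurable_component_singleton) simp
    from measurable_compose[OF this, of f borel] show ?thesis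
      by (simp add: Y_def K_def None)
  next
    case (Some j)
    let ?R = "PiM (range (\<lambda>w. w @ [j])) (\<lambda>_. rep_law)"
    have "(\<lambda>h. h (w @ [j])) \<in> measurable ?R reproduction_space" for w
      using measurable_component_singleton[of "w @ [j]" "range (\<lambda>w. w @ [j])" "\<lambda>_. rep_law"]
      by (simp add: measurable_cong_sets[OF refl sets_rep_law])
    then have "(\<lambda>h. \<lambda>w. h (w @ [j])) \<in> measurable ?R environment_space"
      by (intro measurable_PiM_single') (auto simp: space_PiM space_pair_measure)
    from measurable_compose[OF this g] show ?thesis
      by (simp add: Y_def K_def Some)
  qed
  ultimately have "env.indep_vars (\<lambda>_. borel) (\<lambda>i e. Y i (restrict (\<lambda>w. e w) (K i))) I"
    by (rule env.indep_vars_compose2)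
  then have *: "(\<integral>\<^sup>+ e. (\<Prod>i\<in>I. Y i (restrict (\<lambda>w. e w) (K i))) \<partial>env_law) =
      (\<Prod>i\<in>I. \<integral>\<^sup>+ e. Y i (restrict (\<lambda>w. e w) (K i)) \<partial>env_law)"
    by (intro env.indep_vars_nn_integral) (auto simp: I_def J)
  have Y_None: "Y None (restrict (\<lambda>w. e w) (K None)) = f (e [])" for e
    by (simp add: Y_def K_def)
  have Y_Some: "Y (Some j) (restrict (\<lambda>w. e w) (K (Some j))) = g j (shift j e)" for j e
    by (simp add: Y_def K_def shift_def)
  have prod_I: "(\<Prod>i\<in>I. h i) = h None * (\<Prod>j\<in>J. h (Some j))" for h :: "nat option \<Rightarrow> ennreal"
    unfolding I_def using J by (subst prod.insert) (auto simp: prod.reindex)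
  have root: "(\<integral>\<^sup>+ e. f (e []) \<partial>env_law) = (\<integral>\<^sup>+ r. f r \<partial>rep_law)"
  proof -
    have "(\<integral>\<^sup>+ r. f r \<partial>rep_law) = (\<integral>\<^sup>+ r. f r \<partial>distr env_law rep_law (\<lambda>e. e []))"
      by (simp add: distr_reproduction)
    also have "\<dots> = (\<integral>\<^sup>+ e. f (e []) \<partial>env_law)" by (rule nn_integral_distr) simp_all
    finally show ?thesis ..
  qed
  have child: "(\<integral>\<^sup>+ e. g j (shift j e) \<partial>env_law) = (\<integral>\<^sup>+ e. g j e \<partial>env_law)" for j
  proof -
    have "(\<integral>\<^sup>+ e. g j e \<partial>env_law) = (\<integral>\<^sup>+ e. g j e \<partial>distr env_law env_law (shift j))"
      by (simp add: distr_shift)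
    also have "\<dots> = (\<integral>\<^sup>+ e. g j (shift j e) \<partial>env_law)" by (rule nn_integral_distr) simp_all
    finally show ?thesis ..
  qed
  show ?thesis
    using * unfolding prod_I Y_None Y_Some root child .
qed

lemma distr_root_child: "distr env_law (rep_law \<Otimes>\<^sub>M env_law) (\<lambda>e. (e [], shift j e)) = rep_law \<Otimes>\<^sub>M env_law"
proof (rule pair_measure_eqI[symmetric])
  show "sigma_finite_measure rep_law" "sigma_finite_measure env_law" by unfold_locales
  fix A B assume "A \<in> sets rep_law" "B \<in> sets env_law"
  then have [measurable]: "A \<in> sets reproduction_space" "B \<in> sets environment_space"
    by (simp_all add: sets_rep_law sets_env_law)
  have [measurable]: "A \<in> sets rep_law" "B \<in> sets env_law" by fact+
  have "emeasure (distr env_law (rep_law \<Otimes>\<^sub>M env_law) (\<lambda>e. (e [], shift j e))) (A \<times> B) =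
      (\<integral>\<^sup>+ p. indicator (A \<times> B) p \<partial>distr env_law (rep_law \<Otimes>\<^sub>M env_law) (\<lambda>e. (e [], shift j e)))"
    by (rule nn_integral_indicator[symmetric]) simp
  also have "\<dots> = (\<integral>\<^sup>+ e. indicator (A \<times> B) (e [], shift j e) \<partial>env_law)"
    by (rule nn_integral_distr) measurable
  also have "\<dots> = (\<integral>\<^sup>+ e. indicator A (e []) * (\<Prod>j\<in>{j}. indicator B (shift j e)) \<partial>env_law)"
    by (simp add: indicator_times)
  also have "\<dots> = (\<integral>\<^sup>+ r. indicator A r \<partial>rep_law) * (\<Prod>j\<in>{j}. \<integral>\<^sup>+ e. indicator B e \<partial>env_law)"
    by (rule nn_integral_root_prod) simp_all
  finally show "emeasure rep_law A * emeasure env_law B =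
      emeasure (distr env_law (rep_law \<Otimes>\<^sub>M env_law) (\<lambda>e. (e [], shift j e))) (A \<times> B)"
    by simp
qed simp

end

section \<open>Recursive counts and the one-big-jump configuration\<close>

text \<open>One step of the recursion at the root: \<open>h\<close> receives the displacement of a child and the environment
that governs its subtree.\<close>

definition branch_sum :: "(real \<Rightarrow> environment \<Rightarrow> nat) \<Rightarrow> environment \<Rightarrow> nat" where
  "branch_sum h e = (\<Sum>j<fst (e []). h (snd (e []) j) (shift j e))"

text \<open>\<open>jumps a n k e\<close> is the number of particles of generation \<open>n\<close> with at least \<open>k\<close> displacements larger than \<open>a\<close>
along their line of descent. For \<open>k = 0\<close> the truncated subtraction keeps \<open>k\<close> at \<open>0\<close>, so that all particles are
counted.\<close>

primrec jumps :: "real \<Rightarrow> nat \<Rightarrow> nat \<Rightarrow> environment \<Rightarrow> nat" where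
  "jumps a 0 k = (\<lambda>_. of_bool (k = 0))"
| "jumps a (Suc n) k = branch_sum (\<lambda>x. jumps a n (if \<bar>x\<bar> > a then k - 1 else k))"

abbreviation gsize :: "nat \<Rightarrow> environment \<Rightarrow> nat" where
  "gsize n e \<equiv> card (generation e n)"

text \<open>\<open>marked S n e\<close> is the number of particles in the generations \<open>1\<close> to \<open>n\<close> for which the pair of their own displacement
and the number of their descendants in generation \<open>n\<close> lies in \<open>S\<close>.\<close>

primrec marked :: "(real \<times> nat) set \<Rightarrow> nat \<Rightarrow> environment \<Rightarrow> nat" where
  "marked S 0 = (\<lambda>_. 0)"
| "marked S (Suc n) = branch_sum (\<lambda>x e. of_bool ((x, gsize n e) \<in> S) + marked S n e)"

definition big :: "real \<Rightarrow> (real \<times> nat) set" where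
  "big c = {(x, k). \<bar>x\<bar> > c}"

lemma branch_sum_mono: "(\<And>x e. h x e \<le> h' x e) \<Longrightarrow> branch_sum h e \<le> branch_sum h' e"
  by (simp add: branch_sum_def sum_mono)

lemma branch_sum_eq_0_iff: "branch_sum h e = 0 \<longleftrightarrow> (\<forall>j<fst (e []). h (snd (e []) j) (shift j e) = 0)"
  by (auto simp: branch_sum_def)

lemma Cons_in_particles_iff: "i # v \<in> particles e \<longleftrightarrow> v \<in> particles e \<and> i < fst (e v)"
  by (auto intro: particles.child elim: particles.cases)

lemma snoc_in_particles_iff: "w @ [j] \<in> particles e \<longleftrightarrow> j < fst (e []) \<and> w \<in> particles (shift j e)"
  by (induction w) (auto simp: Cons_in_particles_iff shift_def intro: particles.root)

lemma position_snoc: "position e (w @ [j]) = snd (e []) j + position (shift j e) w"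
  by (induction w) (auto simp: shift_def)

lemma generation_0: "generation e 0 = {[]}"
  by (auto simp: generation_def intro: particles.root)

lemma generation_Suc: "generation e (Suc n) = (\<Union>j<fst (e []). (\<lambda>w. w @ [j]) ` generation (shift j e) n)"
proof (intro set_eqI iffI)
  fix v assume v: "v \<in> generation e (Suc n)"
  then have "v \<noteq> []" by (auto simp: generation_def)
  then obtain w j where "v = w @ [j]" by (metis rev_exhaust)
  then show "v \<in> (\<Union>j<fst (e []). (\<lambda>w. w @ [j]) ` generation (shift j e) n)"
    using v by (auto simp: generation_def snoc_in_particles_iff)
qed (auto simp: generation_def snoc_in_particles_iff)

lemma gsize_Suc: "gsize (Suc n) e = branch_sum (\<lambda>_. gsize n) e"
proof -
  have "gsize (Suc n) e = (\<Sum>j<fst (e []). card ((\<lambda>w. w @ [j]) ` generation (shift j e) n))"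
    unfolding generation_Suc by (rule card_UN_disjoint) (auto simp: finite_generation)
  then show ?thesis
    by (simp add: branch_sum_def card_image inj_on_def)
qed

lemma jumps_0_eq_gsize: "jumps a n 0 = gsize n"
proof (induction n)
  case (Suc n)
  have "jumps a n (if a < \<bar>x\<bar> then 0 - 1 else 0) = gsize n" for x
    using Suc by (cases "a < \<bar>x\<bar>") simp_all
  then show ?case by (simp only: jumps.simps gsize_Suc)
qed (simp add: generation_0 fun_eq_iff)

lemma jumps_decreasing: "jumps a n (Suc k) e \<le> jumps a n k e"
proof (induction n arbitrary: k e)
  case (Suc n)
  show ?case
    unfolding jumps.simps
  proof (rule branch_sum_mono)
    fix x e'
    show "jumps a n (if a < \<bar>x\<bar> then Suc k - 1 else Suc k) e' \<le> jumps a n (if a < \<bar>x\<bar> then k - 1 else k) e'"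
      using Suc.IH[of k e'] Suc.IH[of "k - 1" e'] by (cases k) auto
  qed
qed simp

lemma marked_mono: "S \<subseteq> T \<Longrightarrow> marked S n e \<le> marked T n e"
proof (induction n arbitrary: e)
  case (Suc n)
  show ?case
    unfolding marked.simps
    by (rule branch_sum_mono) (use Suc in \<open>auto intro: add_mono le_SucI\<close>)
qed simp

lemma position_le_without_jumps:
  assumes "jumps a n 1 e = 0" and "w \<in> generation e n"
  shows "\<bar>position e w\<bar> \<le> n * a"
  using assms
proof (induction n arbitrary: e w)
  case (Suc n)
  from Suc.prems(2) obtain j w' where j: "j < fst (e [])" "w = w' @ [j]" "w' \<in> generation (shift j e) n"
    by (auto simp: generation_Suc)
  have *: "jumps a n (if \<bar>snd (e []) j\<bar> > a then 1 - 1 else 1) (shift j e) = 0"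
    using Suc.prems(1) j(1) unfolding jumps.simps branch_sum_eq_0_iff by blast
  show ?case
  proof (cases "\<bar>snd (e []) j\<bar> > a")
    case True
    then have "generation (shift j e) n = {}"
      using * by (simp add: jumps_0_eq_gsize finite_generation)
    then show ?thesis using j by simp
  next
    case False
    then show ?thesis
      using Suc.IH[of "shift j e" w'] j * by (simp add: position_snoc algebra_simps)
  qed
qed (simp add: generation_0)

text \<open>A line of descent with at most one displacement above \<open>a\<close>, which in turn is at most \<open>c\<close>.\<close>

lemma position_le_without_big:
  assumes "0 \<le> a" "0 \<le> c"
    and "jumps a n 2 e = 0" and "marked (big c) n e = 0" and "w \<in> generation e n"
  shows "\<bar>position e w\<bar> \<le> n * a + c"
  using assms(3-)
proof (induction n arbitrary: e w)
  case (Suc n)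
  from Suc.prems(3) obtain j w' where j: "j < fst (e [])" "w = w' @ [j]" "w' \<in> generation (shift j e) n"
    by (auto simp: generation_Suc)
  have *: "jumps a n (if \<bar>snd (e []) j\<bar> > a then 2 - 1 else 2) (shift j e) = 0"
    using Suc.prems(1) j(1) unfolding jumps.simps branch_sum_eq_0_iff by blast
  have B: "\<bar>snd (e []) j\<bar> \<le> c" "marked (big c) n (shift j e) = 0"
    using Suc.prems(2) j(1) by (auto simp: branch_sum_eq_0_iff big_def)
  show ?case
  proof (cases "\<bar>snd (e []) j\<bar> > a")
    case True
    then have "\<bar>position (shift j e) w'\<bar> \<le> n * a"
      using * j by (intro position_le_without_jumps) auto
    then show ?thesis using B(1) assms(1) j by (simp add: position_snoc algebra_simps)
  next
    case False
    then have "\<bar>position (shift j e) w'\<bar> \<le> n * a + c"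
      using Suc.IH[of "shift j e" w'] j * B by simp
    then show ?thesis using False j by (simp add: position_snoc algebra_simps)
  qed
qed (use assms in \<open>simp add: generation_0\<close>)

text \<open>A marked displacement with descendants in generation \<open>n\<close> lies on the line of descent of such a descendant.\<close>

lemma jumps_pos_if_marked:
  assumes S: "\<And>x k. (x, k) \<in> S \<Longrightarrow> \<bar>x\<bar> > a \<and> k > 0"
  shows "marked S n e > 0 \<Longrightarrow> jumps a n 1 e > 0"
proof (induction n arbitrary: e)
  case (Suc n)
  then obtain j where j: "j < fst (e [])"
    and "(snd (e []) j, gsize n (shift j e)) \<in> S \<or> marked S n (shift j e) > 0"
    by (auto simp: branch_sum_eq_0_iff simp flip: neq0_conv)
  then have "jumps a n (if \<bar>snd (e []) j\<bar> > a then 1 - 1 else 1) (shift j e) > 0"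
    using S[of "snd (e []) j" "gsize n (shift j e)"] Suc.IH[of "shift j e"] jumps_decreasing[of a n 0 "shift j e"]
    by (auto simp: jumps_0_eq_gsize)
  then show ?case
    using j by (auto simp: branch_sum_eq_0_iff simp flip: neq0_conv)
qed simp

text \<open>The single big displacement \<open>x\<close> belongs to one edge, and \<open>D\<close> is the set of particles of generation \<open>n\<close> below that
edge. On their lines of descent \<open>x\<close> is the only displacement above \<open>a\<close>, so they are close to \<open>x\<close>. Any other line of
descent has at most one displacement above \<open>a\<close>, and that one is at most \<open>c\<close>.\<close>

lemma one_big_jump:
  assumes a: "0 \<le> a" "a \<le> c" and S: "\<And>x k. (x, k) \<in> S \<Longrightarrow> \<bar>x\<bar> > c \<and> k > 0"
    and "jumps a n 2 e = 0" and "marked (big c) n e \<le> 1" and "marked S n e > 0"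
  obtains x D where "(x, card D) \<in> S" "D \<subseteq> generation e n"
    "\<And>w. w \<in> D \<Longrightarrow> \<bar>position e w - x\<bar> \<le> n * a"
    "\<And>w. w \<in> generation e n - D \<Longrightarrow> \<bar>position e w\<bar> \<le> n * a + c"
proof -
  have "\<exists>x D. (x, card D) \<in> S \<and> D \<subseteq> generation e n \<and> (\<forall>w\<in>D. \<bar>position e w - x\<bar> \<le> n * a) \<and>
      (\<forall>w\<in>generation e n - D. \<bar>position e w\<bar> \<le> n * a + c)"
    using assms(4-)
  proof (induction n arbitrary: e)
    case (Suc n)
    let ?x = "\<lambda>j. snd (e []) j" and ?e = "\<lambda>j. shift j e" and ?z = "fst (e [])"
    let ?b = "\<lambda>j. of_bool (\<bar>?x j\<bar> > c) + marked (big c) n (?e j) :: nat"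
    have J: "jumps a n (if \<bar>?x j\<bar> > a then 1 else 2) (?e j) = 0" if "j < ?z" for j
      using Suc.prems(1) that by (auto simp: branch_sum_eq_0_iff split: if_splits)
    have J2: "jumps a n 2 (?e j) = 0" if "j < ?z" for j
      using J[OF that] jumps_decreasing[of a n 1 "?e j"] by (auto simp: numeral_2_eq_2 split: if_splits)
    have J1: "jumps a n 1 (?e j) = 0" if "j < ?z" "\<bar>?x j\<bar> > c" for j
      using J[OF that(1)] that(2) a by (auto split: if_splits)
    from Suc.prems(3) obtain j where j: "j < ?z"
      and mj: "(?x j, gsize n (?e j)) \<in> S \<or> marked S n (?e j) > 0"
      by (auto simp: branch_sum_eq_0_iff simp flip: neq0_conv)
    have SB: "marked S n e' \<le> marked (big c) n e'" for e'
      by (rule marked_mono) (use S in \<open>auto simp: big_def\<close>)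
    have bj: "?b j \<ge> 1"
      using mj S[of "?x j" "gsize n (?e j)"] SB[of "?e j"] by (auto simp: Suc_le_eq)
    have "(\<Sum>i<?z. ?b i) \<le> 1"
      using Suc.prems(2) by (simp add: branch_sum_def big_def)
    moreover have "(\<Sum>i<?z. ?b i) = ?b j + (\<Sum>i\<in>{..<?z} - {j}. ?b i)"
      using j by (intro sum.remove) auto
    ultimately have "?b j \<le> 1" and "(\<Sum>i\<in>{..<?z} - {j}. ?b i) = 0"
      using bj by linarith+
    then have others: "\<bar>?x i\<bar> \<le> c" "marked (big c) n (?e i) = 0" if "i < ?z" "i \<noteq> j" for i
      using that by (auto simp: not_less)
    \<comment> \<open>particles below a child other than the one whose subtree or edge carries the big displacement\<close>
    have far_small: "\<bar>position e w\<bar> \<le> Suc n * a + c"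
      if "i < ?z" "i \<noteq> j" "w = w' @ [i]" "w' \<in> generation (?e i) n" for i w w'
    proof (cases "\<bar>?x i\<bar> > a")
      case True
      then have "\<bar>position (?e i) w'\<bar> \<le> n * a"
        using J[OF that(1)] that by (intro position_le_without_jumps) auto
      then show ?thesis
        using others(1)[OF that(1,2)] a that(3) by (simp add: position_snoc algebra_simps)
    next
      case False
      then have "\<bar>position (?e i) w'\<bar> \<le> n * a + c"
        using J2[OF that(1)] others(2)[OF that(1,2)] that a by (intro position_le_without_big) auto
      then show ?thesis
        using False that(3) by (simp add: position_snoc algebra_simps)
    qed
    show ?case
    proof (cases "(?x j, gsize n (?e j)) \<in> S")
      case True
      let ?D = "(\<lambda>w. w @ [j]) ` generation (?e j) n"
      have xj: "\<bar>?x j\<bar> > c" using S[OF True] by simp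
      have "(?x j, card ?D) \<in> S"
        using True by (simp add: card_image inj_on_def)
      moreover have "?D \<subseteq> generation e (Suc n)"
        using j by (auto simp: generation_Suc)
      moreover have "\<bar>position e w - ?x j\<bar> \<le> Suc n * a" if "w \<in> ?D" for w
      proof -
        from that obtain w' where w': "w = w' @ [j]" "w' \<in> generation (?e j) n" by auto
        have "\<bar>position (?e j) w'\<bar> \<le> n * a"
          using J1[OF j xj] w' by (intro position_le_without_jumps) auto
        then show ?thesis using w' a by (simp add: position_snoc algebra_simps)
      qed
      moreover have "\<bar>position e w\<bar> \<le> Suc n * a + c" if "w \<in> generation e (Suc n) - ?D" for w
        using that far_small by (auto simp: generation_Suc)
      ultimately show ?thesis by blast
    next
      case False
      with mj have mj: "marked S n (?e j) > 0" by simp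
      then have "marked (big c) n (?e j) > 0" using SB[of "?e j"] by linarith
      then have "marked (big c) n (?e j) \<le> 1" using \<open>?b j \<le> 1\<close> by simp
      with Suc.IH[OF J2[OF j] _ mj] obtain x D where D: "(x, card D) \<in> S" "D \<subseteq> generation (?e j) n"
          "\<And>w. w \<in> D \<Longrightarrow> \<bar>position (?e j) w - x\<bar> \<le> n * a"
          "\<And>w. w \<in> generation (?e j) n - D \<Longrightarrow> \<bar>position (?e j) w\<bar> \<le> n * a + c"
        by blast
      \<comment> \<open>the edge to the child \<open>j\<close> itself is small: otherwise the marked edge in its subtree would be
        a second displacement above \<open>a\<close> on some line of descent\<close>
      have "jumps a n 1 (?e j) > 0"
        using mj by (rule jumps_pos_if_marked[rotated]) (use S a in force)
      then have xj: "\<bar>?x j\<bar> \<le> a"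
        using J[OF j] by (auto split: if_splits)
      let ?D = "(\<lambda>w. w @ [j]) ` D"
      have "(x, card ?D) \<in> S"
        using D(1) by (simp add: card_image inj_on_def)
      moreover have "?D \<subseteq> generation e (Suc n)"
        using j D(2) by (auto simp: generation_Suc)
      moreover have "\<bar>position e w - x\<bar> \<le> Suc n * a" if "w \<in> ?D" for w
      proof -
        from that obtain w' where w': "w = w' @ [j]" "w' \<in> D" by auto
        show ?thesis using D(3)[OF w'(2)] xj by (simp add: w'(1) position_snoc algebra_simps)
      qed
      moreover have "\<bar>position e w\<bar> \<le> Suc n * a + c" if w: "w \<in> generation e (Suc n) - ?D" for w
      proof -
        from w obtain i w' where i: "i < ?z" "w = w' @ [i]" "w' \<in> generation (?e i) n"
          by (auto simp: generation_Suc)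
        show ?thesis
        proof (cases "i = j")
          case True
          with i w have "\<bar>position (?e j) w'\<bar> \<le> n * a + c" by (intro D(4)) auto
          then show ?thesis using xj True i by (simp add: position_snoc algebra_simps)
        qed (use far_small i in blast)
      qed
      ultimately show ?thesis by blast
    qed
  qed simp
  then show thesis using that by blast
qed

section \<open>Expectations of the counts\<close>

lemma measurable_nat_sum:
  fixes f :: "nat \<Rightarrow> 'a \<Rightarrow> nat"
  assumes "\<And>j. f j \<in> measurable M (count_space UNIV)"
  shows "(\<lambda>x. \<Sum>j<n. f j x) \<in> measurable M (count_space UNIV)"
proof (induction n)
  case (Suc n)
  have "(\<lambda>x. (\<lambda>k x. k + f n x) (\<Sum>j<n. f j x) x) \<in> measurable M (count_space UNIV)"
    by (rule measurable_compose_countable[OF measurable_compose[OF assms measurable_count_space] Suc])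
  then show ?case by simp
qed simp

lemma measurable_branch_sum:
  assumes h: "(\<lambda>(x, e). h x e) \<in> measurable (borel \<Otimes>\<^sub>M environment_space) (count_space UNIV)"
  shows "branch_sum h \<in> measurable environment_space (count_space UNIV)"
proof -
  have "(\<lambda>e. (snd (e []) j, shift j e)) \<in> measurable environment_space (borel \<Otimes>\<^sub>M environment_space)" for j
    by measurable
  from measurable_compose[OF this h]
  have "(\<lambda>e. h (snd (e []) j) (shift j e)) \<in> measurable environment_space (count_space UNIV)" for j
    by simp
  note sum = measurable_nat_sum[OF this]
  have "(\<lambda>e. fst (e [])) \<in> measurable environment_space (count_space UNIV)"
    by measurable
  from measurable_compose_countable[OF sum this] show ?thesis
    by (simp add: branch_sum_def [abs_def])
qed

lemma measurable_jumps_summand_aux: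
  assumes [measurable]: "\<And>k. jumps a n k \<in> measurable environment_space (count_space UNIV)"
  shows "(\<lambda>(x :: real, e). jumps a n (if \<bar>x\<bar> > a then k - 1 else k) e)
    \<in> measurable (borel \<Otimes>\<^sub>M environment_space) (count_space UNIV)"
proof -
  have "(\<lambda>(x :: real, e). if \<bar>x\<bar> > a then jumps a n (k - 1) e else jumps a n k e)
      \<in> measurable (borel \<Otimes>\<^sub>M environment_space) (count_space UNIV)"
    by measurable
  then show ?thesis
    by (simp add: if_distrib[of "jumps a n"] if_distribR cong: if_cong)
qed

lemma measurable_jumps [measurable]: "jumps a n k \<in> measurable environment_space (count_space UNIV)"
proof (induction n arbitrary: k)
  case (Suc n)
  show ?case
    unfolding jumps.simps
    by (rule measurable_branch_sum[OF measurable_jumps_summand_aux[OF Suc]])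
qed simp

lemmas measurable_jumps_summand = measurable_jumps_summand_aux[OF measurable_jumps]

lemma measurable_gsize [measurable]: "gsize n \<in> measurable environment_space (count_space UNIV)"
  using measurable_jumps[of 0 n 0] by (simp add: jumps_0_eq_gsize)

lemma measurable_marked_summand:
  assumes S [measurable]: "S \<in> sets (borel \<Otimes>\<^sub>M count_space UNIV)"
    and f [measurable]: "f \<in> measurable environment_space (count_space UNIV)"
  shows "(\<lambda>(x, e). of_bool ((x, gsize n e) \<in> S) + f e :: nat)
    \<in> measurable (borel \<Otimes>\<^sub>M environment_space) (count_space UNIV)"
proof -
  have 1: "{p \<in> space (borel \<Otimes>\<^sub>M environment_space). (fst p, gsize n (snd p)) \<in> S}
      \<in> sets (borel \<Otimes>\<^sub>M environment_space)"
    by measurable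
  have "(\<lambda>p. if (fst p, gsize n (snd p)) \<in> S then Suc (f (snd p)) else f (snd p))
      \<in> measurable (borel \<Otimes>\<^sub>M environment_space) (count_space UNIV)"
    by (rule measurable_If[OF _ _ 1]) measurable
  also have "(\<lambda>p. if (fst p, gsize n (snd p)) \<in> S then Suc (f (snd p)) else f (snd p)) =
      (\<lambda>(x, e). of_bool ((x, gsize n e) \<in> S) + f e)"
    by (auto simp: fun_eq_iff)
  finally show ?thesis .
qed

lemma measurable_marked [measurable]:
  assumes "S \<in> sets (borel \<Otimes>\<^sub>M count_space UNIV)"
  shows "marked S n \<in> measurable environment_space (count_space UNIV)"
proof (induction n)
  case (Suc n)
  show ?case
    unfolding marked.simps
    by (rule measurable_branch_sum[OF measurable_marked_summand[OF assms Suc]])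
qed simp

lemma big_eq_Times: "big c = {x. \<bar>x\<bar> > c} \<times> UNIV"
  by (auto simp: big_def)

lemma abs_gt_borel: "{x :: real. \<bar>x\<bar> > c} \<in> sets borel"
  by measurable

lemma big_in_sets [measurable]: "big c \<in> sets (borel \<Otimes>\<^sub>M count_space UNIV)"
  using abs_gt_borel[of c] by (simp add: big_eq_Times)

context branching
begin

definition mean :: ennreal where
  "mean = (\<integral>\<^sup>+ z. of_nat z \<partial>\<zeta>)"

text \<open>By independence each child contributes the expectation of \<open>h\<close> under the product law, and the expected number of
children is the factor in front (the many-to-one formula for one generation).\<close>

lemma nn_integral_branch_sum:
  assumes h: "(\<lambda>(x, e). h x e) \<in> measurable (borel \<Otimes>\<^sub>M environment_space) (count_space UNIV)"
  shows "(\<integral>\<^sup>+ e. of_nat (branch_sum h e) \<partial>env_law) = mean * (\<integral>\<^sup>+ e. \<integral>\<^sup>+ x. of_nat (h x e) \<partial>F \<partial>env_law)"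
proof -
  define H where "H = (\<integral>\<^sup>+ e. \<integral>\<^sup>+ x. of_nat (h x e) \<partial>F \<partial>env_law)"
  have h' [measurable]: "(\<lambda>p. of_nat (h (fst p) (snd p)) :: ennreal) \<in> borel_measurable (borel \<Otimes>\<^sub>M environment_space)"
    using measurable_compose[OF h, of of_nat "borel :: ennreal measure"] by (simp add: case_prod_beta')
  define \<phi> :: "nat \<Rightarrow> reproduction \<times> environment \<Rightarrow> ennreal" where
    "\<phi> j p = of_bool (j < fst (fst p)) * of_nat (h (snd (fst p) j) (snd p))" for j p
  have pr: "(\<lambda>p. (snd (fst p) j, snd p)) \<in>
      measurable (reproduction_space \<Otimes>\<^sub>M environment_space) (borel \<Otimes>\<^sub>M environment_space)" for j
    by measurable
  have h'' [measurable]: "(\<lambda>p. of_nat (h (snd (fst p) j) (snd p)) :: ennreal) \<in>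
      borel_measurable (reproduction_space \<Otimes>\<^sub>M environment_space)" for j
    using measurable_compose[OF pr h'] by simp
  have \<phi> [measurable]: "\<phi> j \<in> borel_measurable (reproduction_space \<Otimes>\<^sub>M environment_space)" for j
    unfolding \<phi>_def [abs_def] of_bool_def by measurable
  have \<phi>' [measurable]: "\<phi> j \<in> borel_measurable (rep_law \<Otimes>\<^sub>M env_law)" for j
    by measurable
  have sum: "of_nat (branch_sum h e) = (\<Sum>j. \<phi> j (e [], shift j e))" for e
  proof -
    have "(\<Sum>j. \<phi> j (e [], shift j e)) = (\<Sum>j<fst (e []). \<phi> j (e [], shift j e))"
      by (rule suminf_finite) (auto simp: \<phi>_def)
    then show ?thesis by (simp add: \<phi>_def branch_sum_def)
  qed
  have contribution: "(\<integral>\<^sup>+ e. \<phi> j (e [], shift j e) \<partial>env_law) = (\<integral>\<^sup>+ z. of_bool (j < z) \<partial>\<zeta>) * H" for j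
  proof -
    have "(\<integral>\<^sup>+ e. \<phi> j (e [], shift j e) \<partial>env_law) =
        (\<integral>\<^sup>+ p. \<phi> j p \<partial>distr env_law (rep_law \<Otimes>\<^sub>M env_law) (\<lambda>e. (e [], shift j e)))"
      by (rule nn_integral_distr[symmetric]) measurable
    also have "\<dots> = (\<integral>\<^sup>+ p. \<phi> j p \<partial>(rep_law \<Otimes>\<^sub>M env_law))"
      by (simp add: distr_root_child)
    also have "\<dots> = (\<integral>\<^sup>+ r. \<integral>\<^sup>+ e. \<phi> j (r, e) \<partial>env_law \<partial>rep_law)"
      by (rule env.nn_integral_fst[symmetric]) measurable
    also have "\<dots> = (\<integral>\<^sup>+ e. \<integral>\<^sup>+ r. \<phi> j (r, e) \<partial>rep_law \<partial>env_law)"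
    proof -
      interpret pair_sigma_finite rep_law env_law ..
      show ?thesis by (rule Fubini'[symmetric]) (simp add: case_prod_eta)
    qed
    also have "\<dots> = (\<integral>\<^sup>+ e. (\<integral>\<^sup>+ z. of_bool (j < z) \<partial>\<zeta>) * (\<integral>\<^sup>+ x. of_nat (h x e) \<partial>F) \<partial>env_law)"
    proof (rule nn_integral_cong)
      fix e :: environment
      have e: "e \<in> space environment_space" by (simp add: space_PiM space_pair_measure)
      have [measurable]: "(\<lambda>x. of_nat (h x e) :: ennreal) \<in> borel_measurable borel"
        using measurable_compose[OF measurable_Pair2'[OF e, of borel] h'] by simp
      interpret disp: prob_space "PiM UNIV (\<lambda>_ :: nat. F)" by (rule prob_space_displacements)
      have "(\<lambda>r. \<phi> j (r, e)) \<in> borel_measurable reproduction_space"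
        using measurable_compose[OF measurable_Pair2'[OF e, of reproduction_space] \<phi>] .
      then have "(\<lambda>r. \<phi> j (r, e)) \<in> borel_measurable (\<zeta> \<Otimes>\<^sub>M PiM UNIV (\<lambda>_. F))"
        by (simp add: measurable_cong_sets[OF sets_rep_law refl, unfolded rep_law_def])
      note disp.nn_integral_fst[OF this, symmetric]
      then have "(\<integral>\<^sup>+ r. \<phi> j (r, e) \<partial>rep_law) = (\<integral>\<^sup>+ z. \<integral>\<^sup>+ x. \<phi> j ((z, x), e) \<partial>PiM UNIV (\<lambda>_. F) \<partial>\<zeta>)"
        unfolding rep_law_def .
      also have "\<dots> = (\<integral>\<^sup>+ z. of_bool (j < z) * (\<integral>\<^sup>+ x. of_nat (h (x j) e) \<partial>PiM UNIV (\<lambda>_. F)) \<partial>\<zeta>)"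
        unfolding \<phi>_def by (intro nn_integral_cong) (simp add: nn_integral_cmult)
      also have "\<dots> = (\<integral>\<^sup>+ z. of_bool (j < z) \<partial>\<zeta>) * (\<integral>\<^sup>+ x. of_nat (h (x j) e) \<partial>PiM UNIV (\<lambda>_. F))"
        by (rule nn_integral_multc) simp
      also have "(\<integral>\<^sup>+ x. of_nat (h (x j) e) \<partial>PiM UNIV (\<lambda>_. F)) =
          (\<integral>\<^sup>+ x. of_nat (h x e) \<partial>distr (PiM UNIV (\<lambda>_. F)) F (\<lambda>x. x j))"
        by (rule nn_integral_distr[symmetric]) simp_all
      also have "\<dots> = (\<integral>\<^sup>+ x. of_nat (h x e) \<partial>F)"
        by (simp add: distr_displacement)
      finally show "(\<integral>\<^sup>+ r. \<phi> j (r, e) \<partial>rep_law) =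
          (\<integral>\<^sup>+ z. of_bool (j < z) \<partial>\<zeta>) * (\<integral>\<^sup>+ x. of_nat (h x e) \<partial>F)" .
    qed
    also have "\<dots> = (\<integral>\<^sup>+ z. of_bool (j < z) \<partial>\<zeta>) * H"
      unfolding H_def
    proof (rule nn_integral_cmult)
      have "(\<lambda>p. of_nat (h (snd p) (fst p)) :: ennreal) \<in> borel_measurable (env_law \<Otimes>\<^sub>M F)"
        using measurable_compose[of "\<lambda>p. (snd p, fst p)" "env_law \<Otimes>\<^sub>M F", OF _ h'] by simp
      then show "(\<lambda>e. \<integral>\<^sup>+ x. of_nat (h x e) \<partial>F) \<in> borel_measurable env_law"
        using F.borel_measurable_nn_integral[of "\<lambda>e x. of_nat (h x e)" env_law] by (simp add: case_prod_beta')
    qed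
    finally show ?thesis .
  qed
  have "(\<integral>\<^sup>+ e. of_nat (branch_sum h e) \<partial>env_law) = (\<Sum>j. \<integral>\<^sup>+ e. \<phi> j (e [], shift j e) \<partial>env_law)"
    unfolding sum
  proof (rule nn_integral_suminf)
    fix j
    have "(\<lambda>e. (e [], shift j e)) \<in> measurable env_law (reproduction_space \<Otimes>\<^sub>M environment_space)"
      by measurable
    from measurable_compose[OF this \<phi>] show "(\<lambda>e. \<phi> j (e [], shift j e)) \<in> borel_measurable env_law" .
  qed
  also have "\<dots> = (\<Sum>j. \<integral>\<^sup>+ z. of_bool (j < z) \<partial>\<zeta>) * H"
    unfolding contribution by (rule ennreal_suminf_multc)
  also have "(\<Sum>j. \<integral>\<^sup>+ z. of_bool (j < z) \<partial>\<zeta>) = (\<integral>\<^sup>+ z. (\<Sum>j. of_bool (j < z)) \<partial>\<zeta>)"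
    by (rule nn_integral_suminf[symmetric]) simp
  also have "\<dots> = mean"
    unfolding mean_def
  proof (rule nn_integral_cong)
    fix z :: nat
    have "(\<Sum>j. of_bool (j < z)) = (\<Sum>j<z. of_bool (j < z) :: ennreal)"
      by (rule suminf_finite) auto
    then show "(\<Sum>j. of_bool (j < z)) = (of_nat z :: ennreal)" by simp
  qed
  finally show ?thesis by (simp add: H_def)
qed

text \<open>The summand with index \<open>l\<close> belongs to the edges that lead to generation \<open>n - l\<close>.\<close>

lemma nn_integral_marked:
  assumes S [measurable]: "S \<in> sets (borel \<Otimes>\<^sub>M count_space UNIV)"
  shows "(\<integral>\<^sup>+ e. of_nat (marked S n e) \<partial>env_law) =
    (\<Sum>l<n. mean ^ (n - l) * (\<integral>\<^sup>+ e. emeasure F {x. (x, gsize l e) \<in> S} \<partial>env_law))"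
proof (induction n)
  case (Suc n)
  define w where "w l = (\<integral>\<^sup>+ e. emeasure F {x. (x, gsize l e) \<in> S} \<partial>env_law)" for l
  have slice: "{x. (x, k) \<in> S} \<in> sets F" for k :: nat
    using sets_Pair1[OF S, of k] by (simp add: vimage_def sets_F sets_Pair2)
  have "(\<lambda>e. emeasure F {x. (x, gsize n e) \<in> S}) \<in> borel_measurable env_law"
    using measurable_compose[OF measurable_gsize, of "\<lambda>k. emeasure F {x. (x, k) \<in> S}" borel n]
    by (simp add: measurable_cong_sets[OF sets_env_law refl])
  note w_meas = this
  have "(\<integral>\<^sup>+ e. of_nat (marked S (Suc n) e) \<partial>env_law) =
      mean * (\<integral>\<^sup>+ e. \<integral>\<^sup>+ x. of_nat (of_bool ((x, gsize n e) \<in> S) + marked S n e) \<partial>F \<partial>env_law)"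
    unfolding marked.simps
    by (rule nn_integral_branch_sum[OF measurable_marked_summand[OF S measurable_marked[OF S]]])
  also have "(\<integral>\<^sup>+ e. \<integral>\<^sup>+ x. of_nat (of_bool ((x, gsize n e) \<in> S) + marked S n e) \<partial>F \<partial>env_law) =
      (\<integral>\<^sup>+ e. emeasure F {x. (x, gsize n e) \<in> S} + of_nat (marked S n e) \<partial>env_law)"
  proof (rule nn_integral_cong)
    fix e
    have "(\<integral>\<^sup>+ x. of_nat (of_bool ((x, gsize n e) \<in> S) + marked S n e) \<partial>F) =
        (\<integral>\<^sup>+ x. indicator {x. (x, gsize n e) \<in> S} x + of_nat (marked S n e) \<partial>F)"
      by (intro nn_integral_cong) (simp add: indicator_def)
    also have "\<dots> = emeasure F {x. (x, gsize n e) \<in> S} + of_nat (marked S n e)"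
      using slice by (subst nn_integral_add) (simp_all add: F.emeasure_space_1[simplified])
    finally show "(\<integral>\<^sup>+ x. of_nat (of_bool ((x, gsize n e) \<in> S) + marked S n e) \<partial>F) =
        emeasure F {x. (x, gsize n e) \<in> S} + of_nat (marked S n e)" .
  qed
  also have "\<dots> = w n + (\<integral>\<^sup>+ e. of_nat (marked S n e) \<partial>env_law)"
    unfolding w_def by (rule nn_integral_add[OF w_meas]) measurable
  also have "mean * (w n + (\<integral>\<^sup>+ e. of_nat (marked S n e) \<partial>env_law)) =
      (\<Sum>l<Suc n. mean ^ (Suc n - l) * w l)"
  proof -
    have "mean * (\<Sum>l<n. mean ^ (n - l) * w l) = (\<Sum>l<n. mean ^ (Suc n - l) * w l)"
      unfolding sum_distrib_left by (rule sum.cong) (auto simp: Suc_diff_le mult.assoc)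
    then show ?thesis
      unfolding Suc w_def[symmetric] by (simp add: distrib_left add.commute)
  qed
  finally show ?case by (simp only: w_def)
qed simp

lemma nn_integral_nat_law: "(\<integral>\<^sup>+ z. (f z :: ennreal) \<partial>\<zeta>) = (\<Sum>z. f z * emeasure \<zeta> {z})"
proof -
  have "(\<integral>\<^sup>+ z. f z \<partial>\<zeta>) = (\<integral>\<^sup>+ z. (\<Sum>k. f k * indicator {k} z) \<partial>\<zeta>)"
  proof (rule nn_integral_cong)
    fix z
    show "f z = (\<Sum>k. f k * indicator {k} z)"
      by (subst suminf_finite[of "{z}"]) auto
  qed
  also have "\<dots> = (\<Sum>k. \<integral>\<^sup>+ z. f k * indicator {k} z \<partial>\<zeta>)"
    by (rule nn_integral_suminf) measurable
  also have "\<dots> = (\<Sum>k. f k * emeasure \<zeta> {k})"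
    by (intro suminf_cong nn_integral_cmult_indicator) (simp add: sets_\<zeta>)
  finally show ?thesis .
qed

text \<open>On a line of descent of length \<open>n\<close> the \<open>k\<close> large displacements can be chosen in at most \<open>n\<^sup>k\<close> ways. In
the recursion this is the inequality \<open>n\<^sup>k\<^sup>-\<^sup>1 + n\<^sup>k \<le> (n + 1)\<^sup>k\<close>.\<close>

lemma nn_integral_jumps_le:
  "(\<integral>\<^sup>+ e. of_nat (jumps a n k e) \<partial>env_law) \<le> mean ^ n * (of_nat n * emeasure F {x. \<bar>x\<bar> > a}) ^ k"
proof (induction n arbitrary: k)
  case 0
  then show ?case by (cases k) (simp_all add: env.emeasure_space_1[simplified])
next
  case (Suc n)
  define p where "p = emeasure F {x. \<bar>x\<bar> > a}"
  define J where "J k = (\<integral>\<^sup>+ e. of_nat (jumps a n k e) \<partial>env_law)" for k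
  have P: "{x. \<bar>x\<bar> > a} \<in> sets F" by (simp add: sets_F)
  have step: "(\<integral>\<^sup>+ e. of_nat (jumps a (Suc n) k e) \<partial>env_law) =
      mean * (\<integral>\<^sup>+ e. \<integral>\<^sup>+ x. of_nat (jumps a n (if \<bar>x\<bar> > a then k - 1 else k) e) \<partial>F \<partial>env_law)"
    unfolding jumps.simps by (rule nn_integral_branch_sum[OF measurable_jumps_summand])
  show ?case
  proof (cases k)
    case 0
    have "(if \<bar>x\<bar> > a then k - 1 else k) = 0" for x
      by (simp add: 0)
    then have "(\<integral>\<^sup>+ e. of_nat (jumps a (Suc n) k e) \<partial>env_law) = mean * J 0"
      unfolding step J_def by (simp add: F.emeasure_space_1[simplified])
    also have "\<dots> \<le> mean * mean ^ n"
      using Suc[of 0] by (intro mult_left_mono) (simp_all add: J_def)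
    finally show ?thesis by (simp add: 0)
  next
    case (Suc m)
    have "(\<integral>\<^sup>+ x. of_nat (jumps a n (if \<bar>x\<bar> > a then k - 1 else k) e) \<partial>F) \<le>
        of_nat (jumps a n m e) * p + of_nat (jumps a n k e)" for e
    proof -
      have "(\<integral>\<^sup>+ x. of_nat (jumps a n (if \<bar>x\<bar> > a then k - 1 else k) e) \<partial>F) \<le>
          (\<integral>\<^sup>+ x. of_nat (jumps a n m e) * indicator {x. \<bar>x\<bar> > a} x + of_nat (jumps a n k e) \<partial>F)"
        by (rule nn_integral_mono) (simp add: Suc indicator_def)
      also have "\<dots> = of_nat (jumps a n m e) * p + of_nat (jumps a n k e)"
        using P by (simp add: nn_integral_add nn_integral_cmult p_def F.emeasure_space_1[simplified])
      finally show ?thesis .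
    qed
    then have "(\<integral>\<^sup>+ e. of_nat (jumps a (Suc n) k e) \<partial>env_law) \<le>
        mean * (\<integral>\<^sup>+ e. of_nat (jumps a n m e) * p + of_nat (jumps a n k e) \<partial>env_law)"
      unfolding step by (intro mult_left_mono nn_integral_mono) simp_all
    also have "\<dots> = mean * (J m * p + J k)"
      by (simp add: J_def nn_integral_add nn_integral_multc)
    also have "\<dots> \<le> mean * (mean ^ n * (of_nat n * p) ^ m * p + mean ^ n * (of_nat n * p) ^ k)"
      using Suc.IH[of m] Suc.IH[of k] unfolding J_def p_def
      by (intro mult_left_mono add_mono mult_right_mono) simp_all
    also have "\<dots> = mean ^ Suc n * (p ^ k * of_nat (n ^ m + n ^ k))"
      by (simp add: Suc power_mult_distrib algebra_simps)
    also have "\<dots> \<le> mean ^ Suc n * (p ^ k * of_nat (Suc n ^ k))"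
    proof -
      have "n ^ m + n ^ k = n ^ m * Suc n" by (simp add: Suc)
      also have "\<dots> \<le> Suc n ^ m * Suc n" by (intro mult_right_mono power_mono) auto
      finally have "n ^ m + n ^ k \<le> Suc n ^ k" by (simp add: Suc mult.commute)
      then show ?thesis by (intro mult_left_mono of_nat_mono) auto
    qed
    finally show ?thesis by (simp add: p_def power_mult_distrib mult.commute)
  qed
qed

text \<open>No displacement in \<open>B\<close> occurs if and only if none occurs on the edges to the children and in their subtrees, which
are independent; so the probability is the generating function of the number of children at the product of the
probabilities for one child.\<close>

lemma emeasure_marked_eq_0:
  fixes B :: "real set"
  assumes B [measurable]: "B \<in> sets borel"
  defines "v \<equiv> \<lambda>n. emeasure env_law {e. marked (B \<times> UNIV) n e = 0}"
  shows "v (Suc n) = (\<integral>\<^sup>+ z. (emeasure F (- B) * v n) ^ z \<partial>\<zeta>)"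
proof -
  have S [measurable]: "B \<times> UNIV \<in> sets (borel \<Otimes>\<^sub>M count_space (UNIV :: nat set))"
    by simp
  have sets_marked: "{e. marked (B \<times> UNIV) n e = 0} \<in> sets env_law" for n
  proof -
    have "marked (B \<times> UNIV) n -` {0} \<inter> space environment_space \<in> sets environment_space"
      by (rule measurable_sets[OF measurable_marked[OF S]]) simp
    then show ?thesis by (simp add: vimage_def sets_env_law space_PiM space_pair_measure)
  qed
  have B' [measurable]: "- B \<in> sets borel" by simp
  define f :: "nat \<Rightarrow> reproduction \<Rightarrow> ennreal" where
    "f k r = indicator ({k} \<times> {x. \<forall>j<k. x j \<in> - B}) r" for k r
  define g :: "environment \<Rightarrow> ennreal" where "g = indicator {e. marked (B \<times> UNIV) n e = 0}"
  have box: "{x. \<forall>j<k. x j \<in> - B} \<in> sets (PiM UNIV (\<lambda>_ :: nat. borel))" for k :: nat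
  proof -
    have "{x \<in> space (PiM UNIV (\<lambda>_ :: nat. borel)). \<forall>j<k. x j \<in> - B} \<in> sets (PiM UNIV (\<lambda>_ :: nat. borel))"
      by measurable
    then show ?thesis by (simp add: space_PiM)
  qed
  have f [measurable]: "f k \<in> borel_measurable reproduction_space" for k
    unfolding f_def [abs_def] using box[of k] by (intro borel_measurable_indicator) simp
  have g [measurable]: "g \<in> borel_measurable environment_space"
    unfolding g_def using sets_marked[of n] by (intro borel_measurable_indicator) (simp add: sets_env_law)
  have "indicator {e. marked (B \<times> UNIV) (Suc n) e = 0} e =
      (\<Sum>k. f k (e []) * (\<Prod>j\<in>{..<k}. g (shift j e)))" for e
  proof -
    let ?k = "fst (e [])"
    have "(\<Sum>k. f k (e []) * (\<Prod>j\<in>{..<k}. g (shift j e))) =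
        (\<Sum>k\<in>{?k}. f k (e []) * (\<Prod>j\<in>{..<k}. g (shift j e)))"
      by (rule suminf_finite) (auto simp: f_def indicator_def)
    also have "\<dots> = f ?k (e []) * (\<Prod>j\<in>{..<?k}. g (shift j e))" by simp
    also have "(\<Prod>j\<in>{..<?k}. g (shift j e)) = of_bool (\<forall>j<?k. marked (B \<times> UNIV) n (shift j e) = 0)"
      by (auto simp: g_def indicator_def intro!: prod.neutral)
    also have "f ?k (e []) = of_bool (\<forall>j<?k. snd (e []) j \<notin> B)"
      by (cases "e []") (auto simp: f_def indicator_def)
    finally show ?thesis
      by (auto simp: branch_sum_eq_0_iff indicator_def)
  qed
  note decomposition = this
  have "v (Suc n) = (\<integral>\<^sup>+ e. indicator {e. marked (B \<times> UNIV) (Suc n) e = 0} e \<partial>env_law)"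
    unfolding v_def by (rule nn_integral_indicator[symmetric, OF sets_marked])
  also have "\<dots> = (\<integral>\<^sup>+ e. (\<Sum>k. f k (e []) * (\<Prod>j\<in>{..<k}. g (shift j e))) \<partial>env_law)"
    by (rule nn_integral_cong) (rule decomposition)
  also have "\<dots> = (\<Sum>k. \<integral>\<^sup>+ e. f k (e []) * (\<Prod>j\<in>{..<k}. g (shift j e)) \<partial>env_law)"
    by (rule nn_integral_suminf) measurable
  also have "\<dots> = (\<Sum>k. (\<integral>\<^sup>+ r. f k r \<partial>rep_law) * (\<Prod>j\<in>{..<k}. \<integral>\<^sup>+ e. g e \<partial>env_law))"
    by (intro suminf_cong nn_integral_root_prod) simp_all
  also have "\<dots> = (\<Sum>k. (emeasure F (- B) * v n) ^ k * emeasure \<zeta> {k})"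
  proof (rule suminf_cong)
    fix k
    interpret disp: prob_space "PiM UNIV (\<lambda>_ :: nat. F)" by (rule prob_space_displacements)
    interpret disp: product_prob_space "\<lambda>_ :: nat. F" UNIV
      by unfold_locales
    have "(\<integral>\<^sup>+ r. f k r \<partial>rep_law) = emeasure rep_law ({k} \<times> {x. \<forall>j<k. x j \<in> - B})"
      unfolding f_def using box[of k] by (simp add: sets_rep_law)
    also have "\<dots> = emeasure \<zeta> {k} * emeasure (PiM UNIV (\<lambda>_. F)) {x. \<forall>j<k. x j \<in> - B}"
      unfolding rep_law_def using box[of k]
      by (intro disp.emeasure_pair_measure_Times) (simp_all add: sets_\<zeta> sets_displacements)
    also have "emeasure (PiM UNIV (\<lambda>_. F)) {x. \<forall>j<k. x j \<in> - B} = (\<Prod>j\<in>{..<k}. emeasure F (- B))"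
      using disp.emeasure_PiM_Collect[of "{..<k}" "\<lambda>_. - B"] by (simp add: sets_F space_PiM Ball_def)
    also have "(\<integral>\<^sup>+ e. g e \<partial>env_law) = v n"
      unfolding g_def v_def by (rule nn_integral_indicator[OF sets_marked])
    ultimately show "(\<integral>\<^sup>+ r. f k r \<partial>rep_law) * (\<Prod>j\<in>{..<k}. \<integral>\<^sup>+ e. g e \<partial>env_law) =
        (emeasure F (- B) * v n) ^ k * emeasure \<zeta> {k}"
      by (simp add: power_mult_distrib mult_ac)
  qed
  also have "\<dots> = (\<integral>\<^sup>+ z. (emeasure F (- B) * v n) ^ z \<partial>\<zeta>)"
    by (rule nn_integral_nat_law[symmetric])
  finally show ?thesis .
qed

lemma emeasure_pos_le_nn_integral:
  assumes "{e. f e > (0 :: nat)} \<in> sets env_law"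
  shows "emeasure env_law {e. f e > 0} \<le> (\<integral>\<^sup>+ e. of_nat (f e) \<partial>env_law)"
proof -
  have "indicator {e. f e > 0} e \<le> (of_nat (f e) :: ennreal)" for e
    using of_nat_mono[of "of_bool (f e > 0)" "f e", where 'a = ennreal] by (simp add: indicator_def)
  then have "(\<integral>\<^sup>+ e. indicator {e. f e > 0} e \<partial>env_law) \<le> (\<integral>\<^sup>+ e. of_nat (f e) \<partial>env_law)"
    by (rule nn_integral_mono)
  then show ?thesis by (simp only: nn_integral_indicator[OF assms])
qed

end

section \<open>Absence of a second big displacement\<close>

text \<open>The truncated geometric series is bounded by a telescoping sum: each summand \<open>min 1 x\<close> is at most a constant
times the increment of \<open>\<lambda>t. ln (1 + t)\<close> from \<open>x\<close> to \<open>x \<mu>\<close>. It produces the logarithm in the moment condition.\<close>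

lemma sum_min_one_le_ln:
  fixes \<mu> y :: real
  assumes "\<mu> > 1" "y \<ge> 0"
  shows "(\<Sum>k<n. min 1 (y * \<mu> ^ k)) \<le> 2 * \<mu> / (\<mu> - 1) * ln (1 + y * \<mu> ^ n)"
proof (induction n)
  case 0
  then show ?case using assms by simp
next
  case (Suc n)
  have step: "min 1 x \<le> 2 * \<mu> / (\<mu> - 1) * (ln (1 + x * \<mu>) - ln (1 + x))" if "x \<ge> 0" for x :: real
  proof -
    have pos: "0 < 1 + x" "0 < 1 + x * \<mu>" using assms that by (auto intro: add_pos_nonneg)
    have "ln ((1 + x) / (1 + x * \<mu>)) \<le> (1 + x) / (1 + x * \<mu>) - 1"
      using pos by (intro ln_le_minus_one) simp
    then have "(\<mu> - 1) * x / (1 + x * \<mu>) \<le> ln (1 + x * \<mu>) - ln (1 + x)"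
      using pos by (simp add: ln_div field_simps)
    moreover have "min 1 x / (2 * \<mu>) \<le> x / (1 + x * \<mu>)"
    proof (cases "x \<le> 1")
      case True
      have "1 + x * \<mu> \<le> 2 * \<mu>"
        using mult_right_mono[OF True, of \<mu>] assms by linarith
      then show ?thesis
        using True that assms pos by (intro frac_le) (auto simp: min_def)
    next
      case False
      have "1 \<le> x * \<mu>" using False assms mult_mono[of 1 x 1 \<mu>] by simp
      then show ?thesis
        using False assms pos by (simp add: field_simps)
    qed
    from mult_left_mono[OF this, of "\<mu> - 1"] have "(\<mu> - 1) * (min 1 x / (2 * \<mu>)) \<le> (\<mu> - 1) * x / (1 + x * \<mu>)"
      using assms by simp
    ultimately have "(\<mu> - 1) * (min 1 x / (2 * \<mu>)) \<le> ln (1 + x * \<mu>) - ln (1 + x)" by linarith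
    then show ?thesis using assms by (simp add: field_simps)
  qed
  have "min 1 (y * \<mu> ^ n) \<le> 2 * \<mu> / (\<mu> - 1) * (ln (1 + y * \<mu> ^ n * \<mu>) - ln (1 + y * \<mu> ^ n))"
    using assms by (intro step) simp
  then show ?case
    using Suc by (simp add: algebra_simps)
qed

text \<open>First-order expansion with an error that is at most quadratic and at most linear; with the quadratic bound alone a
second moment would be required.\<close>

lemma power_le_quadratic:
  fixes s :: real
  assumes "0 \<le> s" "s \<le> 1"
  shows "(1 - s) ^ z \<le> 1 - z * s + z * s * min 1 (z * s)"
proof (cases "z * s \<ge> 1")
  case True
  have "(1 - s) ^ z \<le> 1" using assms by (intro power_le_one) auto
  then show ?thesis using True by (simp add: min_def)
next
  case False
  let ?y = "z * s"
  have y: "0 \<le> ?y" using assms by simp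
  have "(1 - s) ^ z \<le> exp (- s) ^ z"
    using assms exp_ge_add_one_self[of "- s"] by (intro power_mono) auto
  also have "\<dots> = exp (- ?y)" by (simp add: exp_of_nat_mult[symmetric])
  also have "\<dots> \<le> 1 / (1 + ?y)"
    using exp_ge_add_one_self[of ?y] y by (simp add: exp_minus field_simps)
  also have "\<dots> \<le> 1 - ?y + ?y * ?y"
  proof -
    have "(1 - ?y + ?y * ?y) * (1 + ?y) = 1 + ?y ^ 3"
      by (simp add: algebra_simps power3_eq_cube)
    also have "\<dots> \<ge> 1" using y by (intro order_trans[OF _ add_increasing2]) auto
    finally show ?thesis using y by (simp add: divide_le_eq)
  qed
  finally show ?thesis using False by (simp add: min_def)
qed

lemma ln_le_log_plus:
  assumes "0 \<le> c" "c \<le> M"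
  shows "ln (1 + real z * c) \<le> ln (1 + M) + ln 2 + log_plus (real z)"
proof -
  let ?m = "max (real z) 1"
  have "1 + real z * c \<le> ?m + ?m * M"
    using assms by (intro add_mono mult_mono) auto
  also have "\<dots> \<le> (1 + M) * 2 * ?m"
    using assms by (simp add: algebra_simps)
  finally have "ln (1 + real z * c) \<le> ln ((1 + M) * 2 * ?m)"
    using assms by (intro ln_mono) (auto intro: add_pos_nonneg)
  also have "\<dots> = ln (1 + M) + ln 2 + ln ?m"
    using ln_mult_pos[of "(1 + M) * 2" ?m] ln_mult_pos[of "1 + M" 2] assms by simp
  finally show ?thesis by (simp add: log_plus_def)
qed

locale branching_moments = branching +
  fixes \<mu> :: real
  assumes integrable_progeny: "integrable \<zeta> real"
    and mean_progeny: "\<mu> = (\<integral>z. real z \<partial>\<zeta>)" and supercritical: "\<mu> > 1"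
    and integrable_log: "integrable \<zeta> (\<lambda>z. real z * log_plus (real z))"
begin

lemma measurable_\<zeta> [measurable]: "f \<in> borel_measurable \<zeta>"
  by (simp add: measurable_cong_sets[OF sets_\<zeta> refl])

lemma mean_eq: "mean = ennreal \<mu>"
proof -
  have "mean = (\<integral>\<^sup>+ z. ennreal (real z) \<partial>\<zeta>)"
    unfolding mean_def by (rule nn_integral_cong) (simp add: ennreal_of_nat_eq_real_of_nat)
  also have "\<dots> = ennreal \<mu>"
    unfolding mean_progeny by (rule nn_integral_eq_integral[OF integrable_progeny]) simp
  finally show ?thesis .
qed

lemma integrable_dominating:
  "integrable \<zeta> (\<lambda>z. real z * (K + log_plus (real z)))"
  using integrable_progeny integrable_log by (simp add: distrib_left)

lemma ln_term_bound:
  assumes "0 \<le> c" "c \<le> M"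
  shows "norm (real z * ln (1 + real z * c)) \<le> real z * (ln (1 + M) + ln 2 + log_plus (real z))"
  using ln_le_log_plus[OF assms, of z] assms by (simp add: abs_mult mult_left_mono)

lemma integrable_ln_term:
  assumes "0 \<le> c"
  shows "integrable \<zeta> (\<lambda>z. real z * ln (1 + real z * c))"
proof (rule Bochner_Integration.integrable_bound)
  show "integrable \<zeta> (\<lambda>z. real z * (ln (1 + c) + ln 2 + log_plus (real z)))"
    by (rule integrable_dominating)
  show "AE z in \<zeta>. norm (real z * ln (1 + real z * c)) \<le>
      norm (real z * (ln (1 + c) + ln 2 + log_plus (real z)))"
  proof (rule AE_I2)
    fix z
    show "norm (real z * ln (1 + real z * c)) \<le> norm (real z * (ln (1 + c) + ln 2 + log_plus (real z)))"
      using ln_term_bound[OF assms order_refl, of z] unfolding real_norm_def by linarith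
  qed
qed simp

text \<open>Dominated convergence; the integrability of \<open>Z log\<^sub>+ Z\<close> provides the dominating function.\<close>

lemma ln_term_tendsto_0:
  assumes c: "c \<longlonglongrightarrow> 0" and nonneg: "\<And>n. 0 \<le> c n"
  shows "(\<lambda>n. \<integral>z. real z * ln (1 + real z * c n) \<partial>\<zeta>) \<longlonglongrightarrow> 0"
proof -
  obtain M where M: "\<And>n. c n \<le> M"
    using convergent_imp_Bseq[OF convergentI[OF c]] unfolding Bseq_def by (auto simp: abs_le_iff)
  have "(\<lambda>n. \<integral>z. real z * ln (1 + real z * c n) \<partial>\<zeta>) \<longlonglongrightarrow> (\<integral>z. 0 \<partial>\<zeta>)"
  proof (rule integral_dominated_convergence)
    show "integrable \<zeta> (\<lambda>z. real z * (ln (1 + M) + ln 2 + log_plus (real z)))"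
      by (rule integrable_dominating)
    show "AE z in \<zeta>. (\<lambda>n. real z * ln (1 + real z * c n)) \<longlonglongrightarrow> 0"
    proof (rule AE_I2)
      fix z
      have "(\<lambda>n. real z * ln (1 + real z * c n)) \<longlonglongrightarrow> real z * ln (1 + real z * 0)"
        by (intro tendsto_intros c) auto
      then show "(\<lambda>n. real z * ln (1 + real z * c n)) \<longlonglongrightarrow> 0" by simp
    qed
    show "AE z in \<zeta>. norm (real z * ln (1 + real z * c n)) \<le>
        real z * (ln (1 + M) + ln 2 + log_plus (real z))" for n
      using ln_term_bound[OF nonneg M] by blast
  qed simp_all
  then show ?thesis by simp
qed

text \<open>The expected number of edges in the generations \<open>1\<close> to \<open>n\<close> whose displacement lies in a set of probability
\<open>p\<close>, see \<open>nn_integral_marked_big\<close>.\<close>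

definition big_mean :: "real \<Rightarrow> nat \<Rightarrow> real" where
  "big_mean p n = p * (\<Sum>l<n. \<mu> ^ (n - l))"

lemma big_mean_Suc: "big_mean p (Suc n) = \<mu> * (p + big_mean p n)"
proof -
  have "(\<Sum>l<n. \<mu> ^ (Suc n - l)) = \<mu> * (\<Sum>l<n. \<mu> ^ (n - l))"
    unfolding sum_distrib_left by (rule sum.cong) (auto simp: Suc_diff_le)
  then show ?thesis by (simp add: big_mean_def algebra_simps)
qed

lemma big_mean_nonneg: "0 \<le> p \<Longrightarrow> 0 \<le> big_mean p n"
  using supercritical by (auto simp: big_mean_def intro!: mult_nonneg_nonneg sum_nonneg)

lemma big_mean_eq: "big_mean p n = \<mu> / (\<mu> - 1) * p * (\<mu> ^ n - 1)"
proof (induction n)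
  case (Suc n)
  then show ?case using supercritical by (simp add: big_mean_Suc field_simps)
qed (simp add: big_mean_def)

lemma big_mean_le:
  assumes "0 \<le> p"
  shows "p + big_mean p n \<le> \<mu> / (\<mu> - 1) * p * \<mu> ^ n" and "big_mean p n \<le> \<mu> / (\<mu> - 1) * p * \<mu> ^ n"
proof -
  have "p \<le> \<mu> / (\<mu> - 1) * p"
    using assms supercritical by (simp add: field_simps)
  then show "p + big_mean p n \<le> \<mu> / (\<mu> - 1) * p * \<mu> ^ n"
    unfolding big_mean_eq right_diff_distrib by linarith
  then show "big_mean p n \<le> \<mu> / (\<mu> - 1) * p * \<mu> ^ n"
    using assms by simp
qed

lemma nn_integral_marked_big:
  assumes B: "B \<in> sets borel"
  shows "(\<integral>\<^sup>+ e. of_nat (marked (B \<times> UNIV) n e) \<partial>env_law) = ennreal (big_mean (measure F B) n)"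
proof -
  have S: "B \<times> UNIV \<in> sets (borel \<Otimes>\<^sub>M count_space (UNIV :: nat set))" using B by simp
  have "(\<integral>\<^sup>+ e. of_nat (marked (B \<times> UNIV) n e) \<partial>env_law) = (\<Sum>l<n. ennreal \<mu> ^ (n - l) * ennreal (measure F B))"
    by (simp add: nn_integral_marked[OF S] mean_eq F.emeasure_eq_measure env.emeasure_space_1[simplified])
  also have "\<dots> = (\<Sum>l<n. ennreal (\<mu> ^ (n - l) * measure F B))"
    using supercritical by (simp add: ennreal_mult' ennreal_power)
  also have "\<dots> = ennreal (big_mean (measure F B) n)"
    using supercritical by (subst sum_ennreal) (auto simp: big_mean_def sum_distrib_left mult.commute)
  finally show ?thesis .
qed

lemma sets_marked:
  assumes "S \<in> sets (borel \<Otimes>\<^sub>M count_space UNIV)"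
  shows "{e. P (marked S n e)} \<in> sets env_law"
proof -
  have "marked S n -` {k. P k} \<inter> space environment_space \<in> sets environment_space"
    by (rule measurable_sets[OF measurable_marked[OF assms]]) simp
  then show ?thesis by (simp add: vimage_def sets_env_law space_PiM space_pair_measure)
qed

text \<open>Let \<open>t n\<close> be the expected number of edges with a displacement in \<open>B\<close> and \<open>u n\<close> the probability that there is one.
The recursions \<open>t (n + 1) = \<mu> (p + t n)\<close> and \<open>u (n + 1) = 1 - E (1 - s)\<^sup>Z\<close> with \<open>s = p + u n - p u n\<close> give a linear
recursion for the difference \<open>t n - u n\<close>, whose inhomogeneity consists of \<open>\<mu> p t n\<close> (a big displacement followed by another
one in its subtree) and \<open>K s = E (s Z min 1 (s Z))\<close> (big displacements below several children). Since \<open>s\<close> is of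
order \<open>p \<mu>\<^sup>n\<close>, summing the second term over the generations gives the truncated geometric series that is bounded by
\<open>ln\<close>. The difference is the expectation of the number of superfluous edges, so it bounds the probability of
two big displacements.\<close>

lemma big_mean_minus_prob_le:
  assumes B: "B \<in> sets borel"
  defines "p \<equiv> measure F B"
  shows "big_mean p n - env.prob {e. marked (B \<times> UNIV) n e > 0} \<le>
    p * \<mu> ^ n * (\<mu> / (\<mu> - 1) * n * p +
      2 * \<mu> / (\<mu> - 1)\<^sup>2 * (\<integral>z. real z * ln (1 + real z * (\<mu> / (\<mu> - 1) * p * \<mu> ^ n)) \<partial>\<zeta>))"
proof -
  have S: "B \<times> UNIV \<in> sets (borel \<Otimes>\<^sub>M count_space (UNIV :: nat set))" using B by simp
  have p: "0 \<le> p" "p \<le> 1" by (auto simp: p_def)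
  define C where "C = \<mu> / (\<mu> - 1)"
  have C: "C > 0" using supercritical by (simp add: C_def)
  define t where "t = big_mean p"
  define v where "v n = env.prob {e. marked (B \<times> UNIV) n e = 0}" for n
  define u where "u n = env.prob {e. marked (B \<times> UNIV) n e > 0}" for n
  define K where "K s = (\<integral>z. z * s * min 1 (z * s) \<partial>\<zeta>)" for s :: real
  have uv: "u n = 1 - v n" for n
    using env.prob_compl[OF sets_marked[OF S, of "\<lambda>k. k = 0" n]]
    by (simp add: u_def v_def Compl_eq_Diff_UNIV[symmetric] Collect_neg_eq[symmetric])
  have K_int: "integrable \<zeta> (\<lambda>z. z * s * min 1 (z * s))" if "0 \<le> s" for s :: real
  proof (rule Bochner_Integration.integrable_bound)
    show "integrable \<zeta> (\<lambda>z. real z * s)" using integrable_progeny by simp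
    show "AE z in \<zeta>. norm (real z * s * min 1 (real z * s)) \<le> norm (real z * s)"
      using that by (intro AE_I2) (auto simp: abs_mult intro!: mult_left_le)
  qed simp
  have K_mono: "K s \<le> K s'" if "0 \<le> s" "s \<le> s'" for s s'
    unfolding K_def using that
    by (intro integral_mono K_int mult_mono min.mono mult_nonneg_nonneg) auto
  have u_le_t: "u n \<le> t n" for n
  proof -
    have "emeasure env_law {e. marked (B \<times> UNIV) n e > 0} \<le> (\<integral>\<^sup>+ e. of_nat (marked (B \<times> UNIV) n e) \<partial>env_law)"
      by (rule emeasure_pos_le_nn_integral[OF sets_marked[OF S]])
    also have "\<dots> = ennreal (t n)"
      unfolding t_def p_def by (rule nn_integral_marked_big[OF B])
    finally have "ennreal (u n) \<le> ennreal (t n)"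
      unfolding u_def env.emeasure_eq_measure .
    moreover have "0 \<le> t n" unfolding t_def by (rule big_mean_nonneg[OF p(1)])
    ultimately show ?thesis by (simp only: ennreal_le_iff)
  qed
  \<comment> \<open>the generating function is expanded to first order by \<open>power_le_quadratic\<close>\<close>
  have step: "t (Suc n) - u (Suc n) \<le> \<mu> * (t n - u n) + \<mu> * p * t n + K (p + t n)" for n
  proof -
    define s where "s = p + u n - p * u n"
    have s1: "1 - s = (1 - p) * v n" by (simp add: s_def uv algebra_simps)
    have un: "0 \<le> u n" "u n \<le> 1" by (auto simp: u_def)
    have "0 \<le> p * (1 - u n) + u n" "0 \<le> (1 - p) * v n"
      using p un by (auto simp: v_def)
    then have s: "0 \<le> s" "s \<le> 1"
      using s1 by (auto simp: s_def algebra_simps)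
    have "ennreal (v (Suc n)) = (\<integral>\<^sup>+ z. (emeasure F (- B) * emeasure env_law {e. marked (B \<times> UNIV) n e = 0}) ^ z \<partial>\<zeta>)"
      using emeasure_marked_eq_0[OF B, of n] by (simp add: v_def env.emeasure_eq_measure)
    also have "emeasure F (- B) * emeasure env_law {e. marked (B \<times> UNIV) n e = 0} = ennreal (1 - s)"
    proof -
      have "measure F (- B) = 1 - p"
        using F.prob_compl[of B] B by (simp add: p_def sets_F Compl_eq_Diff_UNIV)
      then show ?thesis
        using p by (simp add: s1 v_def env.emeasure_eq_measure F.emeasure_eq_measure ennreal_mult')
    qed
    also have "(\<integral>\<^sup>+ z. ennreal (1 - s) ^ z \<partial>\<zeta>) = (\<integral>\<^sup>+ z. ennreal ((1 - s) ^ z) \<partial>\<zeta>)"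
      using s by (simp add: ennreal_power)
    also have "\<dots> \<le> (\<integral>\<^sup>+ z. ennreal (1 - z * s + z * s * min 1 (z * s)) \<partial>\<zeta>)"
      using power_le_quadratic[OF s] by (intro nn_integral_mono ennreal_leI) simp
    also have "\<dots> = ennreal (\<integral>z. 1 - z * s + z * s * min 1 (z * s) \<partial>\<zeta>)"
    proof (rule nn_integral_eq_integral)
      show "integrable \<zeta> (\<lambda>z. 1 - z * s + z * s * min 1 (z * s))"
        using K_int[OF s(1)] integrable_progeny by simp
      show "AE z in \<zeta>. 0 \<le> 1 - z * s + z * s * min 1 (z * s)"
        using order_trans[OF zero_le_power power_le_quadratic[OF s]] s by (intro AE_I2) simp
    qed
    also have "(\<integral>z. 1 - z * s + z * s * min 1 (z * s) \<partial>\<zeta>) = 1 - \<mu> * s + K s"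
      using K_int[OF s(1)] integrable_progeny by (simp add: K_def mean_progeny \<zeta>.prob_space[simplified])
    finally have "v (Suc n) \<le> max 0 (1 - \<mu> * s + K s)"
      by (auto simp: ennreal_le_iff2 max_def)
    moreover have "0 \<le> 1 - \<mu> * s + K s"
    proof -
      have "0 \<le> (\<integral>z. 1 - z * s + z * s * min 1 (z * s) \<partial>\<zeta>)"
        using order_trans[OF zero_le_power power_le_quadratic[OF s]] s by (intro integral_nonneg_AE AE_I2) simp
      then show ?thesis
        using K_int[OF s(1)] integrable_progeny by (simp add: K_def mean_progeny \<zeta>.prob_space[simplified])
    qed
    ultimately have "v (Suc n) \<le> 1 - \<mu> * s + K s" by simp
    then have "t (Suc n) - u (Suc n) \<le> \<mu> * (p + t n) - \<mu> * s + K s"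
      by (simp add: uv t_def big_mean_Suc)
    also have "\<mu> * (p + t n) - \<mu> * s = \<mu> * (t n - u n) + \<mu> * p * u n"
      by (simp add: s_def algebra_simps)
    also have "K s \<le> K (p + t n)"
      using s u_le_t[of n] mult_nonneg_nonneg[OF p(1) un(1)]
      by (intro K_mono) (auto simp: s_def)
    also have "\<mu> * p * u n \<le> \<mu> * p * t n"
      using supercritical p u_le_t by (intro mult_left_mono) auto
    finally show ?thesis by simp
  qed
  define I where "I n = (\<integral>z. real z * (\<Sum>k<n. min 1 (real z * (C * p) * \<mu> ^ k)) \<partial>\<zeta>)" for n
  have I_int': "integrable \<zeta> (\<lambda>z. real z * min 1 (real z * (C * p) * \<mu> ^ k))" for k
  proof (rule Bochner_Integration.integrable_bound[OF integrable_progeny])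
    show "AE z in \<zeta>. norm (real z * min 1 (real z * (C * p) * \<mu> ^ k)) \<le> norm (real z)"
      using C p supercritical by (intro AE_I2) (auto simp: abs_mult intro!: mult_left_le)
  qed simp
  have I_int: "integrable \<zeta> (\<lambda>z. real z * (\<Sum>k<n. min 1 (real z * (C * p) * \<mu> ^ k)))" for n
    using I_int' by (simp add: sum_distrib_left)
  have K_I: "K (p + t n) \<le> C * p * \<mu> ^ n * (I (Suc n) - I n)" for n
  proof -
    have "K (p + t n) \<le> K (C * p * \<mu> ^ n)"
      using big_mean_le(1)[OF p(1), of n] big_mean_nonneg[OF p(1), of n] p
      by (intro K_mono) (auto simp: t_def C_def)
    also have "\<dots> = C * p * \<mu> ^ n * (\<integral>z. real z * min 1 (real z * (C * p) * \<mu> ^ n) \<partial>\<zeta>)"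
      unfolding K_def by (subst integral_mult_right_zero[symmetric]) (simp add: mult_ac)
    also have "(\<integral>z. real z * min 1 (real z * (C * p) * \<mu> ^ n) \<partial>\<zeta>) = I (Suc n) - I n"
      unfolding I_def using I_int[of n] I_int'[of n] by (simp add: distrib_left)
    finally show ?thesis .
  qed
  have I_bound: "t n - u n \<le> p * \<mu> ^ n * (C * n * p + C / \<mu> * I n)"
  proof (induction n)
    case 0
    then show ?case by (simp add: t_def big_mean_def u_def I_def)
  next
    case (Suc n)
    have "t (Suc n) - u (Suc n) \<le> \<mu> * (t n - u n) + \<mu> * p * t n + K (p + t n)" by (rule step)
    also have "\<mu> * (t n - u n) \<le> \<mu> * (p * \<mu> ^ n * (C * n * p + C / \<mu> * I n))"
      using Suc supercritical by (intro mult_left_mono) auto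
    also have "\<mu> * p * t n \<le> \<mu> * p * (C * p * \<mu> ^ n)"
      using big_mean_le(2)[OF p(1), of n] p supercritical by (intro mult_left_mono) (auto simp: t_def C_def)
    also note K_I
    also have "\<mu> * (p * \<mu> ^ n * (C * n * p + C / \<mu> * I n)) + \<mu> * p * (C * p * \<mu> ^ n) +
        C * p * \<mu> ^ n * (I (Suc n) - I n) = p * \<mu> ^ Suc n * (C * Suc n * p + C / \<mu> * I (Suc n))"
      using supercritical by (simp add: field_simps)
    finally show ?case by simp
  qed
  have "I n \<le> (\<integral>z. real z * (2 * \<mu> / (\<mu> - 1) * ln (1 + real z * (C * p) * \<mu> ^ n)) \<partial>\<zeta>)"
    unfolding I_def
  proof (rule integral_mono[OF I_int])
    have "integrable \<zeta> (\<lambda>z. 2 * \<mu> / (\<mu> - 1) * (real z * ln (1 + real z * (C * p * \<mu> ^ n))))"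
      using C p supercritical by (intro integrable_mult_right integrable_ln_term) auto
    then show "integrable \<zeta> (\<lambda>z. real z * (2 * \<mu> / (\<mu> - 1) * ln (1 + real z * (C * p) * \<mu> ^ n)))"
      by (simp add: mult_ac)
    show "real z * (\<Sum>k<n. min 1 (real z * (C * p) * \<mu> ^ k)) \<le>
        real z * (2 * \<mu> / (\<mu> - 1) * ln (1 + real z * (C * p) * \<mu> ^ n))" for z
      using C p supercritical by (intro mult_left_mono sum_min_one_le_ln) auto
  qed
  also have "(\<integral>z. real z * (2 * \<mu> / (\<mu> - 1) * ln (1 + real z * (C * p) * \<mu> ^ n)) \<partial>\<zeta>) =
      2 * \<mu> / (\<mu> - 1) * (\<integral>z. real z * ln (1 + real z * (C * p * \<mu> ^ n)) \<partial>\<zeta>)"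
    by (subst integral_mult_right_zero[symmetric]) (simp add: mult_ac)
  finally have I_le: "I n \<le> 2 * \<mu> / (\<mu> - 1) * (\<integral>z. real z * ln (1 + real z * (C * p * \<mu> ^ n)) \<partial>\<zeta>)" .
  note I_bound
  also have "p * \<mu> ^ n * (C * n * p + C / \<mu> * I n) \<le> p * \<mu> ^ n * (C * n * p + C / \<mu> *
      (2 * \<mu> / (\<mu> - 1) * (\<integral>z. real z * ln (1 + real z * (C * p * \<mu> ^ n)) \<partial>\<zeta>)))"
    using p C supercritical by (intro mult_left_mono add_left_mono I_le) auto
  also have "C / \<mu> * (2 * \<mu> / (\<mu> - 1) * x) = 2 * \<mu> / (\<mu> - 1)\<^sup>2 * x" for x
    using supercritical by (simp add: C_def power2_eq_square)
  finally show ?thesis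
    by (simp add: t_def u_def C_def)
qed

text \<open>Let \<open>V\<close> and \<open>B\<close> be the numbers of edges marked by \<open>S\<close> and of big edges. As \<open>V \<le> B\<close>, the pointwise inequality
\<open>V + 2 [B > 0] \<le> [V > 0, B \<le> 1] + 2 B\<close> holds; integration gives the claim.\<close>

lemma prob_one_big_ge:
  assumes S: "S \<in> sets (borel \<Otimes>\<^sub>M count_space UNIV)" and SB: "S \<subseteq> big c"
  shows "(\<integral>\<^sup>+ e. of_nat (marked S n e) \<partial>env_law) \<le>
    emeasure env_law {e. marked S n e > 0 \<and> marked (big c) n e \<le> 1} +
    2 * ennreal (big_mean (measure F {x. \<bar>x\<bar> > c}) n - env.prob {e. marked (big c) n e > 0})"
proof -
  define t where "t = big_mean (measure F {x. \<bar>x\<bar> > c}) n"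
  define u where "u = env.prob {e. marked (big c) n e > 0}"
  have t: "(\<integral>\<^sup>+ e. of_nat (marked (big c) n e) \<partial>env_law) = ennreal t"
    unfolding t_def big_eq_Times by (rule nn_integral_marked_big[OF abs_gt_borel])
  have sets_u: "{e. marked (big c) n e > 0} \<in> sets env_law"
    by (rule sets_marked[OF big_in_sets])
  have "{e. marked S n e > 0} \<inter> {e. marked (big c) n e \<le> 1} \<in> sets env_law"
    by (intro sets.Int sets_marked S big_in_sets)
  then have sets_G: "{e. marked S n e > 0 \<and> marked (big c) n e \<le> 1} \<in> sets env_law"
    by (simp add: Int_def)
  let ?G = "{e. marked S n e > 0 \<and> marked (big c) n e \<le> 1}" and ?U = "{e. marked (big c) n e > 0}"
  have m: "(\<lambda>e. of_nat (marked S n e) :: ennreal) \<in> borel_measurable env_law"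
      "(\<lambda>e. of_nat (marked (big c) n e) :: ennreal) \<in> borel_measurable env_law"
    using measurable_compose[OF measurable_marked[OF S], of of_nat "borel :: ennreal measure"]
      measurable_compose[OF measurable_marked[OF big_in_sets], of of_nat "borel :: ennreal measure"]
    by (simp_all add: measurable_cong_sets[OF sets_env_law refl])
  have "(of_nat (marked S n e) :: ennreal) + 2 * indicator ?U e \<le>
      indicator ?G e + 2 * of_nat (marked (big c) n e)" for e
  proof -
    have "marked S n e \<le> marked (big c) n e" by (rule marked_mono[OF SB])
    then have "marked S n e + 2 * of_bool (e \<in> ?U) \<le> of_bool (e \<in> ?G) + 2 * marked (big c) n e"
      by auto
    from of_nat_mono[OF this, where 'a = ennreal] show ?thesis
      by (simp add: indicator_def)
  qed
  then have "(\<integral>\<^sup>+ e. of_nat (marked S n e) + 2 * indicator ?U e \<partial>env_law) \<le>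
      (\<integral>\<^sup>+ e. indicator ?G e + 2 * of_nat (marked (big c) n e) \<partial>env_law)"
    by (rule nn_integral_mono)
  moreover have "(\<integral>\<^sup>+ e. of_nat (marked S n e) + 2 * indicator ?U e \<partial>env_law) =
      (\<integral>\<^sup>+ e. of_nat (marked S n e) \<partial>env_law) + (\<integral>\<^sup>+ e. 2 * indicator ?U e \<partial>env_law)"
    by (intro nn_integral_add borel_measurable_times_ennreal borel_measurable_const borel_measurable_indicator m sets_u sets_G)
  moreover have "(\<integral>\<^sup>+ e. 2 * indicator ?U e \<partial>env_law) = 2 * ennreal u"
    using nn_integral_cmult_indicator[OF sets_u, of 2] by (simp only: u_def env.emeasure_eq_measure)
  moreover have "(\<integral>\<^sup>+ e. indicator ?G e + 2 * of_nat (marked (big c) n e) \<partial>env_law) =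
      (\<integral>\<^sup>+ e. indicator ?G e \<partial>env_law) + (\<integral>\<^sup>+ e. 2 * of_nat (marked (big c) n e) \<partial>env_law)"
    by (intro nn_integral_add borel_measurable_times_ennreal borel_measurable_const borel_measurable_indicator m sets_u sets_G)
  moreover have "(\<integral>\<^sup>+ e. indicator ?G e \<partial>env_law) = emeasure env_law ?G"
    by (rule nn_integral_indicator[OF sets_G])
  moreover have "(\<integral>\<^sup>+ e. 2 * of_nat (marked (big c) n e) \<partial>env_law) = 2 * ennreal t"
    unfolding t[symmetric] by (rule nn_integral_cmult[OF m(2)])
  ultimately have "(\<integral>\<^sup>+ e. of_nat (marked S n e) \<partial>env_law) + 2 * ennreal u \<le> emeasure env_law ?G + 2 * ennreal t"
    by (simp only:)
  moreover have "ennreal t \<le> ennreal u + ennreal (t - u)"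
  proof (cases "t \<le> u")
    case True
    then show ?thesis by (intro add_increasing2 ennreal_leI) auto
  next
    case False
    have "0 \<le> u" by (simp add: u_def)
    then show ?thesis using False by (simp add: ennreal_plus[symmetric] del: ennreal_plus)
  qed
  then have "emeasure env_law ?G + 2 * ennreal t \<le> emeasure env_law ?G + 2 * (ennreal u + ennreal (t - u))"
    by (intro add_left_mono mult_left_mono) auto
  ultimately have "(\<integral>\<^sup>+ e. of_nat (marked S n e) \<partial>env_law) + 2 * ennreal u \<le>
      emeasure env_law ?G + 2 * (ennreal u + ennreal (t - u))"
    by (rule order_trans)
  then have "2 * ennreal u + (\<integral>\<^sup>+ e. of_nat (marked S n e) \<partial>env_law) \<le>
      2 * ennreal u + (emeasure env_law ?G + 2 * ennreal (t - u))"
    by (simp only: distrib_left ac_simps)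
  moreover have "2 * ennreal u \<noteq> \<infinity>" by (simp add: ennreal_mult_eq_top_iff)
  ultimately show ?thesis
    unfolding t_def u_def by (auto simp only: ennreal_add_left_cancel_le)
qed

end

section \<open>Regularly varying tails\<close>

text \<open>Convergence on an intersection-stable family passes to finite unions by inclusion and exclusion: one set is split
off at a time, and its intersections with the others belong to the family again.\<close>

lemma finite_Union_tendsto:
  fixes \<phi> :: "nat \<Rightarrow> real set \<Rightarrow> real" and m :: "real set \<Rightarrow> real"
  assumes stable: "\<And>A B. A \<in> \<J> \<Longrightarrow> B \<in> \<J> \<Longrightarrow> A \<inter> B \<in> \<J>"
    and conv: "\<And>A. A \<in> \<J> \<Longrightarrow> (\<lambda>n. \<phi> n A) \<longlonglongrightarrow> m A"
    and incl_excl: "\<And>n A B. A \<in> \<J> \<Longrightarrow> B \<in> sets borel \<Longrightarrow> \<phi> n (A \<union> B) = \<phi> n A + \<phi> n B - \<phi> n (A \<inter> B)"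
    and incl_excl_m: "\<And>Js A. A \<in> \<J> \<Longrightarrow> set Js \<subseteq> \<J> \<Longrightarrow>
      m (A \<union> \<Union>(set Js)) = m A + m (\<Union>(set Js)) - m (A \<inter> \<Union>(set Js))"
    and borel: "\<And>A. A \<in> \<J> \<Longrightarrow> A \<in> sets borel" and empty: "\<And>n. \<phi> n {} = 0" "m {} = 0"
  shows "set Js \<subseteq> \<J> \<Longrightarrow> (\<lambda>n. \<phi> n (\<Union>(set Js))) \<longlonglongrightarrow> m (\<Union>(set Js))"
proof (induction "length Js" arbitrary: Js)
  case 0
  then show ?case by (simp add: empty)
next
  case (Suc k)
  then obtain A Ks where Js: "Js = A # Ks" "length Ks = k" by (cases Js) auto
  then have A: "A \<in> \<J>" and Ks: "set Ks \<subseteq> \<J>" using Suc.prems by auto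
  have inter: "A \<inter> \<Union>(set Ks) = \<Union>(set (map (\<lambda>K. A \<inter> K) Ks))" by auto
  have "(\<lambda>n. \<phi> n (A \<inter> \<Union>(set Ks))) \<longlonglongrightarrow> m (A \<inter> \<Union>(set Ks))"
    unfolding inter by (rule Suc.hyps(1)) (use Js Ks A stable in auto)
  moreover have "(\<lambda>n. \<phi> n (\<Union>(set Ks))) \<longlonglongrightarrow> m (\<Union>(set Ks))"
    by (rule Suc.hyps(1)) (use Js Ks in auto)
  ultimately have "(\<lambda>n. \<phi> n A + \<phi> n (\<Union>(set Ks)) - \<phi> n (A \<inter> \<Union>(set Ks))) \<longlonglongrightarrow>
      m A + m (\<Union>(set Ks)) - m (A \<inter> \<Union>(set Ks))"
    by (intro tendsto_add tendsto_diff conv[OF A])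
  moreover have "\<Union>(set Ks) \<in> sets borel" using Ks borel by (auto intro!: sets.finite_Union)
  ultimately show ?case
    using incl_excl[OF A] incl_excl_m[OF A Ks] by (simp add: Js)
qed

text \<open>Intervals that are closed at the end farther from \<open>0\<close>, so that their probabilities are differences of the tail
probabilities \<open>P(X > x)\<close> and \<open>P(X < - x)\<close>, whose limits are given.\<close>

definition cells :: "real set set" where
  "cells = {A. \<exists>a b. 0 < a \<and> a \<le> b \<and> (A = {a<..b} \<or> A = {- b..<- a})}"

lemma cells_Int:
  assumes "A \<in> cells" "B \<in> cells"
  shows "A \<inter> B \<in> cells"
proof -
  have empty: "{} \<in> cells"
    unfolding cells_def by (intro CollectI exI[of _ 1]) simp
  have right: "{a<..b} \<inter> {c<..d} \<in> cells" if "0 < a" "a \<le> b" "0 < c" "c \<le> d" for a b c d :: real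
  proof (cases "max a c \<le> min b d")
    case True
    have "{a<..b} \<inter> {c<..d} = {max a c<..min b d}" by auto
    also have "\<dots> \<in> cells"
      unfolding cells_def
      by (intro CollectI exI[of _ "max a c"] exI[of _ "min b d"]) (use True that in simp)
    finally show ?thesis .
  next
    case False
    then have "{a<..b} \<inter> {c<..d} = {}" by auto
    then show ?thesis by (simp only: empty)
  qed
  have left: "{- b..<- a} \<inter> {- d..<- c} \<in> cells" if "0 < a" "a \<le> b" "0 < c" "c \<le> d" for a b c d :: real
  proof (cases "max a c \<le> min b d")
    case True
    have "{- b..<- a} \<inter> {- d..<- c} = {- min b d..<- max a c}" by auto
    also have "\<dots> \<in> cells"
      unfolding cells_def
      by (intro CollectI exI[of _ "max a c"] exI[of _ "min b d"]) (use True that in simp)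
    finally show ?thesis .
  next
    case False
    then have "{- b..<- a} \<inter> {- d..<- c} = {}" by auto
    then show ?thesis by (simp only: empty)
  qed
  have mixed: "{a<..b} \<inter> {- d..<- c} = {}" "{- d..<- c} \<inter> {a<..b} = {}" if "0 < a" "0 < c" for a b c d :: real
    using that by auto
  from assms(1) obtain a b where A: "0 < a" "a \<le> b" "A = {a<..b} \<or> A = {- b..<- a}"
    unfolding cells_def by blast
  from assms(2) obtain c d where B: "0 < c" "c \<le> d" "B = {c<..d} \<or> B = {- d..<- c}"
    unfolding cells_def by blast
  show ?thesis
    using A(3) B(3) right[OF A(1,2) B(1,2)] left[OF A(1,2) B(1,2)] mixed(1)[OF A(1) B(1), of b d]
      mixed(2)[OF B(1) A(1), of b d] empty
    by (elim disjE) (simp_all only:)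
qed

lemma open_eq_Union_cells:
  assumes "open U" "0 \<notin> U"
  obtains \<C> where "countable \<C>" "\<C> \<subseteq> cells" "\<Union>\<C> = U"
proof -
  \<comment> \<open>rational endpoints keep the family countable\<close>
  define \<R> where "\<R> = (\<lambda>(a, b). {real_of_rat a<..real_of_rat b}) ` {(a, b). 0 < a \<and> a \<le> b} \<union>
    (\<lambda>(a, b). {- real_of_rat b..<- real_of_rat a}) ` {(a, b). 0 < a \<and> a \<le> b}"
  have "{real_of_rat a<..real_of_rat b} \<in> cells" "{- real_of_rat b..<- real_of_rat a} \<in> cells"
    if "0 < a" "a \<le> b" for a b
    unfolding cells_def
    by (intro CollectI exI[of _ "real_of_rat a"] exI[of _ "real_of_rat b"];
        use that in \<open>simp add: of_rat_less_eq\<close>)+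
  then have "\<R> \<subseteq> cells"
    unfolding \<R>_def by (intro Un_least image_subsetI) auto
  moreover have "countable \<R>" unfolding \<R>_def by simp
  moreover have "U \<subseteq> \<Union>{J \<in> \<R>. J \<subseteq> U}"
  proof
    fix x assume "x \<in> U"
    then obtain e where e: "e > 0" "\<And>y. \<bar>y - x\<bar> < e \<Longrightarrow> y \<in> U"
      using assms(1) unfolding open_dist dist_real_def by blast
    have "x \<noteq> 0" using \<open>x \<in> U\<close> assms(2) by blast
    define s where "s = \<bar>x\<bar>"
    have "s > 0" using \<open>x \<noteq> 0\<close> by (simp add: s_def)
    have "max (s - e) 0 < s" using e \<open>s > 0\<close> by simp
    then obtain a where a: "max (s - e) 0 < real_of_rat a" "real_of_rat a < s" using of_rat_dense by blast
    have "s < s + e" using e by simp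
    then obtain b where b: "s < real_of_rat b" "real_of_rat b < s + e" using of_rat_dense by blast
    have "0 < real_of_rat a" "real_of_rat a < real_of_rat b" using a b by simp_all
    then have ab: "0 < a" "a \<le> b" by (simp_all add: of_rat_less)
    show "x \<in> \<Union>{J \<in> \<R>. J \<subseteq> U}"
    proof (cases "x > 0")
      case True
      then have "{real_of_rat a<..real_of_rat b} \<subseteq> U"
        using a b by (auto simp: s_def intro!: e(2))
      moreover have "{real_of_rat a<..real_of_rat b} \<in> \<R>" using ab by (force simp: \<R>_def)
      moreover have "x \<in> {real_of_rat a<..real_of_rat b}" using True a b by (simp add: s_def)
      ultimately show ?thesis by blast
    next
      case False
      then have "{- real_of_rat b..<- real_of_rat a} \<subseteq> U"
        using a b by (auto simp: s_def intro!: e(2))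
      moreover have "{- real_of_rat b..<- real_of_rat a} \<in> \<R>" using ab by (force simp: \<R>_def)
      moreover have "x \<in> {- real_of_rat b..<- real_of_rat a}" using False a b by (simp add: s_def)
      ultimately show ?thesis by blast
    qed
  qed
  ultimately show thesis
    by (intro that[of "{J \<in> \<R>. J \<subseteq> U}"]) (auto intro: countable_subset)
qed

lemma exists_power_bound:
  fixes \<beta> K :: real
  assumes "\<beta> > 1"
  obtains N where "N \<ge> 1" "K \<le> \<beta> ^ N"
proof -
  obtain N where "K < \<beta> ^ N" using real_arch_pow[OF assms] by blast
  moreover have "\<beta> ^ N \<le> \<beta> ^ Suc N" using assms by (intro power_increasing) auto
  ultimately show thesis by (intro that[of "Suc N"]) auto
qed

locale heavy_tail =
  fixes F :: "real measure" and \<alpha> q :: real and L :: "real \<Rightarrow> real"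
  assumes prob_F: "prob_space F" and sets_eq_borel: "sets F = sets borel"
    and \<alpha>_pos: "\<alpha> > 0" and slowly: "slowly_varying L" and q_nonneg: "0 \<le> q" and q_le_1: "q \<le> 1"
    and tail_formula: "\<And>x. x > 0 \<Longrightarrow> measure F {y. \<bar>y\<bar> > x} = x powr (- \<alpha>) * L x"
    and balance: "((\<lambda>x. measure F {y. y > x} / measure F {y. \<bar>y\<bar> > x}) \<longlongrightarrow> q) at_top"
begin

sublocale law: prob_space F by (rule prob_F)

definition tail :: "real \<Rightarrow> real" where
  "tail x = measure F {y. \<bar>y\<bar> > x}"

lemma space_law [simp]: "space F = UNIV"
  using sets_eq_imp_space_eq[OF sets_eq_borel] by simp

lemma abs_gt_in_sets: "{y. \<bar>y\<bar> > x} \<in> sets F" and gt_in_sets: "{y. y > x} \<in> sets F"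
  and lt_in_sets: "{y. y < x} \<in> sets F" for x :: real
  unfolding sets_eq_borel by measurable

lemma tail_antimono: "x \<le> y \<Longrightarrow> tail y \<le> tail x"
  unfolding tail_def by (intro law.finite_measure_mono abs_gt_in_sets) auto

lemma tail_ratio_eq:
  assumes "t > 0" "x > 0"
  shows "tail (t * x) / tail t = x powr (- \<alpha>) * (L (t * x) / L t)"
  using assms by (simp add: tail_def tail_formula powr_mult)

lemma tail_ratio:
  assumes "x > 0"
  shows "((\<lambda>t. tail (t * x) / tail t) \<longlongrightarrow> x powr (- \<alpha>)) at_top"
proof -
  have "((\<lambda>t. x powr (- \<alpha>) * (L (t * x) / L t)) \<longlongrightarrow> x powr (- \<alpha>) * 1) at_top"
    using slowly assms unfolding slowly_varying_def by (intro tendsto_mult_left) blast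
  moreover have "\<forall>\<^sub>F t in at_top. x powr (- \<alpha>) * (L (t * x) / L t) = tail (t * x) / tail t"
    using eventually_gt_at_top[of 0] by eventually_elim (simp add: tail_ratio_eq assms)
  ultimately show ?thesis by (simp add: tendsto_cong)
qed

lemma tail_pos: "tail x > 0"
proof -
  have "\<forall>\<^sub>F t in at_top. tail (t * 1) / tail t > 0"
    by (rule order_tendstoD(1)[OF tail_ratio]) simp_all
  then have "\<forall>\<^sub>F t in at_top. tail t > 0 \<and> x \<le> t"
    using eventually_ge_at_top[of x]
    by eventually_elim (auto simp: tail_def zero_less_measure_iff split: if_splits)
  then obtain t where "tail t > 0" "x \<le> t"
    using eventually_happens'[OF trivial_limit_at_top_linorder] by blast
  then show ?thesis using tail_antimono by (meson less_le_trans)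
qed

lemma tail_small:
  assumes "\<epsilon> > 0"
  shows "\<exists>x. tail x \<le> \<epsilon>"
proof -
  have "(\<lambda>n. measure F {y. \<bar>y\<bar> > real n}) \<longlonglongrightarrow> measure F (\<Inter>n. {y. \<bar>y\<bar> > real n})"
    by (intro law.finite_Lim_measure_decseq) (auto simp: decseq_def abs_gt_in_sets)
  also have "(\<Inter>n. {y. \<bar>y\<bar> > real n}) = {}"
  proof (rule equals0I)
    fix y assume y: "y \<in> (\<Inter>n. {y. \<bar>y\<bar> > real n})"
    obtain n where "\<bar>y\<bar> \<le> real n" using real_arch_simple by blast
    moreover have "real n < \<bar>y\<bar>" using y by blast
    ultimately show False by simp
  qed
  finally have "\<forall>\<^sub>F n in sequentially. tail (real n) < \<epsilon>"
    unfolding tail_def by (intro order_tendstoD(2)[of _ 0]) (simp_all add: assms)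
  then show ?thesis
    using eventually_happens'[OF sequentially_bot] by (meson less_imp_le)
qed

text \<open>A crude form of Potter's bounds: the tail decreases at most by a constant factor when its argument is doubled.\<close>

lemma doubling:
  obtains C t\<^sub>0 where "C \<ge> 1" "t\<^sub>0 > 0" "\<And>t k. t \<ge> t\<^sub>0 \<Longrightarrow> tail t \<le> C ^ k * tail (2 ^ k * t)"
proof -
  \<comment> \<open>half of the limit of \<open>T(2 t) / T t\<close>\<close>
  define h where "h = 2 powr (- \<alpha>) / 2"
  have h: "h > 0" "h < 2 powr (- \<alpha>)" by (simp_all add: h_def)
  have "h \<le> 1"
    using \<alpha>_pos powr_mono[of "- \<alpha>" 0 2] by (simp add: h_def)
  have "\<forall>\<^sub>F t in at_top. tail (t * 2) / tail t > h"
    using h by (intro order_tendstoD(1)[OF tail_ratio]) simp_all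
  then obtain t\<^sub>0 where t\<^sub>0: "\<And>t. t \<ge> t\<^sub>0 \<Longrightarrow> tail (t * 2) / tail t > h"
    unfolding eventually_at_top_linorder by blast
  have step: "tail t \<le> 1 / h * tail (2 * t)" if "t \<ge> max t\<^sub>0 1" for t
    using t\<^sub>0[of t] that h tail_pos[of t] by (simp add: field_simps)
  have "tail t \<le> (1 / h) ^ k * tail (2 ^ k * t)" if t: "t \<ge> max t\<^sub>0 1" for t k
  proof (induction k)
    case (Suc k)
    have "1 * t \<le> 2 ^ k * t"
      using t by (intro mult_right_mono) auto
    then have "tail (2 ^ k * t) \<le> 1 / h * tail (2 * (2 ^ k * t))"
      using \<open>1 * t \<le> 2 ^ k * t\<close> by (intro step order_trans[OF t]) simp
    then have "(1 / h) ^ k * tail (2 ^ k * t) \<le> (1 / h) ^ k * (1 / h * tail (2 * (2 ^ k * t)))"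
      using h by (intro mult_left_mono) auto
    then show ?case using Suc by (simp add: ac_simps)
  qed simp
  then show thesis
    using h \<open>h \<le> 1\<close> by (intro that[of "1 / h" "max t\<^sub>0 1"]) auto
qed

lemma right_tail_ratio:
  assumes "x > 0"
  shows "((\<lambda>t. measure F {y. y > t * x} / tail t) \<longlongrightarrow> q * x powr (- \<alpha>)) at_top"
proof -
  have "filterlim (\<lambda>t. t * x) at_top at_top"
    using assms by (intro filterlim_at_top_mult_tendsto_pos[of _ x] filterlim_ident tendsto_const) auto
  from filterlim_compose[OF balance this]
  have "((\<lambda>t. measure F {y. y > t * x} / tail (t * x) * (tail (t * x) / tail t)) \<longlongrightarrow> q * x powr (- \<alpha>)) at_top"
    unfolding tail_def[symmetric] by (intro tendsto_mult tail_ratio assms)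
  moreover have "tail (t * x) \<noteq> 0" for t using tail_pos[of "t * x"] by simp
  ultimately show ?thesis by simp
qed

lemma left_tail_ratio:
  assumes "x > 0"
  shows "((\<lambda>t. measure F {y. y < - (t * x)} / tail t) \<longlongrightarrow> (1 - q) * x powr (- \<alpha>)) at_top"
proof -
  have "((\<lambda>t. tail (t * x) / tail t - measure F {y. y > t * x} / tail t) \<longlongrightarrow> x powr (- \<alpha>) - q * x powr (- \<alpha>)) at_top"
    by (intro tendsto_diff tail_ratio right_tail_ratio assms)
  moreover have "\<forall>\<^sub>F t in at_top. tail (t * x) / tail t - measure F {y. y > t * x} / tail t =
      measure F {y. y < - (t * x)} / tail t"
    using eventually_gt_at_top[of 0]
  proof eventually_elim
    case (elim t)
    have "0 \<le> t * x" using elim assms by simp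
    have "{y. \<bar>y\<bar> > t * x} = {y. y > t * x} \<union> {y. y < - (t * x)}" by auto
    moreover have "{y. y > t * x} \<inter> {y. y < - (t * x)} = {}" using \<open>0 \<le> t * x\<close> by auto
    ultimately have "tail (t * x) = measure F {y. y > t * x} + measure F {y. y < - (t * x)}"
      unfolding tail_def using law.finite_measure_Union[OF gt_in_sets lt_in_sets] by simp
    then show ?case by (simp add: diff_divide_distrib[symmetric])
  qed
  ultimately show ?thesis by (simp add: tendsto_cong left_diff_distrib)
qed

lemma emeasure_nu_greaterThan:
  assumes "a > 0"
  shows "emeasure (nu \<alpha> q) {a<..} = ennreal (q * a powr (- \<alpha>))"
proof -
  have lim: "((\<lambda>x. - q * x powr (- \<alpha>)) \<longlongrightarrow> - q * 0) at_top"
    using \<alpha>_pos by (intro tendsto_mult_left tendsto_neg_powr filterlim_ident) auto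
  have "emeasure (nu \<alpha> q) {a<..} = (\<integral>\<^sup>+ x. ennreal (\<alpha> * q * x powr (- \<alpha> - 1)) * indicator {a..} x \<partial>lborel)"
  proof -
    have "AE x in lborel. ennreal (\<alpha> * q * x powr (- \<alpha> - 1) * indicator {0<..} x
        + \<alpha> * (1 - q) * \<bar>x\<bar> powr (- \<alpha> - 1) * indicator {..<0} x) * indicator {a<..} x =
        ennreal (\<alpha> * q * x powr (- \<alpha> - 1)) * indicator {a..} x"
      using AE_lborel_singleton[of a]
      by eventually_elim (use assms in \<open>auto simp: indicator_def\<close>)
    then show ?thesis
      unfolding nu_def by (subst emeasure_density) (auto intro: nn_integral_cong_AE)
  qed
  also have "\<dots> = ennreal (0 - (- q * a powr (- \<alpha>)))"
  proof (rule nn_integral_FTC_atLeast)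
    show "(\<lambda>x. \<alpha> * q * x powr (- \<alpha> - 1)) \<in> borel_measurable borel" by measurable
    fix x assume "a \<le> x"
    then have "x > 0" using assms by simp
    then show "((\<lambda>x. - q * x powr (- \<alpha>)) has_real_derivative \<alpha> * q * x powr (- \<alpha> - 1)) (at x)"
      by (auto intro!: derivative_eq_intros)
    show "0 \<le> \<alpha> * q * x powr (- \<alpha> - 1)" using \<alpha>_pos q_nonneg by simp
  qed (use lim in simp)
  finally show ?thesis by simp
qed

lemma emeasure_nu_lessThan:
  assumes "a > 0"
  shows "emeasure (nu \<alpha> q) {..<- a} = ennreal ((1 - q) * a powr (- \<alpha>))"
proof -
  have lim: "((\<lambda>x. - (1 - q) * x powr (- \<alpha>)) \<longlongrightarrow> - (1 - q) * 0) at_top"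
    using \<alpha>_pos by (intro tendsto_mult_left tendsto_neg_powr filterlim_ident) auto
  have "emeasure (nu \<alpha> q) {..<- a} =
      (\<integral>\<^sup>+ x. ennreal (\<alpha> * (1 - q) * \<bar>x\<bar> powr (- \<alpha> - 1)) * indicator {..<- a} x \<partial>lborel)"
    unfolding nu_def
    by (subst emeasure_density) (use assms in \<open>auto intro!: nn_integral_cong simp: indicator_def\<close>)
  also have "\<dots> = (\<integral>\<^sup>+ x. ennreal (\<alpha> * (1 - q) * \<bar>x\<bar> powr (- \<alpha> - 1)) * indicator {..<- a} x
      \<partial>distr lborel borel uminus)"
    by (simp add: lborel_distr_uminus)
  also have "\<dots> = (\<integral>\<^sup>+ x. ennreal (\<alpha> * (1 - q) * \<bar>- x\<bar> powr (- \<alpha> - 1)) * indicator {..<- a} (- x) \<partial>lborel)"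
    by (subst nn_integral_distr) auto
  also have "\<dots> = (\<integral>\<^sup>+ x. ennreal (\<alpha> * (1 - q) * x powr (- \<alpha> - 1)) * indicator {a..} x \<partial>lborel)"
  proof (rule nn_integral_cong_AE)
    show "AE x in lborel. ennreal (\<alpha> * (1 - q) * \<bar>- x\<bar> powr (- \<alpha> - 1)) * indicator {..<- a} (- x) =
        ennreal (\<alpha> * (1 - q) * x powr (- \<alpha> - 1)) * indicator {a..} x"
      using AE_lborel_singleton[of a]
      by eventually_elim (use assms in \<open>auto simp: indicator_def\<close>)
  qed
  also have "\<dots> = ennreal (0 - (- (1 - q) * a powr (- \<alpha>)))"
  proof (rule nn_integral_FTC_atLeast)
    show "(\<lambda>x. \<alpha> * (1 - q) * x powr (- \<alpha> - 1)) \<in> borel_measurable borel" by measurable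
    fix x assume "a \<le> x"
    then have "x > 0" using assms by simp
    then show "((\<lambda>x. - (1 - q) * x powr (- \<alpha>)) has_real_derivative \<alpha> * (1 - q) * x powr (- \<alpha> - 1)) (at x)"
      by (auto intro!: derivative_eq_intros simp: algebra_simps)
    show "0 \<le> \<alpha> * (1 - q) * x powr (- \<alpha> - 1)" using \<alpha>_pos q_le_1 by simp
  qed (use lim in simp)
  finally show ?thesis by (simp add: algebra_simps)
qed

lemma emeasure_nu_abs_gt:
  assumes "a > 0"
  shows "emeasure (nu \<alpha> q) {x. \<bar>x\<bar> > a} = ennreal (a powr (- \<alpha>))"
proof -
  have "{x. \<bar>x\<bar> > a} = {a<..} \<union> {..<- a}" by auto
  moreover have "{a<..} \<inter> {..<- a} = {}" using assms by auto
  ultimately have "emeasure (nu \<alpha> q) {x. \<bar>x\<bar> > a} = emeasure (nu \<alpha> q) {a<..} + emeasure (nu \<alpha> q) {..<- a}"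
    by (simp add: plus_emeasure nu_def)
  also have "\<dots> = ennreal (q * a powr (- \<alpha>) + (1 - q) * a powr (- \<alpha>))"
    using q_nonneg q_le_1 by (simp add: emeasure_nu_greaterThan emeasure_nu_lessThan assms)
  finally show ?thesis by (simp add: algebra_simps)
qed

end

context heavy_tail
begin

lemma sets_nu [simp]: "sets (nu \<alpha> q) = sets borel"
  by (simp add: nu_def)

lemma vimage_div_in_sets:
  fixes c :: real
  assumes [measurable]: "A \<in> sets borel"
  shows "{y. y / c \<in> A} \<in> sets F"
  unfolding sets_eq_borel by measurable

lemma measure_nu_rays:
  assumes "a > 0"
  shows "measure (nu \<alpha> q) {a<..} = q * a powr (- \<alpha>)" "emeasure (nu \<alpha> q) {a<..} < \<infinity>"
    and "measure (nu \<alpha> q) {..<- a} = (1 - q) * a powr (- \<alpha>)" "emeasure (nu \<alpha> q) {..<- a} < \<infinity>"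
  using q_nonneg q_le_1
  by (simp_all add: measure_def emeasure_nu_greaterThan emeasure_nu_lessThan assms)

lemma fmeasurable_cells: "A \<in> cells \<Longrightarrow> A \<in> fmeasurable (nu \<alpha> q)"
proof -
  assume "A \<in> cells"
  then obtain a b where A: "0 < a" "A = {a<..b} \<or> A = {- b..<- a}" unfolding cells_def by blast
  then have "A \<subseteq> {a<..} \<union> {..<- a}" "A \<in> sets borel" by auto
  moreover have "{a<..} \<in> fmeasurable (nu \<alpha> q)" "{..<- a} \<in> fmeasurable (nu \<alpha> q)"
    using measure_nu_rays[OF A(1)] by (auto intro: fmeasurableI)
  ultimately show ?thesis
    using fmeasurableI2[of "{a<..} \<union> {..<- a}" "nu \<alpha> q" A] by auto
qed

text \<open>The lower half of vague convergence of the normalised displacement law. An open set is a countable union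
of cells; convergence holds on finite unions of cells, and these exhaust the limit mass.\<close>

lemma liminf_open_ge_nu:
  assumes \<gamma>: "filterlim \<gamma> at_top sequentially" and U: "open U" "0 \<notin> U"
  shows "emeasure (nu \<alpha> q) U \<le> liminf (\<lambda>n. ennreal (measure F {y. y / \<gamma> n \<in> U} / tail (\<gamma> n)))"
proof -
  define \<phi> where "\<phi> n A = measure F {y. y / \<gamma> n \<in> A} / tail (\<gamma> n)" for n A
  define m where "m = measure (nu \<alpha> q)"
  have pos: "\<forall>\<^sub>F n in sequentially. \<gamma> n > 0"
    using \<gamma> by (auto simp: filterlim_at_top_dense)
  have cells_borel: "A \<in> sets borel" if "A \<in> cells" for A
    using that unfolding cells_def by auto
  have \<phi>_mono: "\<phi> n A \<le> \<phi> n B" if "A \<subseteq> B" "B \<in> sets borel" for n A B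
    unfolding \<phi>_def using that tail_pos[of "\<gamma> n"]
    by (intro divide_right_mono law.finite_measure_mono vimage_div_in_sets) auto
  have conv: "(\<lambda>n. \<phi> n A) \<longlonglongrightarrow> m A" if "A \<in> cells" for A
  proof -
    from that obtain a b where ab: "0 < a" "a \<le> b" and A: "A = {a<..b} \<or> A = {- b..<- a}"
      unfolding cells_def by blast
    then have b: "b > 0" by simp
    have diff: ?thesis
      if R: "\<And>x n. R x n \<in> sets F" "\<And>n. \<gamma> n > 0 \<Longrightarrow> R b n \<subseteq> R a n"
          "\<And>n. \<gamma> n > 0 \<Longrightarrow> {y. y / \<gamma> n \<in> A} = R a n - R b n"
        and lim: "\<And>x. x > 0 \<Longrightarrow> (\<lambda>n. measure F (R x n) / tail (\<gamma> n)) \<longlonglongrightarrow> w * x powr (- \<alpha>)"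
        and mA: "m A = w * a powr (- \<alpha>) - w * b powr (- \<alpha>)" for R w
    proof -
      have "(\<lambda>n. measure F (R a n) / tail (\<gamma> n) - measure F (R b n) / tail (\<gamma> n)) \<longlonglongrightarrow> m A"
        unfolding mA by (intro tendsto_diff lim ab b)
      moreover have "\<forall>\<^sub>F n in sequentially.
          measure F (R a n) / tail (\<gamma> n) - measure F (R b n) / tail (\<gamma> n) = \<phi> n A"
        using pos
        by eventually_elim
          (simp add: \<phi>_def R(3) law.finite_measure_Diff[OF R(1) R(1) R(2)] diff_divide_distrib)
      ultimately show ?thesis by (simp add: tendsto_cong)
    qed
    have ab_scaled: "\<gamma> n * a \<le> \<gamma> n * b" if "\<gamma> n > 0" for n
      using that ab by simp
    from A show ?thesis
    proof
      assume A: "A = {a<..b}"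
      show ?thesis
      proof (rule diff[of "\<lambda>x n. {y. y > \<gamma> n * x}" q])
        have "A = {a<..} - {b<..}" using A by auto
        then show "m A = q * a powr (- \<alpha>) - q * b powr (- \<alpha>)"
          using measure_Diff[of "nu \<alpha> q" "{a<..}" "{b<..}"] measure_nu_rays[OF ab(1)] measure_nu_rays[OF b] ab
          by (simp add: m_def)
        show "{y. y / \<gamma> n \<in> A} = {y. y > \<gamma> n * a} - {y. y > \<gamma> n * b}" if "\<gamma> n > 0" for n
          using that by (auto simp: A field_simps)
        show "{y. y > \<gamma> n * b} \<subseteq> {y. y > \<gamma> n * a}" if "\<gamma> n > 0" for n
          using ab_scaled[OF that] by (intro subsetI, unfold mem_Collect_eq) linarith
      qed (rule gt_in_sets filterlim_compose[OF right_tail_ratio \<gamma>], assumption?)+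
    next
      assume A: "A = {- b..<- a}"
      show ?thesis
      proof (rule diff[of "\<lambda>x n. {y. y < - (\<gamma> n * x)}" "1 - q"])
        have "A = {..<- a} - {..<- b}" using A by auto
        then show "m A = (1 - q) * a powr (- \<alpha>) - (1 - q) * b powr (- \<alpha>)"
          using measure_Diff[of "nu \<alpha> q" "{..<- a}" "{..<- b}"] measure_nu_rays[OF ab(1)] measure_nu_rays[OF b] ab
          by (simp add: m_def)
        show "{y. y / \<gamma> n \<in> A} = {y. y < - (\<gamma> n * a)} - {y. y < - (\<gamma> n * b)}" if "\<gamma> n > 0" for n
          using that by (auto simp: A field_simps)
        show "{y. y < - (\<gamma> n * b)} \<subseteq> {y. y < - (\<gamma> n * a)}" if "\<gamma> n > 0" for n
          using ab_scaled[OF that] by (intro subsetI, unfold mem_Collect_eq) linarith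
      qed (rule lt_in_sets filterlim_compose[OF left_tail_ratio \<gamma>], assumption?)+
    qed
  qed
  have finite_Union: "(\<lambda>n. \<phi> n (\<Union>(set Js))) \<longlonglongrightarrow> m (\<Union>(set Js))" if "set Js \<subseteq> cells" for Js
  proof (rule finite_Union_tendsto[of cells \<phi> m, OF cells_Int conv _ _ cells_borel _ _ that])
    fix n A B assume AB: "A \<in> cells" "B \<in> sets (borel :: real measure)"
    let ?v = "\<lambda>A. {y. y / \<gamma> n \<in> A}"
    have "measure F (?v A \<union> ?v B) = measure F (?v A) + measure F (?v B) - measure F (?v A \<inter> ?v B)"
      by (intro measure_Un3) (auto simp: law.fmeasurable_eq_sets intro!: vimage_div_in_sets AB cells_borel)
    moreover have "?v A \<union> ?v B = ?v (A \<union> B)" "?v A \<inter> ?v B = ?v (A \<inter> B)" by auto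
    ultimately show "\<phi> n (A \<union> B) = \<phi> n A + \<phi> n B - \<phi> n (A \<inter> B)"
      by (simp add: \<phi>_def add_divide_distrib diff_divide_distrib)
  next
    fix Js A assume "A \<in> cells" "set Js \<subseteq> cells"
    then show "m (A \<union> \<Union>(set Js)) = m A + m (\<Union>(set Js)) - m (A \<inter> \<Union>(set Js))"
      unfolding m_def by (intro measure_Un3 fmeasurable.finite_Union) (auto intro: fmeasurable_cells)
  qed (simp_all add: \<phi>_def m_def)
  obtain \<C> where \<C>: "countable \<C>" "\<C> \<subseteq> cells" "\<Union>\<C> = U"
    using open_eq_Union_cells[OF U] by blast
  show ?thesis
  proof (cases "\<C> = {}")
    case True
    then show ?thesis using \<C>(3) by auto
  next
    case False
    define J where "J = from_nat_into \<C>"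
    have J: "range J = \<C>" unfolding J_def by (rule range_from_nat_into[OF False \<C>(1)])
    then have J_cells: "J i \<in> cells" for i using \<C>(2) by blast
    define W where "W k = (\<Union>i<k. J i)" for k
    have W: "W k \<in> sets borel" for k
      unfolding W_def using J_cells cells_borel by auto
    have "(\<Union>k. W k) = U"
      unfolding W_def \<C>(3)[symmetric] J[symmetric] by auto
    then have "emeasure (nu \<alpha> q) U = (SUP k. emeasure (nu \<alpha> q) (W k))"
      using SUP_emeasure_incseq[of W "nu \<alpha> q"] W by (force simp: incseq_def W_def)
    also have "\<dots> \<le> liminf (\<lambda>n. ennreal (\<phi> n U))"
    proof (rule SUP_least)
      fix k
      have W_list: "W k = \<Union>(set (map J [0..<k]))" by (auto simp: W_def atLeast0LessThan)
      have "(\<lambda>n. \<phi> n (W k)) \<longlonglongrightarrow> m (W k)"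
        unfolding W_list by (rule finite_Union) (use J_cells in auto)
      then have "(\<lambda>n. ennreal (\<phi> n (W k))) \<longlonglongrightarrow> ennreal (m (W k))" by (rule tendsto_ennrealI)
      moreover have "W k \<in> fmeasurable (nu \<alpha> q)"
        unfolding W_list using J_cells by (intro fmeasurable.finite_Union) (auto intro: fmeasurable_cells)
      then have "ennreal (m (W k)) = emeasure (nu \<alpha> q) (W k)"
        by (simp add: m_def emeasure_eq_measure2)
      ultimately have "emeasure (nu \<alpha> q) (W k) = liminf (\<lambda>n. ennreal (\<phi> n (W k)))"
        by (simp add: lim_imp_Liminf)
      also have "\<dots> \<le> liminf (\<lambda>n. ennreal (\<phi> n U))"
        using \<open>(\<Union>k. W k) = U\<close> U by (intro Liminf_mono always_eventually allI ennreal_leI \<phi>_mono) auto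
      finally show "emeasure (nu \<alpha> q) (W k) \<le> liminf (\<lambda>n. ennreal (\<phi> n U))" .
    qed
    finally show ?thesis by (simp add: \<phi>_def)
  qed
qed

end

section \<open>The scaling sequence and the threshold\<close>

locale heavy_tail_scaling = heavy_tail +
  fixes \<mu> :: real and \<gamma> b :: "nat \<Rightarrow> real"
  assumes \<mu>_gt_1: "\<mu> > 1" and \<gamma>_pos: "\<And>n. n \<ge> 1 \<Longrightarrow> \<gamma> n > 0"
    and b_eq: "\<And>n. n \<ge> 1 \<Longrightarrow> b n = Inf {x. tail x \<le> 1 / \<mu> ^ n}" and b_smallo: "b \<in> o(\<gamma>)"
begin

text \<open>Eventually \<open>c \<gamma> n\<close> exceeds \<open>b n\<close>, the infimum of the arguments at which the tail is at most \<open>\<mu>\<^sup>-\<^sup>n\<close>.\<close>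

lemma tail_scaled_le:
  assumes "c > 0"
  shows "\<forall>\<^sub>F n in sequentially. tail (c * \<gamma> n) \<le> 1 / \<mu> ^ n"
proof -
  have "\<forall>\<^sub>F n in sequentially. norm (b n) \<le> c / 2 * norm (\<gamma> n)"
    using landau_o.smallD[OF b_smallo, of "c / 2"] assms by simp
  then show ?thesis
    using eventually_ge_at_top[of 1]
  proof eventually_elim
    case (elim n)
    note \<gamma> = \<gamma>_pos[OF elim(2)]
    have "b n \<le> c / 2 * \<gamma> n" using elim \<gamma> by simp
    also have "\<dots> < c * \<gamma> n" using \<gamma> assms by simp
    finally have less: "Inf {x. tail x \<le> 1 / \<mu> ^ n} < c * \<gamma> n" using b_eq[OF elim(2)] by simp
    have "{x. tail x \<le> 1 / \<mu> ^ n} \<noteq> {}"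
      using tail_small[of "1 / \<mu> ^ n"] \<mu>_gt_1 by simp
    from cInf_lessD[OF this less] obtain x where "tail x \<le> 1 / \<mu> ^ n" "x < c * \<gamma> n" by auto
    then show ?case using tail_antimono[of x "c * \<gamma> n"] by linarith
  qed
qed

lemma inverse_power_tendsto_0: "(\<lambda>n. 1 / \<mu> ^ n) \<longlonglongrightarrow> 0"
  using LIMSEQ_inverse_realpow_zero[OF \<mu>_gt_1] by (simp add: inverse_eq_divide)

lemma filterlim_\<gamma>: "filterlim \<gamma> at_top sequentially"
  unfolding filterlim_at_top
proof
  fix K
  have "\<forall>\<^sub>F n in sequentially. 1 / \<mu> ^ n < tail K"
    by (rule order_tendstoD(2)[OF inverse_power_tendsto_0 tail_pos])
  then show "\<forall>\<^sub>F n in sequentially. K \<le> \<gamma> n"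
    using tail_scaled_le[OF zero_less_one]
  proof eventually_elim
    case (elim n)
    then have "tail (\<gamma> n) < tail K" by simp
    then show ?case using tail_antimono[of "\<gamma> n" K] by linarith
  qed
qed

lemma tail_scaled_ratio: "c > 0 \<Longrightarrow> (\<lambda>n. tail (c * \<gamma> n) / tail (\<gamma> n)) \<longlonglongrightarrow> c powr (- \<alpha>)"
  using filterlim_compose[OF tail_ratio filterlim_\<gamma>, of c] by (simp add: mult.commute)

text \<open>By regular variation \<open>T(\<gamma> n)\<close> is about \<open>c\<^sup>\<alpha> T(c \<gamma> n)\<close>, and \<open>T(c \<gamma> n) \<le> \<mu>\<^sup>-\<^sup>n\<close> for every \<open>c > 0\<close>.\<close>

lemma expected_big_jumps_tendsto_0: "(\<lambda>n. \<mu> ^ n * tail (\<gamma> n)) \<longlonglongrightarrow> 0"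
proof (rule order_tendstoI)
  fix \<epsilon> :: real assume "\<epsilon> > 0"
  \<comment> \<open>makes the limit \<open>2 / \<epsilon>\<close> of the ratio larger than the required \<open>1 / \<epsilon>\<close>\<close>
  define c where "c = (\<epsilon> / 2) powr (1 / \<alpha>)"
  have c: "c > 0" "c powr (- \<alpha>) = 2 / \<epsilon>"
    using \<open>\<epsilon> > 0\<close> \<alpha>_pos by (simp_all add: c_def powr_powr powr_minus_divide)
  have "\<forall>\<^sub>F n in sequentially. 1 / \<epsilon> < tail (c * \<gamma> n) / tail (\<gamma> n)"
    using \<open>\<epsilon> > 0\<close> by (intro order_tendstoD(1)[OF tail_scaled_ratio[OF c(1)]]) (simp add: c(2) field_simps)
  then show "\<forall>\<^sub>F n in sequentially. \<mu> ^ n * tail (\<gamma> n) < \<epsilon>"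
    using tail_scaled_le[OF c(1)]
  proof eventually_elim
    case (elim n)
    have "tail (\<gamma> n) < \<epsilon> * tail (c * \<gamma> n)"
      using elim(1) \<open>\<epsilon> > 0\<close> tail_pos[of "\<gamma> n"] by (simp add: field_simps)
    also have "\<dots> \<le> \<epsilon> * (1 / \<mu> ^ n)" using elim(2) \<open>\<epsilon> > 0\<close> by (intro mult_left_mono) auto
    finally show ?case using \<mu>_gt_1 by (simp add: field_simps)
  qed
next
  fix \<epsilon> :: real assume "\<epsilon> < 0"
  have "0 \<le> \<mu> ^ n * tail (\<gamma> n)" for n using \<mu>_gt_1 tail_pos[of "\<gamma> n"] by simp
  then show "\<forall>\<^sub>F n in sequentially. \<epsilon> < \<mu> ^ n * tail (\<gamma> n)"
    using \<open>\<epsilon> < 0\<close> by (intro always_eventually) (auto intro: less_le_trans)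
qed

text \<open>The threshold is \<open>\<gamma> n\<close> divided by \<open>2\<^sup>k\<close>, where \<open>k\<close> is a small multiple of \<open>n\<close>. By the doubling bound this raises the tail at
most by \<open>C\<^sup>k\<close>, an exponential factor of small rate that is beaten by \<open>T(\<gamma> n) \<le> \<mu>\<^sup>-\<^sup>n\<close>, and \<open>n / 2\<^sup>k\<close> tends to
\<open>0\<close>.\<close>

lemma threshold_exists:
  obtains a :: "nat \<Rightarrow> real" where "\<forall>\<^sub>F n in sequentially. 0 \<le> a n" "(\<lambda>n. real n * a n / \<gamma> n) \<longlonglongrightarrow> 0"
    "(\<lambda>n. (real n * tail (a n))\<^sup>2 / tail (\<gamma> n)) \<longlonglongrightarrow> 0"
proof -
  obtain C t\<^sub>0 where C: "C \<ge> 1" "t\<^sub>0 > 0" "\<And>t k. t \<ge> t\<^sub>0 \<Longrightarrow> tail t \<le> C ^ k * tail (2 ^ k * t)"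
    using doubling by blast
  \<comment> \<open>the target bound is \<open>(n \<rho>\<^sup>n)\<^sup>2\<close>: of the available factor \<open>\<rho>\<^sup>4\<^sup>n = \<mu>\<^sup>-\<^sup>n\<close> one half is spent on \<open>C\<^sup>2\<^sup>k\<close>\<close>
  define \<rho> where "\<rho> = sqrt (sqrt (1 / \<mu>))"
  have \<rho>: "0 < \<rho>" "\<rho> < 1" "\<rho> ^ 4 = 1 / \<mu>"
  proof -
    show "0 < \<rho>" "\<rho> < 1" using \<mu>_gt_1 by (simp_all add: \<rho>_def)
    have "\<rho> ^ 4 = (\<rho>\<^sup>2)\<^sup>2" by simp
    then show "\<rho> ^ 4 = 1 / \<mu>" using \<mu>_gt_1 by (simp add: \<rho>_def)
  qed
  have "\<rho>\<^sup>2 < 1" using \<rho> by (simp add: power_less_one_iff)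
  then have "1 / \<rho>\<^sup>2 > 1" using \<rho> by simp
  then obtain N where N: "N \<ge> 1" "C\<^sup>2 \<le> (1 / \<rho>\<^sup>2) ^ N" using exists_power_bound by blast
  define k where "k n = n div N" for n
  define a where "a n = \<gamma> n / 2 ^ k n" for n
  have C_bound: "(C ^ k n)\<^sup>2 \<le> (1 / \<rho>\<^sup>2) ^ n" for n
  proof -
    have "(C ^ k n)\<^sup>2 = (C\<^sup>2) ^ k n" by (simp add: power_mult[symmetric] mult.commute)
    also have "\<dots> \<le> ((1 / \<rho>\<^sup>2) ^ N) ^ k n" using N C by (intro power_mono) auto
    also have "\<dots> = (1 / \<rho>\<^sup>2) ^ (N * k n)" by (simp add: power_mult)
    also have "\<dots> \<le> (1 / \<rho>\<^sup>2) ^ n"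
      using \<open>1 / \<rho>\<^sup>2 > 1\<close> by (intro power_increasing) (auto simp: k_def)
    finally show ?thesis .
  qed
  have \<rho>_power: "(1 / \<rho>\<^sup>2) ^ n * (\<rho> ^ 4) ^ n = (\<rho>\<^sup>2) ^ n" for n
  proof -
    have "1 / \<rho>\<^sup>2 * \<rho> ^ 4 = \<rho>\<^sup>2" using \<rho>(1) by (simp add: power2_eq_square power4_eq_xxxx)
    then show ?thesis by (simp only: power_mult_distrib[symmetric])
  qed
  have pos: "\<forall>\<^sub>F n in sequentially. 0 < \<gamma> n"
    using eventually_ge_at_top[of 1] by eventually_elim (rule \<gamma>_pos)
  have \<gamma>_small: "\<forall>\<^sub>F n in sequentially. tail (\<gamma> n) \<le> (\<rho> ^ 4) ^ n"
    using tail_scaled_le[OF zero_less_one] \<rho> by (simp add: power_divide)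
  have "\<forall>\<^sub>F n in sequentially. (\<rho>\<^sup>2) ^ n < tail t\<^sub>0"
    by (rule order_tendstoD(2)[OF LIMSEQ_power_zero tail_pos]) (use \<rho> \<open>\<rho>\<^sup>2 < 1\<close> in auto)
  \<comment> \<open>the doubling bound needs \<open>a n \<ge> t\<^sub>0\<close>; if it failed, \<open>\<gamma> n \<le> 2\<^sup>k t\<^sub>0\<close> would make \<open>T(\<gamma> n)\<close> too large\<close>
  with \<gamma>_small pos have large: "\<forall>\<^sub>F n in sequentially. t\<^sub>0 \<le> a n"
  proof eventually_elim
    case (elim n)
    show ?case
    proof (rule ccontr)
      assume "\<not> t\<^sub>0 \<le> a n"
      then have "\<gamma> n \<le> 2 ^ k n * t\<^sub>0" by (simp add: a_def field_simps)
      have "tail t\<^sub>0 \<le> C ^ k n * tail (2 ^ k n * t\<^sub>0)" by (rule C(3)) simp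
      also have "\<dots> \<le> (C ^ k n)\<^sup>2 * tail (\<gamma> n)"
        using C(1) tail_antimono[OF \<open>\<gamma> n \<le> 2 ^ k n * t\<^sub>0\<close>] tail_pos[of "2 ^ k n * t\<^sub>0"]
        by (intro mult_mono) (auto simp: power2_eq_square intro!: mult_left_le[of 1, simplified] less_imp_le)
      also have "\<dots> \<le> (1 / \<rho>\<^sup>2) ^ n * (\<rho> ^ 4) ^ n"
        using C_bound[of n] elim(1) tail_pos[of "\<gamma> n"] \<rho> by (intro mult_mono) auto
      also have "\<dots> = (\<rho>\<^sup>2) ^ n" by (rule \<rho>_power)
      finally show False using elim(3) by simp
    qed
  qed
  show thesis
  proof (rule that[of a])
    show "\<forall>\<^sub>F n in sequentially. 0 \<le> a n"
      using pos by eventually_elim (simp add: a_def)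
    \<comment> \<open>turns \<open>2\<close> to the power \<open>n div N\<close> into a geometric sequence, up to a factor \<open>2\<close>\<close>
    define \<theta> where "\<theta> = root N (1 / 2)"
    have \<theta>: "0 < \<theta>" "\<theta> < 1" "\<theta> ^ N = 1 / 2"
      using N by (simp_all add: \<theta>_def)
    have half: "(1 / 2) ^ k n \<le> 2 * \<theta> ^ n" for n
    proof -
      have "(1 / 2) ^ k n = 2 * \<theta> ^ (N * k n + N)"
        unfolding power_add power_mult \<theta>(3) by simp
      also have "\<dots> \<le> 2 * \<theta> ^ n"
      proof -
        have "n \<le> N * k n + N"
          using N mod_less_divisor[of N n] mult_div_mod_eq[of N n] unfolding k_def by linarith
        then show ?thesis using \<theta> by (intro mult_left_mono power_decreasing) auto
      qed
      finally show ?thesis .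
    qed
    have lim_\<theta>: "(\<lambda>n. 2 * (real n * \<theta> ^ n)) \<longlonglongrightarrow> 0"
      using \<theta> by (intro tendsto_mult_right_zero powser_times_n_limit_0) auto
    have "\<forall>\<^sub>F n in sequentially. norm (real n * a n / \<gamma> n) \<le> 2 * (real n * \<theta> ^ n)"
      using pos
    proof eventually_elim
      case (elim n)
      have "real n * a n / \<gamma> n = real n * (1 / 2) ^ k n" using elim by (simp add: a_def power_divide)
      then show ?case using mult_left_mono[OF half[of n], of n] by (simp add: mult_ac)
    qed
    from Lim_null_comparison[OF this lim_\<theta>] show "(\<lambda>n. real n * a n / \<gamma> n) \<longlonglongrightarrow> 0" .
    have "(\<lambda>n. (real n * \<rho> ^ n)\<^sup>2) \<longlonglongrightarrow> 0\<^sup>2"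
      using \<rho>(1,2) by (intro tendsto_power powser_times_n_limit_0) auto
    then have lim_\<rho>: "(\<lambda>n. (real n * \<rho> ^ n)\<^sup>2) \<longlonglongrightarrow> 0" by simp
    have "\<forall>\<^sub>F n in sequentially. norm ((real n * tail (a n))\<^sup>2 / tail (\<gamma> n)) \<le> (real n * \<rho> ^ n)\<^sup>2"
      using large \<gamma>_small
    proof eventually_elim
      case (elim n)
      have "tail (a n) \<le> C ^ k n * tail (\<gamma> n)"
        using C(3)[OF elim(1), of "k n"] by (simp add: a_def)
      then have "(tail (a n))\<^sup>2 \<le> (C ^ k n * tail (\<gamma> n))\<^sup>2"
        using tail_pos[of "a n"] by (intro power_mono) auto
      also have "\<dots> = (C ^ k n)\<^sup>2 * tail (\<gamma> n) * tail (\<gamma> n)"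
        by (simp add: power_mult_distrib power2_eq_square)
      also have "\<dots> \<le> (1 / \<rho>\<^sup>2) ^ n * (\<rho> ^ 4) ^ n * tail (\<gamma> n)"
        using C_bound[of n] elim(2) tail_pos[of "\<gamma> n"] \<rho> by (intro mult_mono) auto
      also have "(1 / \<rho>\<^sup>2) ^ n * (\<rho> ^ 4) ^ n = (\<rho> ^ n)\<^sup>2"
        unfolding \<rho>_power by (simp add: power_mult[symmetric] mult.commute)
      finally have "(tail (a n))\<^sup>2 / tail (\<gamma> n) \<le> (\<rho> ^ n)\<^sup>2"
        using tail_pos[of "\<gamma> n"] by (simp add: divide_le_eq)
      from mult_left_mono[OF this, of "(real n)\<^sup>2"] show ?case
        using tail_pos[of "\<gamma> n"] by (simp add: power_mult_distrib)
    qed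
    from Lim_null_comparison[OF this lim_\<rho>]
    show "(\<lambda>n. (real n * tail (a n))\<^sup>2 / tail (\<gamma> n)) \<longlonglongrightarrow> 0" .
  qed
qed

end

section \<open>Lower and upper limits\<close>

lemma liminf_le_liminf_if_le_add:
  fixes x y \<epsilon> :: "nat \<Rightarrow> ennreal"
  assumes le: "\<forall>\<^sub>F n in sequentially. x n \<le> y n + \<epsilon> n" and \<epsilon>: "\<epsilon> \<longlonglongrightarrow> 0"
  shows "liminf x \<le> liminf y"
  unfolding le_Liminf_iff
proof (intro allI impI)
  fix z assume "z < liminf x"
  then obtain z' where z': "z < z'" "z' < liminf x" using dense by blast
  then have "z < \<top>" using less_trans top.not_eq_extremum by fastforce
  have "\<forall>\<^sub>F n in sequentially. z' < x n" using z'(2) by (rule less_LiminfD)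
  moreover have "0 < z' - z" using z'(1) \<open>z < \<top>\<close> by (simp add: diff_gt_0_iff_gt_ennreal)
  then have "\<forall>\<^sub>F n in sequentially. \<epsilon> n < z' - z" by (rule order_tendstoD(2)[OF \<epsilon>])
  ultimately show "\<forall>\<^sub>F n in sequentially. z < y n"
    using le
  proof eventually_elim
    case (elim n)
    show ?case
    proof (rule ccontr)
      assume "\<not> z < y n"
      then have "y n + \<epsilon> n \<le> z + (z' - z)" using elim(2) by (intro add_mono) auto
      also have "\<dots> = z'" using z'(1) by (simp add: less_imp_le add_diff_inverse_ennreal)
      finally show False using elim by (auto dest: order_less_le_trans)
    qed
  qed
qed

text \<open>If \<open>x n\<close> and \<open>y n\<close> are the masses of two disjoint parts of a set of mass \<open>z n\<close>, then a lower bound for one part is an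
upper bound for the other.\<close>

lemma limsup_le_by_complement:
  fixes x y z :: "nat \<Rightarrow> ennreal"
  assumes le: "\<And>n. x n + y n \<le> z n" and z: "limsup z \<le> M" and y: "b \<le> liminf y"
    and M: "M \<le> a + b" "M < \<top>"
  shows "limsup x \<le> a"
  unfolding Limsup_le_iff
proof (intro allI impI)
  fix w0 assume "a < w0"
  then obtain w where w: "a < w" "w < w0" using dense by blast
  then obtain w' where w': "a < w'" "w' < w" using dense by blast
  have w_fin: "w < \<top>" "w' < \<top>" using w w' by (auto simp: less_top[symmetric])
  have "b \<le> liminf y" by (rule y)
  also have "liminf y \<le> limsup y" by (simp add: Liminf_le_Limsup)
  also have "limsup y \<le> limsup z"
    by (intro Limsup_mono always_eventually allI order_trans[OF _ le]) simp
  finally have b_fin: "b < \<top>" using z M(2) by (meson le_less_trans order_trans)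
  have "limsup z \<le> b + a" using order_trans[OF z M(1)] by (simp add: add.commute)
  also have "b + a < b + w'" using w'(1) b_fin by (simp add: ennreal_add_left_cancel_less)
  finally have "limsup z < w' + b" by (simp add: add.commute)
  then have ev_z: "\<forall>\<^sub>F n in sequentially. z n < w' + b" by (rule Limsup_lessD)
  \<comment> \<open>the slack that allows \<open>y\<close> to fall short of its lower limit\<close>
  define d where "d = w - w'"
  have d: "0 < d" "w' + d = w"
    using w' w_fin by (simp_all add: d_def diff_gt_0_iff_gt_ennreal add_diff_inverse_ennreal less_imp_le)
  have "\<forall>\<^sub>F n in sequentially. b - d \<le> y n"
  proof (cases "b = 0")
    case False
    then have "b - d < b"
      using b_fin d(1) by (intro ennreal_between) (auto simp: zero_less_iff_neq_zero)
    then have "b - d < liminf y" using y by simp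
    from less_LiminfD[OF this] show ?thesis by eventually_elim simp
  qed simp
  with ev_z show "\<forall>\<^sub>F n in sequentially. x n < w0"
  proof eventually_elim
    case (elim n)
    have "(b - d) + x n \<le> z n"
      using elim(2) by (intro order_trans[OF _ le[of n]]) (simp add: add.commute add_right_mono add_mono)
    also have "\<dots> < w' + b" by (rule elim(1))
    also have "b \<le> (b - d) + d"
      by (cases "d \<le> b") (auto simp: diff_add_cancel_ennreal intro: add_increasing)
    also have "w' + ((b - d) + d) = (b - d) + w" by (simp add: d(2)[symmetric] ac_simps)
    finally have "x n < w" by (simp add: ennreal_add_left_cancel_less)
    then show ?case using w(2) by simp
  qed
qed

section \<open>Configurations determined by one displacement\<close>

lemma measurable_position [measurable]: "(\<lambda>e. position e v) \<in> borel_measurable environment_space"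
proof (induction v)
  case (Cons i v)
  note Cons [measurable]
  show ?case by simp measurable
qed simp

lemma particles_in_sets: "{e. v \<in> particles e} \<in> sets environment_space"
proof (induction v)
  case Nil
  have "{e :: environment. [] \<in> particles e} = space environment_space"
    by (auto intro: particles.root simp: space_PiM space_pair_measure)
  then show ?case by (metis sets.top)
next
  case (Cons i v)
  have "{e \<in> space environment_space. i < fst (e v)} \<in> sets environment_space" by measurable
  from sets.Int[OF Cons this]
  have "{e. v \<in> particles e} \<inter> {e. i < fst (e v)} \<in> sets environment_space"
    by (simp add: space_PiM space_pair_measure)
  then show ?case by (simp add: Cons_in_particles_iff Int_def)
qed

lemma generation_eq_in_sets: "{e. generation e n = I} \<in> sets environment_space"
proof -
  have "{e \<in> space environment_space. \<forall>v. (v \<in> particles e \<and> length v = n) = (v \<in> I)} \<in> sets environment_space"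
  proof (rule sets.sets_Collect_countable_All)
    fix v
    show "{e \<in> space environment_space. (v \<in> particles e \<and> length v = n) = (v \<in> I)} \<in> sets environment_space"
      using particles_in_sets[of v] sets.compl_sets[OF particles_in_sets[of v]] sets.top[of environment_space]
      by (cases "v \<in> I"; cases "length v = n") (auto simp: space_PiM space_pair_measure Collect_neg_eq[symmetric] Compl_eq_Diff_UNIV[symmetric])
  qed
  also have "{e \<in> space environment_space. \<forall>v. (v \<in> particles e \<and> length v = n) = (v \<in> I)} = {e. generation e n = I}"
    by (auto simp: generation_def space_PiM space_pair_measure)
  finally show ?thesis .
qed

lemma dirac_sum_generation_in_sets:
  assumes A: "A \<in> sets borel_M0"
  shows "{e. dirac_sum (generation e n) (\<lambda>v. position e v / c) \<in> A} \<in> sets environment_space"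
proof -
  have space: "space environment_space = UNIV" by (auto simp: space_PiM space_pair_measure)
  have meas: "(\<lambda>e v. position e v / c) \<in> measurable environment_space (borel :: (nat list \<Rightarrow> real) measure)"
  proof -
    have "(\<lambda>e v. position e v / c) \<in> measurable environment_space (PiM UNIV (\<lambda>_. borel))"
      by (rule measurable_PiM_single') (auto simp: space_PiM)
    then show ?thesis by (simp add: measurable_cong_sets[OF refl sets_PiM_equal_borel[symmetric]])
  qed
  have fin: "{e. dirac_sum I (\<lambda>v. position e v / c) \<in> A} \<in> sets environment_space" if "finite I" for I
  proof -
    have "{y. dirac_sum I y \<in> A} \<in> sets borel"
      by (rule borel_dirac_sum_vimage[OF A that]) (rule continuous_on_product_coordinates)
    from measurable_sets[OF meas this] show ?thesis
      by (simp add: vimage_def space)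
  qed
  have "{e. dirac_sum (generation e n) (\<lambda>v. position e v / c) \<in> A} =
      (\<Union>I\<in>{I. finite I}. {e. generation e n = I} \<inter> {e. dirac_sum I (\<lambda>v. position e v / c) \<in> A})"
  proof (intro set_eqI iffI)
    fix e assume "e \<in> {e. dirac_sum (generation e n) (\<lambda>v. position e v / c) \<in> A}"
    then show "e \<in> (\<Union>I\<in>{I. finite I}. {e. generation e n = I} \<inter> {e. dirac_sum I (\<lambda>v. position e v / c) \<in> A})"
      by (intro UN_I[of "generation e n"]) (simp_all add: finite_generation)
  next
    fix e assume "e \<in> (\<Union>I\<in>{I. finite I}. {e. generation e n = I} \<inter> {e. dirac_sum I (\<lambda>v. position e v / c) \<in> A})"
    then obtain I where "generation e n = I" "dirac_sum I (\<lambda>v. position e v / c) \<in> A" by blast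
    then show "e \<in> {e. dirac_sum (generation e n) (\<lambda>v. position e v / c) \<in> A}" by simp
  qed
  also have "\<dots> \<in> sets environment_space"
    by (rule sets.countable_UN''[OF countable_Collect_finite], rule sets.Int[OF generation_eq_in_sets fin]) simp
  finally show ?thesis .
qed

abbreviation spike :: "nat \<Rightarrow> real \<Rightarrow> real measure" where
  "spike k x \<equiv> dirac_sum {..<k} (\<lambda>_. x)"

lemma spike_in_sets:
  assumes "A \<in> sets borel_M0"
  shows "{x. spike k x \<in> A} \<in> sets borel"
  by (rule borel_dirac_sum_vimage[OF assms]) (auto intro: continuous_on_id)

lemma spike_null: "spike 0 x = null_point_measure" "spike k 0 = null_point_measure"
  by (simp_all add: dirac_sum_eq_null_iff)

text \<open>The points \<open>x\<close> such that every configuration on labels with \<open>k\<close> atoms within \<open>\<eta>\<close> of \<open>x\<close> and the other atoms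
within \<open>\<eta>\<close> of \<open>0\<close> belongs to \<open>W\<close>. The interior is taken below because vague convergence gives lower bounds for
open sets only.\<close>

definition core :: "real measure set \<Rightarrow> real \<Rightarrow> nat \<Rightarrow> real set" where
  "core W \<eta> k = {x. \<forall>(I :: nat list set) D y. finite I \<longrightarrow> D \<subseteq> I \<longrightarrow> card D = k \<longrightarrow>
     (\<forall>i\<in>D. \<bar>y i - x\<bar> \<le> \<eta>) \<longrightarrow> (\<forall>i\<in>I - D. \<bar>y i\<bar> \<le> \<eta>) \<longrightarrow> dirac_sum I y \<in> W}"

text \<open>Points of modulus at most \<open>\<eta>\<close> are removed, so that a displacement marked by this set counts as big.\<close>

definition robust :: "real measure set \<Rightarrow> real \<Rightarrow> nat \<Rightarrow> real set" where
  "robust W \<eta> k = interior (core W \<eta> k) \<inter> {x. \<bar>x\<bar> > \<eta>}"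

lemma coreD:
  fixes I D :: "nat list set"
  assumes "x \<in> core W \<eta> k" "finite I" "D \<subseteq> I" "card D = k"
    "\<forall>i\<in>D. \<bar>y i - x\<bar> \<le> \<eta>" "\<forall>i\<in>I - D. \<bar>y i\<bar> \<le> \<eta>"
  shows "dirac_sum I y \<in> W"
  using assms(1)[unfolded core_def mem_Collect_eq, rule_format, OF assms(2-4)] assms(5,6) by simp

lemma core_antimono:
  assumes "\<eta> \<le> \<eta>'"
  shows "core W \<eta>' k \<subseteq> core W \<eta> k"
proof
  fix x assume x: "x \<in> core W \<eta>' k"
  show "x \<in> core W \<eta> k"
    unfolding core_def
  proof (intro CollectI allI impI)
    fix I D :: "nat list set" and y
    assume *: "finite I" "D \<subseteq> I" "card D = k" "\<forall>i\<in>D. \<bar>y i - x\<bar> \<le> \<eta>" "\<forall>i\<in>I - D. \<bar>y i\<bar> \<le> \<eta>"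
    have "\<forall>i\<in>D. \<bar>y i - x\<bar> \<le> \<eta>'" "\<forall>i\<in>I - D. \<bar>y i\<bar> \<le> \<eta>'"
      using *(4,5) assms by (meson dual_order.trans)+
    then show "dirac_sum I y \<in> W" using x *(1-3) unfolding core_def by blast
  qed
qed

lemma robust_antimono: "\<eta> \<le> \<eta>' \<Longrightarrow> robust W \<eta>' k \<subseteq> robust W \<eta> k"
  unfolding robust_def using interior_mono[OF core_antimono[of \<eta> \<eta>' W k]] by auto

lemma open_robust: "open (robust W \<eta> k)"
proof -
  have "open {x :: real. \<bar>x\<bar> > \<eta>}" by (intro open_Collect_less continuous_intros)
  then show ?thesis unfolding robust_def by (intro open_Int open_interior)
qed

text \<open>For \<open>k = 0\<close> the empty configuration qualifies, and it is the null measure. Hence only edges with descendants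
are ever marked.\<close>

lemma robust_0:
  assumes "null_point_measure \<notin> W"
  shows "robust W \<eta> 0 = {}"
proof -
  have "x \<notin> core W \<eta> 0" for x
  proof
    assume "x \<in> core W \<eta> 0"
    then have "dirac_sum ({} :: nat list set) (\<lambda>_. 0) \<in> W" unfolding core_def by auto
    then show False using assms by (simp add: null_point_measure_eq[where 'a = "nat list" and x = "\<lambda>_. 0"])
  qed
  then have "core W \<eta> 0 = {}" by blast
  then show ?thesis by (simp add: robust_def)
qed

text \<open>If \<open>x\<close> is stable with tolerance \<open>\<delta>\<close>, then all points within \<open>\<delta> / 2\<close> are stable with tolerance \<open>\<delta> / 2\<close>.\<close>

lemma Union_robust:
  assumes W: "openin vague_topology W" and null: "null_point_measure \<notin> W"
    and \<eta>: "\<eta> \<longlonglongrightarrow> 0" "\<And>m. \<eta> m > (0 :: real)"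
  shows "{x. spike k x \<in> W} \<subseteq> (\<Union>m. robust W (\<eta> m) k)"
proof
  fix x assume "x \<in> {x. spike k x \<in> W}"
  then have x: "spike k x \<in> W" by simp
  then have "x \<noteq> 0" using null spike_null(2)[of k] by metis
  from x obtain \<delta> where \<delta>: "\<delta> > 0" and *: "\<And>(I :: nat list set) D y. finite I \<Longrightarrow> D \<subseteq> I \<Longrightarrow> card D = k \<Longrightarrow>
      \<forall>i\<in>D. \<bar>y i - x\<bar> \<le> \<delta> \<Longrightarrow> \<forall>i\<in>I - D. \<bar>y i\<bar> \<le> \<delta> \<Longrightarrow> dirac_sum I y \<in> W"
    using stable_under_perturbation[OF W] by metis
  have "\<forall>\<^sub>F m in sequentially. \<eta> m < min (\<delta> / 2) \<bar>x\<bar>"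
    using \<delta> \<open>x \<noteq> 0\<close> by (intro order_tendstoD(2)[OF \<eta>(1)]) simp
  then obtain m where m: "\<eta> m < \<delta> / 2" "\<eta> m < \<bar>x\<bar>"
    using eventually_happens'[OF sequentially_bot] by (metis min_less_iff_conj)
  have "ball x (\<delta> / 2) \<subseteq> core W (\<eta> m) k"
  proof
    fix x' assume x': "x' \<in> ball x (\<delta> / 2)"
    show "x' \<in> core W (\<eta> m) k"
      unfolding core_def
    proof (intro CollectI allI impI)
      fix I D :: "nat list set" and y
      assume I: "finite I" "D \<subseteq> I" "card D = k" and D: "\<forall>i\<in>D. \<bar>y i - x'\<bar> \<le> \<eta> m" "\<forall>i\<in>I - D. \<bar>y i\<bar> \<le> \<eta> m"
      show "dirac_sum I y \<in> W"
      proof (rule *[OF I])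
        show "\<forall>i\<in>D. \<bar>y i - x\<bar> \<le> \<delta>"
        proof
          fix i assume "i \<in> D"
          with D(1) have "\<bar>y i - x'\<bar> \<le> \<eta> m" by blast
          moreover have "\<bar>x - x'\<bar> < \<delta> / 2" using x' by (simp add: dist_real_def)
          ultimately show "\<bar>y i - x\<bar> \<le> \<delta>" using m(1) by linarith
        qed
        show "\<forall>i\<in>I - D. \<bar>y i\<bar> \<le> \<delta>"
        proof
          fix i assume "i \<in> I - D"
          with D(2) have "\<bar>y i\<bar> \<le> \<eta> m" by blast
          then show "\<bar>y i\<bar> \<le> \<delta>" using m(1) \<delta> by simp
        qed
      qed
    qed
  qed
  then have "x \<in> interior (core W (\<eta> m) k)"
    using \<delta> by (intro interiorI[of "ball x (\<delta> / 2)"]) auto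
  then show "x \<in> (\<Union>m. robust W (\<eta> m) k)"
    using m(2) unfolding robust_def by blast
qed

section \<open>Bounds for open sets and for sets away from the null measure\<close>

locale brw_large_deviations =
  branching_moments \<zeta> F \<mu> + heavy_tail_scaling F \<alpha> q L \<mu> \<gamma> b
  for \<zeta> F \<mu> \<alpha> q L \<gamma> b +
  assumes progeny_pos: "AE z in \<zeta>. 1 \<le> z"
begin

definition config :: "nat \<Rightarrow> environment \<Rightarrow> real measure" where
  "config n e = dirac_sum (generation e n) (\<lambda>v. position e v / \<gamma> n)"

definition rate :: "nat \<Rightarrow> real" where
  "rate n = 1 / (\<mu> ^ n * tail (\<gamma> n))"

abbreviation scaled_prob :: "nat \<Rightarrow> real measure set \<Rightarrow> ennreal" where
  "scaled_prob n A \<equiv> ennreal (rate n) * emeasure env_law {e. config n e \<in> A}"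

text \<open>The weights \<open>\<mu>\<^sup>-\<^sup>l\<close> as a measure, so that Fatou's lemma for integrals applies to the sum over \<open>l\<close>.\<close>

definition generation_weight :: "nat measure" where
  "generation_weight = density (count_space UNIV) (\<lambda>l. ennreal (1 / \<mu> ^ l))"

definition limit_mass :: "real measure set \<Rightarrow> ennreal" where
  "limit_mass A = (\<integral>\<^sup>+ l. \<integral>\<^sup>+ e. emeasure (nu \<alpha> q) {x. spike (gsize l e) x \<in> A} \<partial>env_law \<partial>generation_weight)"

lemma nn_integral_generation_weight:
  "(\<integral>\<^sup>+ l. f l \<partial>generation_weight) = (\<Sum>l. ennreal (1 / \<mu> ^ l) * f l)"
  unfolding generation_weight_def
  by (subst nn_integral_density) (simp_all add: nn_integral_count_space_nat)

lemma measurable_generation_weight [measurable]: "f \<in> borel_measurable generation_weight"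
  by (simp add: generation_weight_def)

lemma measurable_gsize_comp [measurable]: "(\<lambda>e. f (gsize l e)) \<in> borel_measurable env_law"
  using measurable_compose[OF measurable_gsize, of f borel l]
  by (simp add: measurable_cong_sets[OF sets_env_law refl])

lemma config_in_sets: "A \<in> sets borel_M0 \<Longrightarrow> {e. config n e \<in> A} \<in> sets env_law"
  unfolding config_def sets_env_law by (rule dirac_sum_generation_in_sets)

lemma tail_nonneg: "0 \<le> tail x"
  using tail_pos[of x] by simp

lemma rate_pos: "rate n > 0"
  using supercritical tail_pos[of "\<gamma> n"] by (simp add: rate_def)

lemma jumps_in_sets: "{e. jumps a n k e > 0} \<in> sets env_law"
proof -
  have "jumps a n k -` {0<..} \<inter> space environment_space \<in> sets environment_space"
    by (rule measurable_sets[OF measurable_jumps]) simp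
  then show ?thesis by (simp add: vimage_def sets_env_law space_PiM space_pair_measure)
qed

lemma prob_two_jumps_le:
  "emeasure env_law {e. jumps a n 2 e > 0} \<le> ennreal (\<mu> ^ n * (real n * tail a)\<^sup>2)"
proof -
  have "emeasure env_law {e. jumps a n 2 e > 0} \<le> (\<integral>\<^sup>+ e. of_nat (jumps a n 2 e) \<partial>env_law)"
    by (rule emeasure_pos_le_nn_integral[OF jumps_in_sets])
  also have "\<dots> \<le> mean ^ n * (of_nat n * emeasure F {x. \<bar>x\<bar> > a})\<^sup>2"
    by (rule nn_integral_jumps_le)
  also have "\<dots> = ennreal (\<mu> ^ n * (real n * tail a)\<^sup>2)"
    using supercritical tail_pos[of a]
    by (simp add: mean_eq tail_def F.emeasure_eq_measure ennreal_of_nat_eq_real_of_nat ennreal_mult[symmetric] ennreal_power)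
  finally show ?thesis .
qed

text \<open>The bound of \<open>big_mean_minus_prob_le\<close> for displacements larger than \<open>c \<gamma> n\<close>, multiplied by the rate.\<close>

definition multiple_big_error :: "real \<Rightarrow> nat \<Rightarrow> real" where
  "multiple_big_error c n = tail (c * \<gamma> n) / tail (\<gamma> n) *
    (\<mu> / (\<mu> - 1) * (real n * tail (c * \<gamma> n)) + 2 * \<mu> / (\<mu> - 1)\<^sup>2 *
      (\<integral>z. real z * ln (1 + real z * (\<mu> / (\<mu> - 1) * tail (c * \<gamma> n) * \<mu> ^ n)) \<partial>\<zeta>))"

lemma tail_mult_power_tendsto_0:
  assumes "c > 0"
  shows "(\<lambda>n. tail (c * \<gamma> n) * \<mu> ^ n) \<longlonglongrightarrow> 0"
proof -
  have "(\<lambda>n. tail (c * \<gamma> n) / tail (\<gamma> n) * (\<mu> ^ n * tail (\<gamma> n))) \<longlonglongrightarrow> c powr (- \<alpha>) * 0"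
    by (intro tendsto_mult tail_scaled_ratio[OF assms] expected_big_jumps_tendsto_0)
  moreover have "tail (c * \<gamma> n) / tail (\<gamma> n) * (\<mu> ^ n * tail (\<gamma> n)) = tail (c * \<gamma> n) * \<mu> ^ n" for n
    using tail_pos[of "\<gamma> n"] by simp
  ultimately show ?thesis by simp
qed

lemma multiple_big_error_tendsto_0:
  assumes "c > 0"
  shows "multiple_big_error c \<longlonglongrightarrow> 0"
proof -
  have lim: "(\<lambda>n. tail (c * \<gamma> n) * \<mu> ^ n) \<longlonglongrightarrow> 0" by (rule tail_mult_power_tendsto_0[OF assms])
  have "norm (1 / \<mu>) < 1" using supercritical by simp
  then have "(\<lambda>n. tail (c * \<gamma> n) * \<mu> ^ n * (real n * (1 / \<mu>) ^ n)) \<longlonglongrightarrow> 0 * 0"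
    by (intro tendsto_mult lim powser_times_n_limit_0)
  moreover have "tail (c * \<gamma> n) * \<mu> ^ n * (real n * (1 / \<mu>) ^ n) = real n * tail (c * \<gamma> n)" for n
    using supercritical by (simp add: power_divide)
  ultimately have 1: "(\<lambda>n. real n * tail (c * \<gamma> n)) \<longlonglongrightarrow> 0" by simp
  have "(\<lambda>n. \<mu> / (\<mu> - 1) * (tail (c * \<gamma> n) * \<mu> ^ n)) \<longlonglongrightarrow> 0"
    by (intro tendsto_mult_right_zero lim)
  then have "(\<lambda>n. \<mu> / (\<mu> - 1) * tail (c * \<gamma> n) * \<mu> ^ n) \<longlonglongrightarrow> 0" by (simp only: mult.assoc)
  then have 2: "(\<lambda>n. \<integral>z. real z * ln (1 + real z * (\<mu> / (\<mu> - 1) * tail (c * \<gamma> n) * \<mu> ^ n)) \<partial>\<zeta>) \<longlonglongrightarrow> 0"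
    by (rule ln_term_tendsto_0) (use supercritical in \<open>simp add: tail_nonneg\<close>)
  have "multiple_big_error c \<longlonglongrightarrow> c powr (- \<alpha>) * (\<mu> / (\<mu> - 1) * 0 + 2 * \<mu> / (\<mu> - 1)\<^sup>2 * 0)"
    unfolding multiple_big_error_def [abs_def]
    by (intro tendsto_mult tendsto_add tendsto_const tail_scaled_ratio[OF assms] 1 2)
  then show ?thesis by simp
qed

lemma rate_times_multiple_big_le:
  "rate n * (big_mean (tail (c * \<gamma> n)) n - env.prob {e. marked (big (c * \<gamma> n)) n e > 0}) \<le> multiple_big_error c n"
proof -
  let ?p = "tail (c * \<gamma> n)"
  have "rate n * (big_mean ?p n - env.prob {e. marked (big (c * \<gamma> n)) n e > 0}) \<le>
    rate n * (?p * \<mu> ^ n * (\<mu> / (\<mu> - 1) * n * ?p +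
      2 * \<mu> / (\<mu> - 1)\<^sup>2 * (\<integral>z. real z * ln (1 + real z * (\<mu> / (\<mu> - 1) * ?p * \<mu> ^ n)) \<partial>\<zeta>)))"
    using big_mean_minus_prob_le[OF abs_gt_borel, of "c * \<gamma> n" n] rate_pos[of n]
    unfolding big_eq_Times tail_def by (intro mult_left_mono) auto
  also have "\<dots> = rate n * (?p * \<mu> ^ n) * (\<mu> / (\<mu> - 1) * (real n * ?p) +
      2 * \<mu> / (\<mu> - 1)\<^sup>2 * (\<integral>z. real z * ln (1 + real z * (\<mu> / (\<mu> - 1) * ?p * \<mu> ^ n)) \<partial>\<zeta>))"
    by (simp only: mult.assoc)
  also have "rate n * (?p * \<mu> ^ n) = ?p / tail (\<gamma> n)"
    using supercritical by (simp add: rate_def)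
  finally show ?thesis unfolding multiple_big_error_def .
qed

lemma big_scaled_mean:
  "(\<integral>\<^sup>+ e. of_nat (marked (big (c * \<gamma> n)) n e) \<partial>env_law) = ennreal (big_mean (tail (c * \<gamma> n)) n)"
  unfolding big_eq_Times tail_def by (rule nn_integral_marked_big[OF abs_gt_borel])

text \<open>On the event that an edge is marked by \<open>S n\<close>, that no second edge has a displacement above \<open>\<eta> \<gamma> n / 2\<close>, and that
no line of descent has two displacements above \<open>a n\<close>, the configuration belongs to \<open>W\<close>. The expected number of
marked edges equals, after multiplication with the rate, a sum over \<open>l\<close> whose terms are bounded from below
by vague convergence.\<close>

lemma liminf_robust:
  assumes W: "openin vague_topology W" and null: "null_point_measure \<notin> W" and \<eta>: "\<eta> > 0"
  shows "(\<integral>\<^sup>+ l. \<integral>\<^sup>+ e. emeasure (nu \<alpha> q) (robust W \<eta> (gsize l e)) \<partial>env_law \<partial>generation_weight) \<le>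
    liminf (\<lambda>n. scaled_prob n W)"
proof -
  obtain a where a: "\<forall>\<^sub>F n in sequentially. 0 \<le> a n" "(\<lambda>n. real n * a n / \<gamma> n) \<longlonglongrightarrow> 0"
    "(\<lambda>n. (real n * tail (a n))\<^sup>2 / tail (\<gamma> n)) \<longlonglongrightarrow> 0"
    by (rule threshold_exists)
  \<comment> \<open>half of the tolerance is left for the drift \<open>n a n\<close> along a line of descent\<close>
  define c where "c = \<eta> / 2"
  have c: "c > 0" using \<eta> by (simp add: c_def)
  define S where "S n = {(y, k). y / \<gamma> n \<in> robust W \<eta> k}" for n
  define \<phi> where "\<phi> n k = ennreal (measure F {y. y / \<gamma> n \<in> robust W \<eta> k} / tail (\<gamma> n))" for n k
  have robust_borel: "robust W \<eta> k \<in> sets borel" for k using open_robust by auto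
  have slice_sets: "{y. y / \<gamma> n \<in> robust W \<eta> k} \<in> sets borel" for n k
    using vimage_div_in_sets[OF robust_borel[of k], of "\<gamma> n"] by (simp add: sets_F)
  have S_sets: "S n \<in> sets (borel \<Otimes>\<^sub>M count_space UNIV)" for n
  proof -
    have "S n = (\<Union>k. {y. y / \<gamma> n \<in> robust W \<eta> k} \<times> {k})" by (auto simp: S_def)
    also have "\<dots> \<in> sets (borel \<Otimes>\<^sub>M count_space UNIV)"
      using slice_sets by (intro sets.countable_UN'') auto
    finally show ?thesis .
  qed
  define x where "x n = (\<Sum>l<n. ennreal (1 / \<mu> ^ l) * (\<integral>\<^sup>+ e. \<phi> n (gsize l e) \<partial>env_law))" for n
  define \<epsilon> where "\<epsilon> n = (real n * tail (a n))\<^sup>2 / tail (\<gamma> n) + 2 * multiple_big_error c n" for n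
  have rate_mean: "ennreal (rate n) * (\<integral>\<^sup>+ e. of_nat (marked (S n) n e) \<partial>env_law) = x n" for n
  proof -
    have "ennreal (rate n) * (mean ^ (n - l) * (\<integral>\<^sup>+ e. emeasure F {y. (y, gsize l e) \<in> S n} \<partial>env_law)) =
        ennreal (1 / \<mu> ^ l) * (\<integral>\<^sup>+ e. \<phi> n (gsize l e) \<partial>env_law)" if "l < n" for l
    proof -
      have "\<mu> ^ n = \<mu> ^ l * \<mu> ^ (n - l)" using that by (simp add: power_add[symmetric])
      then have "rate n * \<mu> ^ (n - l) = 1 / \<mu> ^ l * (1 / tail (\<gamma> n))"
        using supercritical by (simp add: rate_def)
      then have r: "ennreal (rate n) * mean ^ (n - l) = ennreal (1 / \<mu> ^ l) * ennreal (1 / tail (\<gamma> n))"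
        using supercritical rate_pos[of n] tail_pos[of "\<gamma> n"]
        by (simp add: mean_eq ennreal_power ennreal_mult[symmetric] less_imp_le)
      have "\<phi> n k = ennreal (1 / tail (\<gamma> n)) * emeasure F {y. (y, k) \<in> S n}" for k
        using tail_pos[of "\<gamma> n"]
        by (simp add: \<phi>_def S_def F.emeasure_eq_measure ennreal_mult[symmetric] less_imp_le)
      then have "(\<integral>\<^sup>+ e. \<phi> n (gsize l e) \<partial>env_law) =
          ennreal (1 / tail (\<gamma> n)) * (\<integral>\<^sup>+ e. emeasure F {y. (y, gsize l e) \<in> S n} \<partial>env_law)"
        using nn_integral_cmult[OF measurable_gsize_comp[of "\<lambda>k. emeasure F {y. (y, k) \<in> S n}" l]] by simp
      then show ?thesis using r by (simp add: mult.assoc[symmetric])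
    qed
    then show ?thesis
      unfolding nn_integral_marked[OF S_sets] sum_distrib_left x_def by (intro sum.cong) auto
  qed
  have ev: "\<forall>\<^sub>F n in sequentially. x n \<le> scaled_prob n W + ennreal (\<epsilon> n)"
  proof -
    have "\<forall>\<^sub>F n in sequentially. real n * a n / \<gamma> n < \<eta> / 2"
      using \<eta> by (intro order_tendstoD(2)[OF a(2)]) simp
    then show ?thesis
      using a(1) eventually_ge_at_top[of 1]
    proof eventually_elim
      case (elim n)
      have \<gamma>: "\<gamma> n > 0" using \<gamma>_pos elim(3) by simp
      have na: "real n * a n \<le> \<eta> / 2 * \<gamma> n" using elim(1) \<gamma> by (simp add: field_simps)
      have "1 * a n \<le> real n * a n" using elim by (intro mult_right_mono) auto
      with na have ac: "a n \<le> c * \<gamma> n" by (simp add: c_def)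
      have S_big: "\<bar>y\<bar> > c * \<gamma> n \<and> k > 0" if "(y, k) \<in> S n" for y k
      proof -
        have "\<bar>y / \<gamma> n\<bar> > \<eta>" using that by (simp add: S_def robust_def)
        then have "\<bar>y\<bar> > \<eta> * \<gamma> n" using \<gamma> by (simp add: abs_divide field_simps)
        moreover have "\<eta> * \<gamma> n > c * \<gamma> n" using \<eta> \<gamma> by (simp add: c_def)
        moreover have "k \<noteq> 0" using that robust_0[OF null, of \<eta>] by (cases "k = 0") (auto simp: S_def)
        ultimately show ?thesis by auto
      qed
      let ?G = "{e. marked (S n) n e > 0 \<and> marked (big (c * \<gamma> n)) n e \<le> 1}"
      have "?G \<subseteq> {e. config n e \<in> W} \<union> {e. jumps (a n) n 2 e > 0}"
      proof
        fix e assume e: "e \<in> ?G"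
        show "e \<in> {e. config n e \<in> W} \<union> {e. jumps (a n) n 2 e > 0}"
        proof (cases "jumps (a n) n 2 e = 0")
          case True
          obtain y D where D: "(y, card D) \<in> S n" "D \<subseteq> generation e n"
              "\<And>w. w \<in> D \<Longrightarrow> \<bar>position e w - y\<bar> \<le> n * a n"
              "\<And>w. w \<in> generation e n - D \<Longrightarrow> \<bar>position e w\<bar> \<le> n * a n + c * \<gamma> n"
            using one_big_jump[OF elim(2) ac S_big True] e by auto
          have "y / \<gamma> n \<in> core W \<eta> (card D)"
            using D(1) interior_subset by (auto simp: S_def robust_def)
          note core = this
          have near: "\<forall>w\<in>D. \<bar>position e w / \<gamma> n - y / \<gamma> n\<bar> \<le> \<eta>"
          proof
            fix w assume "w \<in> D"
            have "0 \<le> \<eta> / 2 * \<gamma> n" using \<eta> \<gamma> by simp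
            then have "\<bar>position e w - y\<bar> \<le> \<eta> * \<gamma> n"
              using D(3)[OF \<open>w \<in> D\<close>] na by linarith
            then show "\<bar>position e w / \<gamma> n - y / \<gamma> n\<bar> \<le> \<eta>"
              using \<gamma> by (simp add: diff_divide_distrib[symmetric] abs_divide divide_le_eq)
          qed
          have rest: "\<forall>w\<in>generation e n - D. \<bar>position e w / \<gamma> n\<bar> \<le> \<eta>"
          proof
            fix w assume "w \<in> generation e n - D"
            have "\<bar>position e w\<bar> \<le> \<eta> * \<gamma> n"
              using D(4)[OF \<open>w \<in> generation e n - D\<close>] na by (simp add: c_def)
            then show "\<bar>position e w / \<gamma> n\<bar> \<le> \<eta>"
              using \<gamma> by (simp add: abs_divide divide_le_eq)
          qed
          have "config n e \<in> W"
            unfolding config_def by (rule coreD[OF core finite_generation D(2) refl near rest])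
          then show ?thesis by simp
        qed simp
      qed
      then have "emeasure env_law ?G \<le> emeasure env_law ({e. config n e \<in> W} \<union> {e. jumps (a n) n 2 e > 0})"
        by (intro emeasure_mono sets.Un config_in_sets jumps_in_sets open_in_sets_borel_M0 W null)
      also have "\<dots> \<le> emeasure env_law {e. config n e \<in> W} + emeasure env_law {e. jumps (a n) n 2 e > 0}"
        by (intro emeasure_subadditive config_in_sets jumps_in_sets open_in_sets_borel_M0 W null)
      also have "\<dots> \<le> emeasure env_law {e. config n e \<in> W} + ennreal (\<mu> ^ n * (real n * tail (a n))\<^sup>2)"
        by (intro add_left_mono prob_two_jumps_le)
      finally have G: "emeasure env_law ?G \<le>
          emeasure env_law {e. config n e \<in> W} + ennreal (\<mu> ^ n * (real n * tail (a n))\<^sup>2)" .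
      define d where "d = big_mean (tail (c * \<gamma> n)) n - env.prob {e. marked (big (c * \<gamma> n)) n e > 0}"
      have "(\<integral>\<^sup>+ e. of_nat (marked (S n) n e) \<partial>env_law) \<le> emeasure env_law ?G + 2 * ennreal d"
        unfolding d_def tail_def by (rule prob_one_big_ge[OF S_sets]) (use S_big in \<open>auto simp: big_def\<close>)
      also have "\<dots> \<le> emeasure env_law {e. config n e \<in> W} + ennreal (\<mu> ^ n * (real n * tail (a n))\<^sup>2) + 2 * ennreal d"
        using G by (intro add_right_mono)
      finally have "x n \<le> ennreal (rate n) * (emeasure env_law {e. config n e \<in> W} +
          ennreal (\<mu> ^ n * (real n * tail (a n))\<^sup>2) + 2 * ennreal d)"
        unfolding rate_mean[symmetric] by (intro mult_left_mono) simp_all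
      also have "\<dots> = scaled_prob n W +
          (ennreal (rate n * (\<mu> ^ n * (real n * tail (a n))\<^sup>2)) + 2 * ennreal (rate n * d))"
      proof -
        have m: "ennreal (rate n * y) = ennreal (rate n) * ennreal y" for y
          using rate_pos[of n] by (simp add: ennreal_mult')
        show ?thesis
          unfolding m distrib_left add.assoc mult.left_commute[of "ennreal (rate n)" 2] ..
      qed
      also have "rate n * (\<mu> ^ n * (real n * tail (a n))\<^sup>2) = (real n * tail (a n))\<^sup>2 / tail (\<gamma> n)"
        using supercritical by (simp add: rate_def)
      also have "ennreal ((real n * tail (a n))\<^sup>2 / tail (\<gamma> n)) + 2 * ennreal (rate n * d) \<le> ennreal (\<epsilon> n)"
      proof -
        have nonneg: "0 \<le> multiple_big_error c n"
          unfolding multiple_big_error_def using supercritical tail_pos[of "c * \<gamma> n"] tail_pos[of "\<gamma> n"]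
          by (intro mult_nonneg_nonneg add_nonneg_nonneg integral_nonneg_AE AE_I2 divide_nonneg_nonneg ln_ge_zero) (auto simp: less_imp_le)
        have "2 * ennreal (rate n * d) \<le> 2 * ennreal (multiple_big_error c n)"
          unfolding d_def by (intro mult_left_mono ennreal_leI rate_times_multiple_big_le) simp
        also have "\<dots> = ennreal (2 * multiple_big_error c n)" using nonneg by (simp add: ennreal_mult')
        finally show ?thesis
          using nonneg tail_pos[of "\<gamma> n"] by (simp add: \<epsilon>_def add_left_mono)
      qed
      finally show ?case by (simp add: add_left_mono)
    qed
  qed
  have "\<epsilon> \<longlonglongrightarrow> 0 + 2 * 0"
    unfolding \<epsilon>_def by (intro tendsto_add tendsto_mult_left a(3) multiple_big_error_tendsto_0 c)
  then have "(\<lambda>n. ennreal (\<epsilon> n)) \<longlonglongrightarrow> 0"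
    using tendsto_ennrealI by force
  from liminf_le_liminf_if_le_add[OF ev this]
  have "liminf x \<le> liminf (\<lambda>n. scaled_prob n W)" .
  moreover have "(\<integral>\<^sup>+ l. \<integral>\<^sup>+ e. emeasure (nu \<alpha> q) (robust W \<eta> (gsize l e)) \<partial>env_law \<partial>generation_weight) \<le> liminf x"
  proof -
    have "(\<integral>\<^sup>+ l. \<integral>\<^sup>+ e. emeasure (nu \<alpha> q) (robust W \<eta> (gsize l e)) \<partial>env_law \<partial>generation_weight) \<le>
        (\<integral>\<^sup>+ l. liminf (\<lambda>n. if l < n then \<integral>\<^sup>+ e. \<phi> n (gsize l e) \<partial>env_law else 0) \<partial>generation_weight)"
    proof (rule nn_integral_mono)
      fix l
      have "emeasure (nu \<alpha> q) (robust W \<eta> k) \<le> liminf (\<lambda>n. \<phi> n k)" for k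
        unfolding \<phi>_def using \<eta>
        by (intro liminf_open_ge_nu[OF filterlim_\<gamma> open_robust]) (simp add: robust_def)
      then have "(\<integral>\<^sup>+ e. emeasure (nu \<alpha> q) (robust W \<eta> (gsize l e)) \<partial>env_law) \<le>
          (\<integral>\<^sup>+ e. liminf (\<lambda>n. \<phi> n (gsize l e)) \<partial>env_law)"
        by (intro nn_integral_mono)
      also have "\<dots> \<le> liminf (\<lambda>n. \<integral>\<^sup>+ e. \<phi> n (gsize l e) \<partial>env_law)"
        by (rule nn_integral_liminf) (rule measurable_gsize_comp)
      also have "\<dots> = liminf (\<lambda>n. if l < n then \<integral>\<^sup>+ e. \<phi> n (gsize l e) \<partial>env_law else 0)"
        by (rule Liminf_eq, use eventually_gt_at_top[of l] in eventually_elim) simp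
      finally show "(\<integral>\<^sup>+ e. emeasure (nu \<alpha> q) (robust W \<eta> (gsize l e)) \<partial>env_law) \<le>
          liminf (\<lambda>n. if l < n then \<integral>\<^sup>+ e. \<phi> n (gsize l e) \<partial>env_law else 0)" .
    qed
    also have "\<dots> \<le> liminf (\<lambda>n. \<integral>\<^sup>+ l. (if l < n then \<integral>\<^sup>+ e. \<phi> n (gsize l e) \<partial>env_law else 0) \<partial>generation_weight)"
      by (rule nn_integral_liminf) simp
    also have "(\<lambda>n. \<integral>\<^sup>+ l. (if l < n then \<integral>\<^sup>+ e. \<phi> n (gsize l e) \<partial>env_law else 0) \<partial>generation_weight) = x"
    proof
      fix n
      have "(\<Sum>l. ennreal (1 / \<mu> ^ l) * (if l < n then \<integral>\<^sup>+ e. \<phi> n (gsize l e) \<partial>env_law else 0)) =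
          (\<Sum>l<n. ennreal (1 / \<mu> ^ l) * (if l < n then \<integral>\<^sup>+ e. \<phi> n (gsize l e) \<partial>env_law else 0))"
        by (rule suminf_finite) auto
      then show "(\<integral>\<^sup>+ l. (if l < n then \<integral>\<^sup>+ e. \<phi> n (gsize l e) \<partial>env_law else 0) \<partial>generation_weight) = x n"
        unfolding nn_integral_generation_weight x_def by simp
    qed
    finally show ?thesis .
  qed
  ultimately show ?thesis by (rule order_trans[rotated])
qed

text \<open>Letting the tolerance tend to \<open>0\<close> exhausts the points \<open>x\<close> with \<open>k \<delta>\<^sub>x \<in> W\<close>.\<close>

lemma limit_mass_le_liminf:
  assumes W: "openin vague_topology W" and null: "null_point_measure \<notin> W"
  shows "limit_mass W \<le> liminf (\<lambda>n. scaled_prob n W)"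
proof -
  define \<eta> :: "nat \<Rightarrow> real" where "\<eta> m = 1 / real (Suc m)" for m
  have \<eta>: "\<eta> \<longlonglongrightarrow> 0" "\<And>m. \<eta> m > 0"
    unfolding \<eta>_def using LIMSEQ_inverse_real_of_nat by (simp_all add: inverse_eq_divide)
  have slice: "emeasure (nu \<alpha> q) {x. spike k x \<in> W} \<le> liminf (\<lambda>m. emeasure (nu \<alpha> q) (robust W (\<eta> m) k))" for k
  proof -
    have borel: "robust W (\<eta> m) k \<in> sets (nu \<alpha> q)" for m
      using open_robust[of W "\<eta> m" k] by simp
    have "emeasure (nu \<alpha> q) {x. spike k x \<in> W} \<le> emeasure (nu \<alpha> q) (\<Union>m. robust W (\<eta> m) k)"
      by (intro emeasure_mono Union_robust W null \<eta> sets.countable_UN) (use borel in blast)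
    also have "\<dots> = liminf (\<lambda>m. emeasure (nu \<alpha> q) (robust W (\<eta> m) k))"
    proof (rule lim_imp_Liminf[symmetric, OF _ Lim_emeasure_incseq])
      show "range (\<lambda>m. robust W (\<eta> m) k) \<subseteq> sets (nu \<alpha> q)" using borel by blast
      show "incseq (\<lambda>m. robust W (\<eta> m) k)"
        by (intro incseq_SucI robust_antimono) (simp add: \<eta>_def frac_le)
    qed simp
    finally show ?thesis .
  qed
  have "limit_mass W \<le> (\<integral>\<^sup>+ l. \<integral>\<^sup>+ e. liminf (\<lambda>m. emeasure (nu \<alpha> q) (robust W (\<eta> m) (gsize l e))) \<partial>env_law \<partial>generation_weight)"
    unfolding limit_mass_def by (intro nn_integral_mono slice)
  also have "\<dots> \<le> (\<integral>\<^sup>+ l. liminf (\<lambda>m. \<integral>\<^sup>+ e. emeasure (nu \<alpha> q) (robust W (\<eta> m) (gsize l e)) \<partial>env_law) \<partial>generation_weight)"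
    by (intro nn_integral_mono nn_integral_liminf measurable_gsize_comp)
  also have "\<dots> \<le> liminf (\<lambda>m. \<integral>\<^sup>+ l. \<integral>\<^sup>+ e. emeasure (nu \<alpha> q) (robust W (\<eta> m) (gsize l e)) \<partial>env_law \<partial>generation_weight)"
    by (rule nn_integral_liminf) (rule measurable_generation_weight)
  also have "\<dots> \<le> liminf (\<lambda>m :: nat. liminf (\<lambda>n. scaled_prob n W))"
    by (intro Liminf_mono always_eventually allI liminf_robust W null \<eta>)
  also have "\<dots> = liminf (\<lambda>n. scaled_prob n W)"
    by (simp add: Liminf_const)
  finally show ?thesis .
qed

lemma gsize_pos: "AE e in env_law. \<forall>l. gsize l e > 0"
proof -
  have "AE e in env_law. 1 \<le> fst (e v)" for v
  proof -
    interpret disp: prob_space "PiM UNIV (\<lambda>_ :: nat. F)" by (rule prob_space_displacements)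
    interpret pair: pair_sigma_finite \<zeta> "PiM UNIV (\<lambda>_ :: nat. F)" ..
    have fst_sets: "{r \<in> space rep_law. 1 \<le> fst r} \<in> sets rep_law"
    proof -
      have "{r \<in> space reproduction_space. 1 \<le> fst r} \<in> sets reproduction_space" by measurable
      then show ?thesis by (simp add: sets_rep_law sets_eq_imp_space_eq[OF sets_rep_law])
    qed
    have "AE r in rep_law. 1 \<le> fst r"
      unfolding rep_law_def using fst_sets progeny_pos
      by (intro pair.AE_pair_measure) (simp_all add: rep_law_def)
    then have "AE r in distr env_law rep_law (\<lambda>e. e v). 1 \<le> fst r"
      by (simp only: distr_reproduction)
    then show ?thesis
      by (subst (asm) AE_distr_iff) (simp_all add: fst_sets)
  qed
  then have "AE e in env_law. \<forall>v. 1 \<le> fst (e v)" by (simp add: AE_all_countable)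
  then show ?thesis
  proof (rule eventually_mono)
    fix e :: environment assume "\<forall>v. 1 \<le> fst (e v)"
    have "gsize l e > 0" if "\<forall>v. 1 \<le> fst (e v)" for l and e :: environment
      using that
    proof (induction l arbitrary: e)
      case (Suc l)
      have "\<forall>v. 1 \<le> fst (shift 0 e v)" using Suc.prems by (simp add: shift_def)
      then have "gsize l (shift 0 e) > 0" by (rule Suc.IH)
      moreover have "0 < fst (e [])" using Suc.prems by (metis less_le_trans zero_less_one)
      ultimately show ?case
        unfolding gsize_Suc by (auto simp: branch_sum_eq_0_iff simp flip: neq0_conv)
    qed (simp add: generation_0)
    then show "\<forall>l. gsize l e > 0" using \<open>\<forall>v. 1 \<le> fst (e v)\<close> by blast
  qed
qed

text \<open>As every particle has a child, no generation is empty, and the value is a geometric series.\<close>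

lemma limit_mass_far:
  assumes "\<delta> > 0"
  shows "limit_mass (far \<delta>) = ennreal (\<delta> powr (- \<alpha>) * (\<mu> / (\<mu> - 1)))"
proof -
  have "{x. spike k x \<in> far \<delta>} = {x. \<bar>x\<bar> > \<delta>}" if "k > 0" for k
    using that assms by (auto simp: dirac_sum_in_far_iff)
  then have slice: "emeasure (nu \<alpha> q) {x. spike k x \<in> far \<delta>} = ennreal (\<delta> powr (- \<alpha>))" if "k > 0" for k
    using that by (simp add: emeasure_nu_abs_gt assms)
  have "(\<integral>\<^sup>+ e. emeasure (nu \<alpha> q) {x. spike (gsize l e) x \<in> far \<delta>} \<partial>env_law) = ennreal (\<delta> powr (- \<alpha>))" for l
  proof -
    have "(\<integral>\<^sup>+ e. emeasure (nu \<alpha> q) {x. spike (gsize l e) x \<in> far \<delta>} \<partial>env_law) =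
        (\<integral>\<^sup>+ e. ennreal (\<delta> powr (- \<alpha>)) \<partial>env_law)"
      by (rule nn_integral_cong_AE, use gsize_pos in eventually_elim) (simp add: slice)
    then show ?thesis by (simp add: env.emeasure_space_1[simplified])
  qed
  then have "limit_mass (far \<delta>) = (\<Sum>l. ennreal (1 / \<mu> ^ l) * ennreal (\<delta> powr (- \<alpha>)))"
    unfolding limit_mass_def nn_integral_generation_weight by (simp only:)
  also have "\<dots> = (\<Sum>l. ennreal (\<delta> powr (- \<alpha>) * (1 / \<mu>) ^ l))"
    using supercritical by (intro suminf_cong) (simp add: ennreal_mult[symmetric] power_divide)
  also have "\<dots> = ennreal (\<delta> powr (- \<alpha>) * (\<mu> / (\<mu> - 1)))"
  proof (rule suminf_ennreal_eq)
    have "(\<lambda>l. (1 / \<mu>) ^ l) sums (1 / (1 - 1 / \<mu>))"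
      using supercritical by (intro geometric_sums) simp
    moreover have "1 / (1 - 1 / \<mu>) = \<mu> / (\<mu> - 1)"
      using supercritical by (simp add: field_simps)
    ultimately have "(\<lambda>l. (1 / \<mu>) ^ l) sums (\<mu> / (\<mu> - 1))" by simp
    then show "(\<lambda>l. \<delta> powr (- \<alpha>) * (1 / \<mu>) ^ l) sums (\<delta> powr (- \<alpha>) * (\<mu> / (\<mu> - 1)))"
      by (rule sums_mult)
  qed (use supercritical in simp)
  finally show ?thesis .
qed

text \<open>If no displacement exceeds \<open>c \<gamma> n\<close> with \<open>c < \<delta>\<close> and no line of descent has two displacements above \<open>a n\<close>, then all
particles stay within \<open>\<delta> \<gamma> n\<close>. The union bound over all edges is asymptotically equal to the limit mass as \<open>c\<close> tends to
\<open>\<delta>\<close>.\<close>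

lemma limsup_far_le:
  assumes \<delta>: "\<delta> > 0"
  shows "limsup (\<lambda>n. scaled_prob n (far \<delta>)) \<le> limit_mass (far \<delta>)"
proof -
  let ?y = "\<lambda>n. scaled_prob n (far \<delta>)"
  obtain a where a: "\<forall>\<^sub>F n in sequentially. 0 \<le> a n" "(\<lambda>n. real n * a n / \<gamma> n) \<longlonglongrightarrow> 0"
    "(\<lambda>n. (real n * tail (a n))\<^sup>2 / tail (\<gamma> n)) \<longlonglongrightarrow> 0"
    by (rule threshold_exists)
  have bound: "limsup ?y \<le> ennreal (c powr (- \<alpha>) * (\<mu> / (\<mu> - 1)))" if c: "0 < c" "c < \<delta>" for c
  proof -
    let ?z = "\<lambda>n. tail (c * \<gamma> n) / tail (\<gamma> n) * (\<mu> / (\<mu> - 1)) + (real n * tail (a n))\<^sup>2 / tail (\<gamma> n)"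
    have "\<forall>\<^sub>F n in sequentially. real n * a n / \<gamma> n < \<delta> - c"
      using c by (intro order_tendstoD(2)[OF a(2)]) simp
    then have "\<forall>\<^sub>F n in sequentially. ?y n \<le> ennreal (?z n)"
      using a(1) eventually_ge_at_top[of 1]
    proof eventually_elim
      case (elim n)
      have \<gamma>: "\<gamma> n > 0" using \<gamma>_pos elim(3) by simp
      have na: "real n * a n + c * \<gamma> n \<le> \<delta> * \<gamma> n" using elim(1) \<gamma> by (simp add: field_simps)
      let ?B = "{e. marked (big (c * \<gamma> n)) n e > 0}" and ?J = "{e. jumps (a n) n 2 e > 0}"
      have sub: "{e. config n e \<in> far \<delta>} \<subseteq> ?B \<union> ?J"
      proof
        fix e assume "e \<in> {e. config n e \<in> far \<delta>}"
        then obtain w where w: "w \<in> generation e n" "\<bar>position e w / \<gamma> n\<bar> > \<delta>"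
          using \<delta> by (auto simp: config_def dirac_sum_in_far_iff finite_generation)
        then have "\<bar>position e w\<bar> > \<delta> * \<gamma> n" using \<gamma> by (simp add: abs_divide less_divide_eq)
        then have "\<not> \<bar>position e w\<bar> \<le> real n * a n + c * \<gamma> n" using na by simp
        then have "\<not> (jumps (a n) n 2 e = 0 \<and> marked (big (c * \<gamma> n)) n e = 0)"
          using position_le_without_big[OF elim(2) _ _ _ w(1), of "c * \<gamma> n"] c \<gamma> by auto
        then show "e \<in> ?B \<union> ?J" by auto
      qed
      have B_sets: "?B \<in> sets env_law" by (rule sets_marked[OF big_in_sets])
      have "emeasure env_law {e. config n e \<in> far \<delta>} \<le> emeasure env_law (?B \<union> ?J)"
        by (intro emeasure_mono sub sets.Un B_sets jumps_in_sets)
      also have "\<dots> \<le> emeasure env_law ?B + emeasure env_law ?J"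
        by (rule emeasure_subadditive[OF B_sets jumps_in_sets])
      also have "\<dots> \<le> ennreal (big_mean (tail (c * \<gamma> n)) n) + ennreal (\<mu> ^ n * (real n * tail (a n))\<^sup>2)"
      proof (rule add_mono[OF _ prob_two_jumps_le])
        have "emeasure env_law ?B \<le> (\<integral>\<^sup>+ e. of_nat (marked (big (c * \<gamma> n)) n e) \<partial>env_law)"
          by (rule emeasure_pos_le_nn_integral[OF B_sets])
        also note big_scaled_mean
        finally show "emeasure env_law ?B \<le> ennreal (big_mean (tail (c * \<gamma> n)) n)"
          .
      qed
      also have "\<dots> \<le> ennreal (\<mu> / (\<mu> - 1) * tail (c * \<gamma> n) * \<mu> ^ n) + ennreal (\<mu> ^ n * (real n * tail (a n))\<^sup>2)"
        by (intro add_right_mono ennreal_leI big_mean_le(2) tail_nonneg)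
      finally have "?y n \<le> ennreal (rate n) * (ennreal (\<mu> / (\<mu> - 1) * tail (c * \<gamma> n) * \<mu> ^ n) +
          ennreal (\<mu> ^ n * (real n * tail (a n))\<^sup>2))"
        by (intro mult_left_mono) simp_all
      also have "\<dots> = ennreal (rate n * (\<mu> / (\<mu> - 1) * tail (c * \<gamma> n) * \<mu> ^ n) +
          rate n * (\<mu> ^ n * (real n * tail (a n))\<^sup>2))"
        using rate_pos[of n] supercritical tail_nonneg
        by (subst ennreal_plus) (auto simp: distrib_left ennreal_mult'[symmetric] less_imp_le intro!: mult_nonneg_nonneg)
      also have "rate n * (\<mu> / (\<mu> - 1) * tail (c * \<gamma> n) * \<mu> ^ n) + rate n * (\<mu> ^ n * (real n * tail (a n))\<^sup>2) = ?z n"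
        using supercritical by (simp add: rate_def)
      finally show ?case .
    qed
    then have "limsup ?y \<le> limsup (\<lambda>n. ennreal (?z n))" by (rule Limsup_mono)
    also have "\<dots> = ennreal (c powr (- \<alpha>) * (\<mu> / (\<mu> - 1)) + 0)"
      by (intro lim_imp_Limsup tendsto_ennrealI tendsto_add tendsto_mult_right tail_scaled_ratio a(3) c) simp
    finally show ?thesis by simp
  qed
  have "(\<lambda>m. \<delta> * (1 - 1 / real (Suc (Suc m)))) \<longlonglongrightarrow> \<delta> * (1 - 0)"
    using LIMSEQ_Suc[OF LIMSEQ_inverse_real_of_nat]
    by (intro tendsto_mult_left tendsto_diff tendsto_const) (simp add: inverse_eq_divide)
  then have "(\<lambda>m. ennreal ((\<delta> * (1 - 1 / real (Suc (Suc m)))) powr (- \<alpha>) * (\<mu> / (\<mu> - 1)))) \<longlonglongrightarrow>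
      ennreal ((\<delta> * (1 - 0)) powr (- \<alpha>) * (\<mu> / (\<mu> - 1)))"
    using \<delta> by (intro tendsto_ennrealI tendsto_mult_right tendsto_powr tendsto_const) auto
  then have "limsup ?y \<le> ennreal ((\<delta> * (1 - 0)) powr (- \<alpha>) * (\<mu> / (\<mu> - 1)))"
  proof (rule LIMSEQ_le_const)
    have "limsup ?y \<le> ennreal ((\<delta> * (1 - 1 / real (Suc (Suc m)))) powr (- \<alpha>) * (\<mu> / (\<mu> - 1)))" for m
    proof (rule bound)
      have "0 < 1 - 1 / real (Suc (Suc m))" by simp
      then show "0 < \<delta> * (1 - 1 / real (Suc (Suc m)))" using \<delta> by (intro mult_pos_pos)
      have "\<delta> * (1 - 1 / real (Suc (Suc m))) < \<delta> * 1" using \<delta> by (intro mult_strict_left_mono) simp_all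
      then show "\<delta> * (1 - 1 / real (Suc (Suc m))) < \<delta>" by simp
    qed
    then show "\<exists>N. \<forall>m\<ge>N. limsup ?y \<le> ennreal ((\<delta> * (1 - 1 / real (Suc (Suc m)))) powr (- \<alpha>) * (\<mu> / (\<mu> - 1)))"
      by blast
  qed
  then show ?thesis by (simp add: limit_mass_far[OF \<delta>])
qed

end

context brw_large_deviations
begin

section \<open>The limit measure and convergence\<close>

definition limit_measure :: "real measure measure" where
  "limit_measure = measure_of (space borel_M0) (sets borel_M0) limit_mass"

lemma sets_limit_measure: "sets limit_measure = sets borel_M0"
  unfolding limit_measure_def by (rule sets.sets_measure_of_eq)

lemma emeasure_limit_measure:
  assumes "A \<in> sets borel_M0"
  shows "emeasure limit_measure A = limit_mass A"
proof (rule emeasure_measure_of[OF limit_measure_def])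
  show "sets borel_M0 \<subseteq> Pow (space borel_M0)" by (rule sets.space_closed)
  show "positive (sets limit_measure) limit_mass"
    by (simp add: positive_def limit_mass_def)
  show "countably_additive (sets limit_measure) limit_mass"
    unfolding countably_additive_def sets_limit_measure
  proof (intro allI impI)
    fix B :: "nat \<Rightarrow> real measure set"
    assume B: "range B \<subseteq> sets borel_M0" "disjoint_family B"
    have "(\<Sum>i. emeasure (nu \<alpha> q) {x. spike k x \<in> B i}) = emeasure (nu \<alpha> q) {x. spike k x \<in> (\<Union>i. B i)}" for k
    proof -
      have "(\<Sum>i. emeasure (nu \<alpha> q) {x. spike k x \<in> B i}) = emeasure (nu \<alpha> q) (\<Union>i. {x. spike k x \<in> B i})"
      proof (rule suminf_emeasure)
        show "range (\<lambda>i. {x. spike k x \<in> B i}) \<subseteq> sets (nu \<alpha> q)"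
        proof (rule image_subsetI)
          fix i
          have "B i \<in> sets borel_M0" using B(1) by blast
          then show "{x. spike k x \<in> B i} \<in> sets (nu \<alpha> q)" unfolding sets_nu by (rule spike_in_sets)
        qed
        show "disjoint_family (\<lambda>i. {x. spike k x \<in> B i})"
          using B(2) unfolding disjoint_family_on_def by blast
      qed
      also have "(\<Union>i. {x. spike k x \<in> B i}) = {x. spike k x \<in> (\<Union>i. B i)}" by blast
      finally show ?thesis .
    qed
    then have "limit_mass (\<Union>i. B i) = (\<integral>\<^sup>+ l. \<integral>\<^sup>+ e. (\<Sum>i. emeasure (nu \<alpha> q) {x. spike (gsize l e) x \<in> B i})
        \<partial>env_law \<partial>generation_weight)"
      unfolding limit_mass_def by (simp only:)
    also have "\<dots> = (\<integral>\<^sup>+ l. (\<Sum>i. \<integral>\<^sup>+ e. emeasure (nu \<alpha> q) {x. spike (gsize l e) x \<in> B i} \<partial>env_law) \<partial>generation_weight)"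
      by (intro nn_integral_cong nn_integral_suminf measurable_gsize_comp)
    also have "\<dots> = (\<Sum>i. limit_mass (B i))"
      unfolding limit_mass_def by (rule nn_integral_suminf) (rule measurable_generation_weight)
    finally show "(\<Sum>i. limit_mass (B i)) = limit_mass (\<Union>i. B i)" ..
  qed
  show "A \<in> sets limit_measure" using assms by (simp add: sets_limit_measure)
qed

text \<open>The finite configurations and the multiples \<open>k \<delta>\<^sub>x\<close> that lie in \<open>K\<close> belong to \<open>far \<delta>\<close> for some \<open>\<delta>\<close>, because the complement of
\<open>K\<close> is a neighbourhood of the null measure. Inside \<open>far \<delta>\<close> the total mass has the right upper limit, and the part
outside \<open>K\<close> is open and has the right lower limit.\<close>

lemma limsup_le_limit_mass_closed:
  assumes F: "closedin vague_topology K" and null: "null_point_measure \<notin> K"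
  shows "limsup (\<lambda>n. scaled_prob n K) \<le> limit_mass K"
proof -
  let ?O = "point_measures - K"
  have O: "openin vague_topology ?O" using F by (simp add: closedin_def)
  have null_O: "null_point_measure \<in> ?O" using null by simp
  then have spike_O: "spike 0 0 \<in> ?O" by (simp only: spike_null(1))
  \<comment> \<open>one radius for configurations indexed by labels and one for \<open>spike\<close>, which is indexed by numbers\<close>
  obtain \<delta>1 where \<delta>1: "\<delta>1 > 0" "\<And>(I :: nat list set) D y. finite I \<Longrightarrow> D \<subseteq> I \<Longrightarrow> card D = 0 \<Longrightarrow>
      \<forall>i\<in>D. \<bar>y i - 0\<bar> \<le> \<delta>1 \<Longrightarrow> \<forall>i\<in>I - D. \<bar>y i\<bar> \<le> \<delta>1 \<Longrightarrow> dirac_sum I y \<in> ?O"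
    by (rule stable_under_perturbation[OF O spike_O]) blast
  obtain \<delta>2 where \<delta>2: "\<delta>2 > 0" "\<And>(I :: nat set) D y. finite I \<Longrightarrow> D \<subseteq> I \<Longrightarrow> card D = 0 \<Longrightarrow>
      \<forall>i\<in>D. \<bar>y i - 0\<bar> \<le> \<delta>2 \<Longrightarrow> \<forall>i\<in>I - D. \<bar>y i\<bar> \<le> \<delta>2 \<Longrightarrow> dirac_sum I y \<in> ?O"
    by (rule stable_under_perturbation[OF O spike_O]) blast
  define \<delta> where "\<delta> = min \<delta>1 \<delta>2"
  have \<delta>: "\<delta> > 0" using \<delta>1(1) \<delta>2(1) by (simp add: \<delta>_def)
  have config_far: "config n e \<in> far \<delta>" if "config n e \<in> K" for n e
  proof (rule ccontr)
    assume "config n e \<notin> far \<delta>"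
    then have "\<forall>v\<in>generation e n. \<bar>position e v / \<gamma> n\<bar> \<le> \<delta>1"
      using \<delta> by (auto simp: config_def dirac_sum_in_far_iff finite_generation \<delta>_def not_less)
    then have "config n e \<in> ?O"
      unfolding config_def by (intro \<delta>1(2)[of _ "{}"]) (simp_all add: finite_generation)
    with that show False by simp
  qed
  have spike_far: "spike k x \<in> far \<delta>" if "spike k x \<in> K" for k x
  proof (rule ccontr)
    assume "spike k x \<notin> far \<delta>"
    then have "\<forall>i\<in>{..<k}. \<bar>x\<bar> \<le> \<delta>2"
      using \<delta> by (auto simp: dirac_sum_in_far_iff \<delta>_def not_less)
    then have "spike k x \<in> ?O"
      by (intro \<delta>2(2)[of _ "{}"]) simp_all
    with that show False by simp
  qed
  let ?G = "far \<delta> \<inter> ?O"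
  have G: "openin vague_topology ?G" "null_point_measure \<notin> ?G"
    using null_notin_far[OF \<delta>] by (auto intro: openin_Int openin_far[OF \<delta>] O)
  have sets: "K \<in> sets borel_M0" "?G \<in> sets borel_M0" "far \<delta> \<in> sets borel_M0"
    using closed_in_sets_borel_M0[OF F null] open_in_sets_borel_M0[OF G]
      open_in_sets_borel_M0[OF openin_far[OF \<delta>] null_notin_far[OF \<delta>]] by auto
  show ?thesis
  proof (rule limsup_le_by_complement)
    show "scaled_prob n K +
        scaled_prob n ?G \<le>
        scaled_prob n (far \<delta>)" for n
    proof -
      have "emeasure env_law {e. config n e \<in> K} + emeasure env_law {e. config n e \<in> ?G} =
          emeasure env_law ({e. config n e \<in> K} \<union> {e. config n e \<in> ?G})"
        by (rule plus_emeasure[OF config_in_sets[OF sets(1)] config_in_sets[OF sets(2)]]) auto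
      also have "\<dots> \<le> emeasure env_law {e. config n e \<in> far \<delta>}"
        by (rule emeasure_mono[OF _ config_in_sets[OF sets(3)]]) (use config_far in blast)
      finally show ?thesis by (simp add: distrib_left[symmetric] mult_left_mono)
    qed
    show "limsup (\<lambda>n. scaled_prob n (far \<delta>)) \<le> limit_mass (far \<delta>)"
      by (rule limsup_far_le[OF \<delta>])
    show "limit_mass ?G \<le> liminf (\<lambda>n. scaled_prob n ?G)"
      by (rule limit_mass_le_liminf[OF G])
    show "limit_mass (far \<delta>) < \<top>" by (simp add: limit_mass_far[OF \<delta>])
    have "far \<delta> \<subseteq> K \<union> ?G" by (auto simp: far_def)
    then have "emeasure limit_measure (far \<delta>) \<le> emeasure limit_measure (K \<union> ?G)"
      using sets by (intro emeasure_mono) (simp_all add: sets_limit_measure)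
    also have "\<dots> \<le> emeasure limit_measure K + emeasure limit_measure ?G"
      using sets by (intro emeasure_subadditive) (simp_all add: sets_limit_measure)
    finally show "limit_mass (far \<delta>) \<le> limit_mass K + limit_mass ?G"
      by (simp only: emeasure_limit_measure sets)
  qed
qed

text \<open>The interior and the closure of \<open>A\<close> have the same limit mass as \<open>A\<close>.\<close>

lemma tendsto_limit_mass:
  assumes A: "A \<in> sets borel_M0" and frontier: "limit_mass (vague_topology frontier_of A) = 0"
    and null: "null_point_measure \<notin> vague_topology closure_of A"
  shows "(\<lambda>n. scaled_prob n A) \<longlonglongrightarrow> limit_mass A"
proof -
  let ?p = "\<lambda>B n. scaled_prob n B"
  let ?I = "vague_topology interior_of A" and ?C = "vague_topology closure_of A"
  have A_sub: "A \<subseteq> topspace vague_topology"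
  proof (rule order_trans)
    show "A \<subseteq> nonnull_point_measures"
      using sets.sets_into_space[OF A] unfolding space_borel_M0 .
    show "nonnull_point_measures \<subseteq> topspace vague_topology"
      unfolding nonnull_point_measures_def topspace_vague by (rule Diff_subset)
  qed
  have IA: "?I \<subseteq> A" by (rule interior_of_subset)
  have AC: "A \<subseteq> ?C" by (rule closure_of_subset[OF A_sub])
  have null_I: "null_point_measure \<notin> ?I" using null IA AC by blast
  have I: "?I \<in> sets borel_M0" by (intro open_in_sets_borel_M0 null_I) simp
  have C: "?C \<in> sets borel_M0" by (intro closed_in_sets_borel_M0 null) simp
  have mono: "?p B n \<le> ?p B' n" if "B \<subseteq> B'" "B' \<in> sets borel_M0" for B B' n
    using that by (intro mult_left_mono emeasure_mono config_in_sets) auto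
  have mass_mono: "limit_mass B \<le> limit_mass B'" if "B \<subseteq> B'" "B \<in> sets borel_M0" "B' \<in> sets borel_M0" for B B'
    using emeasure_mono[of B B' limit_measure] that by (simp add: sets_limit_measure emeasure_limit_measure)
  have fr: "vague_topology frontier_of A = ?C - ?I" by (simp add: frontier_of_def)
  have "limit_mass ?C \<le> limit_mass ?I + limit_mass (?C - ?I)"
  proof -
    have "emeasure limit_measure ?C \<le> emeasure limit_measure (?I \<union> (?C - ?I))"
      using I C by (intro emeasure_mono) (auto simp: sets_limit_measure)
    also have "\<dots> \<le> emeasure limit_measure ?I + emeasure limit_measure (?C - ?I)"
      using I C by (intro emeasure_subadditive) (auto simp: sets_limit_measure)
    finally show ?thesis using I C by (simp add: emeasure_limit_measure sets.Diff)
  qed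
  then have CI: "limit_mass ?C \<le> limit_mass ?I" using frontier by (simp add: fr)
  have "limsup (?p A) \<le> limsup (?p ?C)"
    by (intro Limsup_mono always_eventually allI mono AC C)
  also have "\<dots> \<le> limit_mass ?C" by (rule limsup_le_limit_mass_closed[OF closedin_closure_of null])
  also have "\<dots> \<le> limit_mass ?I" by (rule CI)
  finally have upper: "limsup (?p A) \<le> limit_mass A" using mass_mono[OF IA I A] by (rule order_trans)
  have "limit_mass A \<le> limit_mass ?C" by (rule mass_mono[OF AC A C])
  also note CI
  also have "limit_mass ?I \<le> liminf (?p ?I)" by (rule limit_mass_le_liminf[OF openin_interior_of null_I])
  also have "\<dots> \<le> liminf (?p A)" by (intro Liminf_mono always_eventually allI mono IA A)
  finally have lower: "limit_mass A \<le> liminf (?p A)" .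
  have "liminf (?p A) \<le> limsup (?p A)" by (rule Liminf_le_Limsup) simp
  then show ?thesis
    using upper lower by (intro Liminf_eq_Limsup) auto
qed

lemma limit_measure_nonzero: "emeasure limit_measure (space limit_measure) \<noteq> 0"
proof -
  have "far 1 \<in> sets borel_M0"
    by (intro open_in_sets_borel_M0 openin_far null_notin_far) simp_all
  then have "limit_mass (far 1) \<le> emeasure limit_measure (space limit_measure)"
    by (metis emeasure_limit_measure emeasure_space)
  moreover have "limit_mass (far 1) > 0"
    using supercritical by (simp add: limit_mass_far)
  ultimately show ?thesis by auto
qed

end

lemma reproduction_law_eq_product:
  assumes "prob_space P"
    and Z_X: "indep_rv P (count_space UNIV) Z (PiM UNIV (\<lambda>_. borel)) (\<lambda>\<omega> i. X i \<omega>)"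
    and X: "prob_space.indep_vars P (\<lambda>_. borel) X UNIV" and same: "\<And>i. distr P borel (X i) = distr P borel (X 0)"
  shows "reproduction_law P Z X = distr P (count_space UNIV) Z \<Otimes>\<^sub>M PiM UNIV (\<lambda>_. distr P borel (X 0))"
proof -
  interpret P: prob_space P by fact
  let ?X = "\<lambda>\<omega> i. X i \<omega>" and ?B = "PiM UNIV (\<lambda>_ :: nat. borel :: real measure)"
  have Z_meas [measurable]: "Z \<in> measurable P (count_space UNIV)" and X_meas [measurable]: "?X \<in> measurable P ?B"
    using Z_X by (auto simp: indep_rv_def)
  have Xi: "X i \<in> borel_measurable P" for i
    using X by (auto simp: P.indep_vars_def)
  have "distr P ?B ?X = PiM UNIV (\<lambda>i. distr P borel (X i))"
    using iffD1[OF P.indep_vars_iff_distr_eq_PiM[OF UNIV_not_empty Xi] X] by (simp only: restrict_UNIV)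
  also have "\<dots> = PiM UNIV (\<lambda>_. distr P borel (X 0))"
    by (rule PiM_cong[OF refl same])
  finally have X_law: "distr P ?B ?X = PiM UNIV (\<lambda>_. distr P borel (X 0))" .
  have "distr P (count_space UNIV) Z \<Otimes>\<^sub>M distr P ?B ?X = reproduction_law P Z X"
    unfolding reproduction_law_def
  proof (rule pair_measure_eqI)
    show "sigma_finite_measure (distr P (count_space UNIV) Z)" "sigma_finite_measure (distr P ?B ?X)"
      by (intro prob_space_imp_sigma_finite P.prob_space_distr Z_meas X_meas)+
    show "sets (distr P (count_space UNIV) Z \<Otimes>\<^sub>M distr P ?B ?X) =
        sets (distr P reproduction_space (\<lambda>\<omega>. (Z \<omega>, ?X \<omega>)))"
      unfolding sets_distr by (rule sets_pair_measure_cong) simp_all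
    fix A C assume "A \<in> sets (distr P (count_space UNIV) Z)" "C \<in> sets (distr P ?B ?X)"
    then have AC [measurable]: "A \<in> sets (count_space UNIV)" "C \<in> sets ?B" by simp_all
    have "P.indep_set {Z -` A \<inter> space P | A. A \<in> sets (count_space UNIV)} {?X -` B \<inter> space P | B. B \<in> sets ?B}"
      using Z_X by (simp add: indep_rv_def)
    then have "P.prob ((Z -` A \<inter> space P) \<inter> (?X -` C \<inter> space P)) = P.prob (Z -` A \<inter> space P) * P.prob (?X -` C \<inter> space P)"
      by (rule P.indep_setD) (use AC in blast)+
    moreover have "(\<lambda>\<omega>. (Z \<omega>, ?X \<omega>)) -` (A \<times> C) \<inter> space P = (Z -` A \<inter> space P) \<inter> (?X -` C \<inter> space P)" by auto
    ultimately show "emeasure (distr P (count_space UNIV) Z) A * emeasure (distr P ?B ?X) C =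
        emeasure (distr P reproduction_space (\<lambda>\<omega>. (Z \<omega>, ?X \<omega>))) (A \<times> C)"
      using AC by (simp add: emeasure_distr P.emeasure_eq_measure ennreal_mult'[symmetric])
  qed
  then show ?thesis by (simp add: X_law)
qed

theorem theorem1p4:
  fixes P :: "'a measure" and Z :: "'a \<Rightarrow> nat" and X :: "nat \<Rightarrow> 'a \<Rightarrow> real"
    and M :: "'b measure" and E :: "nat list \<Rightarrow> 'b \<Rightarrow> reproduction"
    and \<alpha> q \<mu> :: real and L :: "real \<Rightarrow> real" and \<gamma> b r :: "nat \<Rightarrow> real"
  assumes "prob_space P"
    and "indep_rv P (count_space UNIV) Z (PiM UNIV (\<lambda>_. borel)) (\<lambda>\<omega> i. X i \<omega>)"
    and "prob_space.indep_vars P (\<lambda>_. borel) X UNIV"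
    and "\<And>i. distr P borel (X i) = distr P borel (X 0)"
    and "\<alpha> > 0" and "slowly_varying L" and "0 \<le> q" and "q \<le> 1"
    and "\<And>x. x > 0 \<Longrightarrow> \<P>(\<omega> in P. \<bar>X 0 \<omega>\<bar> > x) = x powr (- \<alpha>) * L x"
    and "((\<lambda>x. \<P>(\<omega> in P. X 0 \<omega> > x) / \<P>(\<omega> in P. \<bar>X 0 \<omega>\<bar> > x)) \<longlongrightarrow> q) at_top"
    and "\<P>(\<omega> in P. Z \<omega> \<ge> 1) = 1"
    and "integrable P (\<lambda>\<omega>. real (Z \<omega>))"
    and "\<mu> = (\<integral>\<omega>. real (Z \<omega>) \<partial>P)" and "\<mu> > 1"
    and "integrable P (\<lambda>\<omega>. real (Z \<omega>) * log_plus (real (Z \<omega>)))"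
    and "prob_space M" and "branching_random_walk (reproduction_law P Z X) M E"
    and "\<And>n. n \<ge> 1 \<Longrightarrow> \<gamma> n > 0"
    and "\<And>n. n \<ge> 1 \<Longrightarrow> b n = Inf {x. \<P>(\<omega> in P. \<bar>X 0 \<omega>\<bar> > x) \<le> 1 / \<mu> ^ n}"
    and "b \<in> o(\<gamma>)"
    and "\<And>n. n \<ge> 1 \<Longrightarrow> r n = 1 / (\<mu> ^ n * \<P>(\<omega> in P. \<bar>X 0 \<omega>\<bar> > \<gamma> n))"
  shows "\<exists>m :: real measure measure.
    sets m = sets borel_M0 \<and> emeasure m (space m) \<noteq> 0 \<and>
    (\<forall>A \<in> sets borel_M0.
       emeasure m (vague_topology frontier_of A) = 0 \<and>
       null_point_measure \<notin> vague_topology closure_of A \<longrightarrow>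
       (\<lambda>n. ennreal (r n * \<P>(\<omega> in M. scaled_generation E (\<gamma> n) n \<omega> \<in> A)))
         \<longlonglongrightarrow> emeasure m A) \<and>
    (\<forall>A \<in> sets borel_M0.
       emeasure m A =
         (\<Sum>l. ennreal (1 / \<mu> ^ l) *
           (\<integral>\<^sup>+ \<omega>. emeasure (nu \<alpha> q)
              {x. scale_measure (of_nat (generation_size E l \<omega>)) (return R0 x) \<in> A} \<partial>M)))"
proof -
  interpret P: prob_space P by fact
  interpret M: prob_space M by fact
  define \<zeta> where "\<zeta> = distr P (count_space UNIV) Z"
  define F where "F = distr P borel (X 0)"
  have Z [measurable]: "Z \<in> measurable P (count_space UNIV)"
    using assms(2) by (simp add: indep_rv_def)
  have X0 [measurable]: "X 0 \<in> borel_measurable P"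
    using assms(3) by (simp add: P.indep_vars_def)
  have F_measure: "measure F {y. Q y} = \<P>(\<omega> in P. Q (X 0 \<omega>))" if "Measurable.pred borel Q" for Q
  proof -
    have "{y. Q y} \<in> sets borel" using that by (simp add: pred_def)
    then show ?thesis by (simp add: F_def measure_distr vimage_def Int_def conj_commute)
  qed
  have F_abs: "measure F {y. \<bar>y\<bar> > x} = \<P>(\<omega> in P. \<bar>X 0 \<omega>\<bar> > x)" for x
    by (rule F_measure) measurable
  have F_gt: "measure F {y. y > x} = \<P>(\<omega> in P. X 0 \<omega> > x)" for x
    by (rule F_measure) measurable
  have tail_eq: "heavy_tail.tail F x = \<P>(\<omega> in P. \<bar>X 0 \<omega>\<bar> > x)" if "heavy_tail F \<alpha> q L" for x
    using that by (simp add: heavy_tail.tail_def F_abs)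
  have ht: "heavy_tail F \<alpha> q L"
  proof (rule heavy_tail.intro)
    show "prob_space F" unfolding F_def by (rule P.prob_space_distr[OF X0])
    show "((\<lambda>x. measure F {y. y > x} / measure F {y. \<bar>y\<bar> > x}) \<longlongrightarrow> q) at_top"
      unfolding F_abs F_gt by fact
  qed (use assms(5-9) in \<open>simp_all add: F_def F_abs[unfolded F_def]\<close>)
  interpret brw_large_deviations \<zeta> F \<mu> \<alpha> q L \<gamma> b
  proof (intro brw_large_deviations.intro branching_moments.intro heavy_tail_scaling.intro)
    show "branching \<zeta> F"
    proof (rule branching.intro)
      show "prob_space \<zeta>" unfolding \<zeta>_def by (rule P.prob_space_distr[OF Z])
      show "prob_space F" unfolding F_def by (rule P.prob_space_distr[OF X0])
    qed (simp_all add: \<zeta>_def F_def)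
    show "branching_moments_axioms \<zeta> \<mu>"
    proof (rule branching_moments_axioms.intro)
      show "integrable \<zeta> real" "integrable \<zeta> (\<lambda>z. real z * log_plus (real z))"
        unfolding \<zeta>_def using assms(12,15) by (simp_all add: integrable_distr_eq)
      show "\<mu> = (\<integral>z. real z \<partial>\<zeta>)"
        unfolding \<zeta>_def assms(13) by (simp add: integral_distr)
    qed fact
    show "heavy_tail F \<alpha> q L" by (rule ht)
    show "heavy_tail_scaling_axioms F \<mu> \<gamma> b"
    proof (rule heavy_tail_scaling_axioms.intro)
      show "b n = Inf {x. heavy_tail.tail F x \<le> 1 / \<mu> ^ n}" if "1 \<le> n" for n
        unfolding tail_eq[OF ht] by (rule assms(19)[OF that])
    qed (fact assms(14,18,20))+
    show "brw_large_deviations_axioms \<zeta>"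
    proof (rule brw_large_deviations_axioms.intro)
      have "AE \<omega> in P. Z \<omega> \<ge> 1" using assms(11) by (subst (asm) P.prob_Collect_eq_1) simp_all
      then show "AE z in \<zeta>. 1 \<le> z" unfolding \<zeta>_def by (simp add: AE_distr_iff)
    qed
  qed
  have "reproduction_law P Z X = rep_law"
    unfolding rep_law_def unfolding \<zeta>_def F_def by (rule reproduction_law_eq_product[OF assms(1-4)])
  then have E_indep: "M.indep_vars (\<lambda>_. reproduction_space) E UNIV"
    and E_law: "distr M reproduction_space (E v) = rep_law" for v
    using assms(17) by (auto simp: branching_random_walk_def)
  have E_meas: "E v \<in> measurable M reproduction_space" for v
    using E_indep by (auto simp: M.indep_vars_def)
  define env where "env \<omega> = (\<lambda>v. E v \<omega>)" for \<omega>
  have env_meas: "env \<in> measurable M environment_space"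
    unfolding env_def using E_meas by (intro measurable_PiM_single') (auto simp: space_PiM space_pair_measure)
  have env_distr: "distr M environment_space env = env_law"
    using iffD1[OF M.indep_vars_iff_distr_eq_PiM[OF UNIV_not_empty E_meas] E_indep]
    by (simp only: restrict_UNIV E_law env_law_def env_def [abs_def])
  have scaled: "scaled_generation E (\<gamma> n) n \<omega> = config n (env \<omega>)" for n \<omega>
    by (simp add: scaled_generation_def config_def env_def Let_def)
  have prob: "ennreal \<P>(\<omega> in M. scaled_generation E (\<gamma> n) n \<omega> \<in> A) = emeasure env_law {e. config n e \<in> A}"
    if A: "A \<in> sets borel_M0" for A n
  proof -
    have "{e. config n e \<in> A} \<in> sets environment_space"
      using config_in_sets[OF A] by (simp add: sets_env_law)
    then have "emeasure (distr M environment_space env) {e. config n e \<in> A} =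
        emeasure M (env -` {e. config n e \<in> A} \<inter> space M)"
      by (rule emeasure_distr[OF env_meas])
    moreover have "env -` {e. config n e \<in> A} \<inter> space M = {\<omega> \<in> space M. scaled_generation E (\<gamma> n) n \<omega> \<in> A}"
      by (auto simp: scaled)
    ultimately show ?thesis by (simp add: env_distr M.emeasure_eq_measure)
  qed
  have mass: "limit_mass A = (\<Sum>l. ennreal (1 / \<mu> ^ l) * (\<integral>\<^sup>+ \<omega>. emeasure (nu \<alpha> q)
      {x. scale_measure (of_nat (generation_size E l \<omega>)) (return R0 x) \<in> A} \<partial>M))" for A
  proof -
    have "(\<integral>\<^sup>+ e. emeasure (nu \<alpha> q) {x. spike (gsize l e) x \<in> A} \<partial>env_law) =
        (\<integral>\<^sup>+ \<omega>. emeasure (nu \<alpha> q) {x. spike (gsize l (env \<omega>)) x \<in> A} \<partial>M)" for l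
      unfolding env_distr[symmetric]
      by (rule nn_integral_distr[OF env_meas], unfold env_distr)
        (rule measurable_gsize_comp[of "\<lambda>k. emeasure (nu \<alpha> q) {x. spike k x \<in> A}"])
    then show ?thesis
      unfolding limit_mass_def nn_integral_generation_weight scale_return_eq_dirac_sum
      by (simp only: generation_size_def env_def)
  qed
  show ?thesis
  proof (intro exI[of _ limit_measure] conjI ballI impI)
    show "sets limit_measure = sets borel_M0" by (rule sets_limit_measure)
    show "emeasure limit_measure (space limit_measure) \<noteq> 0" by (rule limit_measure_nonzero)
    fix A assume A: "A \<in> sets borel_M0"
    show "emeasure limit_measure A = (\<Sum>l. ennreal (1 / \<mu> ^ l) * (\<integral>\<^sup>+ \<omega>. emeasure (nu \<alpha> q)
        {x. scale_measure (of_nat (generation_size E l \<omega>)) (return R0 x) \<in> A} \<partial>M))"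
      unfolding emeasure_limit_measure[OF A] by (rule mass)
  next
    fix A assume A: "A \<in> sets borel_M0"
      and "emeasure limit_measure (vague_topology frontier_of A) = 0 \<and> null_point_measure \<notin> vague_topology closure_of A"
    then have frontier: "emeasure limit_measure (vague_topology frontier_of A) = 0"
      and null: "null_point_measure \<notin> vague_topology closure_of A" by auto
    have "null_point_measure \<notin> vague_topology frontier_of A"
      using null by (simp add: frontier_of_def)
    then have "vague_topology frontier_of A \<in> sets borel_M0"
      by (intro closed_in_sets_borel_M0 closedin_frontier_of)
    then have "limit_mass (vague_topology frontier_of A) = 0"
      using frontier by (simp add: emeasure_limit_measure)
    from tendsto_limit_mass[OF A this null]
    have "(\<lambda>n. scaled_prob n A) \<longlonglongrightarrow> emeasure limit_measure A"
      by (simp only: emeasure_limit_measure[OF A])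
    moreover have "\<forall>\<^sub>F n in sequentially. scaled_prob n A =
        ennreal (r n * \<P>(\<omega> in M. scaled_generation E (\<gamma> n) n \<omega> \<in> A))"
      using eventually_ge_at_top[of 1]
    proof eventually_elim
      case (elim n)
      have "r n = rate n" using assms(21)[OF elim] by (simp add: rate_def tail_eq[OF ht])
      then show ?case using rate_pos[of n] by (simp only: prob[OF A, symmetric]) (simp add: ennreal_mult')
    qed
    ultimately show "(\<lambda>n. ennreal (r n * \<P>(\<omega> in M. scaled_generation E (\<gamma> n) n \<omega> \<in> A))) \<longlonglongrightarrow> emeasure limit_measure A"
      by (rule Lim_transform_eventually)
  qed
qed

end
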